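(* Let $\varphi:\Lambda\to\Gamma$ be a regular covering map of finite simplicial graphs such that $\Gamma$ (and hence $\Lambda$) has no isolated vertices. Then the group $\mathrm{LPAut}(\varphi)$ of liftable conjugating automorphisms of $A_\Gamma$ is generated by liftable partial conjugations.
   Context: Graphs are finite simplicial graphs; subgraphs are induced subgraphs. For a graph $\Gamma$, the right-angled Artin group is $A_\Gamma=\langle v\in V\Gamma \mid [u,v]=1 \text{ for every edge } \{u,v\}\rangle$. For a vertex $v$, $\mathrm{lk}(v)$ is the subgraph induced by the vertices adjacent to $v$ and $\mathrm{st}(v)$ the subgraph induced by $\mathrm{lk}(v)\cup\{v\}$. A covering map of graphs $\varphi:\Lambda\to\Gamma$ is a surjective simplicial map which, for every vertex $u$ of $\Lambda$, maps the set of neighbours of $u$ bijectively onto the set of neighbours of $\varphi(u)$. $\mathrm{Deck}(\varphi)$ is the group of graph automorphisms $\mu$ of $\Lambda$ with $\varphi\circ\mu=\varphi$; $\varphi$ is regular if $\mathrm{Deck}(\varphi)$ acts transitively on every fiber $\varphi^{-1}(v)$. The map $\varphi$ induces a surjective homomorphism $\phi:A_\Lambda\to A_\Gamma$, $u\mapsto\varphi(u)$. An automorphism $f$ of $A_\Gamma$ is liftable if there exists $F\in\mathrm{Aut}(A_\Lambda)$ (a lift of $f$) with $f\circ\phi=\phi\circ F$. An automorphism of $A_\Gamma$ is conjugating if it sends each vertex generator $v$ to a conjugate of $v$. For a vertex $v$ and a union $C$ of connected components of $\Gamma\setminus\mathrm{st}(v)$, the partial conjugation $P^v_C$ is the automorphism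 of $A_\Gamma$ sending each vertex $w$ of $C$ to $vwv^{-1}$ and fixing all other vertices. *)

theory Defs
  imports "HOL-Algebra.Algebra"
begin

definition simple_graph :: "'v set \<Rightarrow> ('v \<Rightarrow> 'v \<Rightarrow> bool) \<Rightarrow> bool" where
  "simple_graph V E \<longleftrightarrow> finite V \<and> (\<forall>u w. E u w \<longrightarrow> u \<in> V \<and> w \<in> V)
     \<and> (\<forall>u w. E u w \<longrightarrow> E w u) \<and> (\<forall>u. \<not> E u u)"

definition no_isolated :: "'v set \<Rightarrow> ('v \<Rightarrow> 'v \<Rightarrow> bool) \<Rightarrow> bool" where
  "no_isolated V E \<longleftrightarrow> (\<forall>v\<in>V. \<exists>w. E v w)"

definition nbrs :: "'v set \<Rightarrow> ('v \<Rightarrow> 'v \<Rightarrow> bool) \<Rightarrow> 'v \<Rightarrow> 'v set" where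
  "nbrs V E u = {w \<in> V. E u w}"

definition star :: "'v set \<Rightarrow> ('v \<Rightarrow> 'v \<Rightarrow> bool) \<Rightarrow> 'v \<Rightarrow> 'v set" where
  "star V E v = insert v (nbrs V E v)"

definition union_of_components_compl_star ::
  "'v set \<Rightarrow> ('v \<Rightarrow> 'v \<Rightarrow> bool) \<Rightarrow> 'v \<Rightarrow> 'v set \<Rightarrow> bool" where
  "union_of_components_compl_star V E v C \<longleftrightarrow>
     C \<subseteq> V - star V E v \<and>
     (\<forall>x\<in>C. \<forall>y\<in>V - star V E v. E x y \<longrightarrow> y \<in> C)"

definition covering_map ::
  "'w set \<Rightarrow> ('w \<Rightarrow> 'w \<Rightarrow> bool) \<Rightarrow> 'v set \<Rightarrow> ('v \<Rightarrow> 'v \<Rightarrow> bool) \<Rightarrow> ('w \<Rightarrow> 'v) \<Rightarrow> bool" where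
  "covering_map VL EL VG EG \<phi> \<longleftrightarrow>
     \<phi> ` VL = VG \<and>
     (\<forall>u u'. EL u u' \<longrightarrow> EG (\<phi> u) (\<phi> u')) \<and>
     (\<forall>u\<in>VL. bij_betw \<phi> (nbrs VL EL u) (nbrs VG EG (\<phi> u)))"

definition graph_auto :: "'w set \<Rightarrow> ('w \<Rightarrow> 'w \<Rightarrow> bool) \<Rightarrow> ('w \<Rightarrow> 'w) \<Rightarrow> bool" where
  "graph_auto V E \<mu> \<longleftrightarrow> bij_betw \<mu> V V \<and> (\<forall>u\<in>V. \<forall>u'\<in>V. E (\<mu> u) (\<mu> u') \<longleftrightarrow> E u u')"

definition Deck ::
  "'w set \<Rightarrow> ('w \<Rightarrow> 'w \<Rightarrow> bool) \<Rightarrow> ('w \<Rightarrow> 'v) \<Rightarrow> ('w \<Rightarrow> 'w) set" where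
  "Deck VL EL \<phi> = {\<mu>. graph_auto VL EL \<mu> \<and> (\<forall>u\<in>VL. \<phi> (\<mu> u) = \<phi> u)}"

definition regular_covering ::
  "'w set \<Rightarrow> ('w \<Rightarrow> 'w \<Rightarrow> bool) \<Rightarrow> 'v set \<Rightarrow> ('v \<Rightarrow> 'v \<Rightarrow> bool) \<Rightarrow> ('w \<Rightarrow> 'v) \<Rightarrow> bool" where
  "regular_covering VL EL VG EG \<phi> \<longleftrightarrow> covering_map VL EL VG EG \<phi> \<and>
     (\<forall>u\<in>VL. \<forall>u'\<in>VL. \<phi> u = \<phi> u' \<longrightarrow> (\<exists>\<mu>\<in>Deck VL EL \<phi>. \<mu> u = u'))"

text \<open>Words: lists of letters (v, True) = v and (v, False) = v^-1.\<close>

definition raag_words :: "'v set \<Rightarrow> ('v \<times> bool) list set" where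
  "raag_words V = {w. \<forall>x\<in>set w. fst x \<in> V}"

inductive raag_rel :: "('v \<Rightarrow> 'v \<Rightarrow> bool) \<Rightarrow> ('v \<times> bool) list \<Rightarrow> ('v \<times> bool) list \<Rightarrow> bool"
  for E where
  refl: "raag_rel E xs xs"
| sym: "raag_rel E xs ys \<Longrightarrow> raag_rel E ys xs"
| trans: "raag_rel E xs ys \<Longrightarrow> raag_rel E ys zs \<Longrightarrow> raag_rel E xs zs"
| cancel: "raag_rel E (xs @ [(v, b), (v, \<not> b)] @ ys) (xs @ ys)"
| commute: "E u v \<Longrightarrow> raag_rel E (xs @ [(u, a), (v, b)] @ ys) (xs @ [(v, b), (u, a)] @ ys)"

definition raag_eq :: "'v set \<Rightarrow> ('v \<Rightarrow> 'v \<Rightarrow> bool) \<Rightarrow> (('v \<times> bool) list \<times> ('v \<times> bool) list) set" where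
  "raag_eq V E = {(x, y). x \<in> raag_words V \<and> y \<in> raag_words V \<and> raag_rel E x y}"

definition RAAG :: "'v set \<Rightarrow> ('v \<Rightarrow> 'v \<Rightarrow> bool) \<Rightarrow> ('v \<times> bool) list set monoid" where
  "RAAG V E = \<lparr> carrier = raag_words V // raag_eq V E,
     monoid.mult = (\<lambda>A B. \<Union>a\<in>A. \<Union>b\<in>B. raag_eq V E `` {a @ b}),
     one = raag_eq V E `` {[]} \<rparr>"

definition raag_gen :: "'v set \<Rightarrow> ('v \<Rightarrow> 'v \<Rightarrow> bool) \<Rightarrow> 'v \<Rightarrow> ('v \<times> bool) list set" where
  "raag_gen V E v = raag_eq V E `` {[(v, True)]}"

definition induced_hom ::
  "'w set \<Rightarrow> ('w \<Rightarrow> 'w \<Rightarrow> bool) \<Rightarrow> 'v set \<Rightarrow> ('v \<Rightarrow> 'v \<Rightarrow> bool) \<Rightarrow> ('w \<Rightarrow> 'v)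
     \<Rightarrow> ('w \<times> bool) list set \<Rightarrow> ('v \<times> bool) list set" where
  "induced_hom VL EL VG EG \<phi> = (\<lambda>A \<in> carrier (RAAG VL EL).
      raag_eq VG EG `` {map (\<lambda>(x, b). (\<phi> x, b)) (SOME a. a \<in> A)})"

definition liftable ::
  "'w set \<Rightarrow> ('w \<Rightarrow> 'w \<Rightarrow> bool) \<Rightarrow> 'v set \<Rightarrow> ('v \<Rightarrow> 'v \<Rightarrow> bool) \<Rightarrow> ('w \<Rightarrow> 'v)
     \<Rightarrow> (('v \<times> bool) list set \<Rightarrow> ('v \<times> bool) list set) \<Rightarrow> bool" where
  "liftable VL EL VG EG \<phi> f \<longleftrightarrow>
     (\<exists>F \<in> auto (RAAG VL EL). \<forall>x \<in> carrier (RAAG VL EL).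
        f (induced_hom VL EL VG EG \<phi> x) = induced_hom VL EL VG EG \<phi> (F x))"

definition conjugating ::
  "'v set \<Rightarrow> ('v \<Rightarrow> 'v \<Rightarrow> bool) \<Rightarrow> (('v \<times> bool) list set \<Rightarrow> ('v \<times> bool) list set) \<Rightarrow> bool" where
  "conjugating V E f \<longleftrightarrow> (\<forall>v\<in>V. \<exists>g\<in>carrier (RAAG V E).
     f (raag_gen V E v) = g \<otimes>\<^bsub>RAAG V E\<^esub> raag_gen V E v \<otimes>\<^bsub>RAAG V E\<^esub> inv\<^bsub>RAAG V E\<^esub> g)"

definition is_partial_conj ::
  "'v set \<Rightarrow> ('v \<Rightarrow> 'v \<Rightarrow> bool) \<Rightarrow> 'v \<Rightarrow> 'v set \<Rightarrow> (('v \<times> bool) list set \<Rightarrow> ('v \<times> bool) list set) \<Rightarrow> bool" where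
  "is_partial_conj V E v C f \<longleftrightarrow> f \<in> auto (RAAG V E) \<and>
     (\<forall>w\<in>V. f (raag_gen V E w) =
        (if w \<in> C then raag_gen V E v \<otimes>\<^bsub>RAAG V E\<^esub> raag_gen V E w \<otimes>\<^bsub>RAAG V E\<^esub> inv\<^bsub>RAAG V E\<^esub> raag_gen V E v
         else raag_gen V E w))"

definition partial_conjugations ::
  "'v set \<Rightarrow> ('v \<Rightarrow> 'v \<Rightarrow> bool) \<Rightarrow> (('v \<times> bool) list set \<Rightarrow> ('v \<times> bool) list set) set" where
  "partial_conjugations V E = {f. \<exists>v\<in>V. \<exists>C. union_of_components_compl_star V E v C \<and> is_partial_conj V E v C f}"

definition LPAut ::
  "'w set \<Rightarrow> ('w \<Rightarrow> 'w \<Rightarrow> bool) \<Rightarrow> 'v set \<Rightarrow> ('v \<Rightarrow> 'v \<Rightarrow> bool) \<Rightarrow> ('w \<Rightarrow> 'v)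
     \<Rightarrow> (('v \<times> bool) list set \<Rightarrow> ('v \<times> bool) list set) set" where
  "LPAut VL EL VG EG \<phi> = {f \<in> auto (RAAG VG EG). conjugating VG EG f \<and> liftable VL EL VG EG \<phi> f}"

end

theory Submission
  imports Defs
begin

text \<open>
  Let \<open>f\<close> be a conjugating automorphism, \<open>f v = g v \<otimes> v \<otimes> inv (g v)\<close> with \<open>g v\<close> as short as possible.
  Write \<open>lkgrp v\<close> for the subgroup generated by the link of \<open>v\<close>. The Fox derivative of \<open>a\<close> with
  respect to \<open>v\<close> counts with sign how often a path from \<open>\<one>\<close> to \<open>a\<close> crosses each hyperplane of
  type \<open>v\<close>, a coset of \<open>lkgrp v\<close>; this describes the half-spaces of the group. A ping-pong argument
  shows that if no \<open>g w\<close> lies beyond one of the two hyperplanes of \<open>v\<close> at \<open>g v\<close>, for \<open>v\<close> and \<open>w\<close> distinct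
  and not adjacent, then \<open>f\<close> is the identity. Otherwise the partial conjugation by \<open>v\<close>
  (or its inverse) supported on the set \<open>C\<close> of those \<open>w\<close> makes \<open>f\<close> shorter (Laurence).

  It remains to lift this partial conjugation. Call vertices \<open>u\<close>, \<open>u'\<close> upstairs equivalent if for every
  \<open>z\<close> over \<open>v\<close> they are connected in the complement of \<open>st(z)\<close>. If \<open>\<phi>\<^sup>-\<^sup>1(C)\<close> is a union of classes, then
  its indicator is a sum of functions \<open>b z\<close>, one for each \<open>z\<close> over \<open>v\<close>, with \<open>b z\<close> constant on the
  components of the complement of \<open>st(z)\<close>, and the product of the corresponding automorphisms lifts the
  partial conjugation. To see that \<open>\<phi>\<^sup>-\<^sup>1(C)\<close> is a union of classes, one first
  arranges that the lift \<open>F\<close> of \<open>f\<close> acts trivially on homology. For \<open>u\<close> outside \<open>st(z)\<close> with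
  a neighbour outside \<open>st(z)\<close>, the derivative of \<open>F u\<close> with respect to \<open>z\<close> is then \<open>(1 - F u) c\<close> for some
  finitely supported \<open>c\<close>; since adjacent generators commute, \<open>c\<close> is constant along paths outside \<open>st(z)\<close>.
  The sum of these \<open>c\<close> over all \<open>z\<close> is the derivative of \<open>g (\<phi> u)\<close> with respect to \<open>v\<close>, which decides
  whether \<open>\<phi> u\<close> lies in \<open>C\<close>.
\<close>

section \<open>Right-angled Artin groups and their universal property\<close>

lemma raag_rel_append:
  assumes "raag_rel E a b"
  shows "raag_rel E (p @ a @ q) (p @ b @ q)"
  using assms
proof induction
  case (refl xs)
  then show ?case by (rule raag_rel.refl)
next
  case (sym xs ys)
  then show ?case by (blast intro: raag_rel.sym)
next
  case (trans xs ys zs)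
  then show ?case by (blast intro: raag_rel.trans)
next
  case (cancel xs v b ys)
  show ?case
    using raag_rel.cancel[of E "p @ xs" v b "ys @ q"] by simp
next
  case (commute u v xs a b ys)
  then show ?case
    using raag_rel.commute[of E u v "p @ xs" a b "ys @ q"] by simp
qed

lemma raag_rel_append2:
  assumes "raag_rel E a b" "raag_rel E c d"
  shows "raag_rel E (a @ c) (b @ d)"
  using raag_rel.trans[of E "a @ c" "b @ c" "b @ d"]
    raag_rel_append[OF assms(1), of "[]" c] raag_rel_append[OF assms(2), of b "[]"] by simp

abbreviation flip_letter :: "'v \<times> bool \<Rightarrow> 'v \<times> bool" where
  "flip_letter s \<equiv> (fst s, \<not> snd s)"

definition word_inv :: "('v \<times> bool) list \<Rightarrow> ('v \<times> bool) list" where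
  "word_inv w = rev (map flip_letter w)"

lemma raag_rel_word_inv: "raag_rel E (word_inv w @ w) []"
proof (induction w)
  case Nil
  then show ?case by (simp add: word_inv_def raag_rel.refl)
next
  case (Cons s w)
  have "raag_rel E (word_inv w @ [(fst s, \<not> snd s), (fst s, \<not> \<not> snd s)] @ w) (word_inv w @ w)"
    by (rule raag_rel.cancel)
  then show ?case
    using Cons raag_rel.trans by (force simp: word_inv_def)
qed

section \<open>Evaluation of words in a group\<close>

definition (in group) eval :: "('v \<Rightarrow> 'a) \<Rightarrow> ('v \<times> bool) list \<Rightarrow> 'a" where
  "eval h w = foldr (\<lambda>s r. (if snd s then h (fst s) else inv h (fst s)) \<otimes> r) w \<one>"

context group
begin

lemma eval_closed: "range h \<subseteq> carrier G \<Longrightarrow> eval h w \<in> carrier G"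
  by (induction w) (auto simp: eval_def)

lemma eval_append:
  "range h \<subseteq> carrier G \<Longrightarrow> eval h (a @ b) = eval h a \<otimes> eval h b"
proof (induction a)
  case Nil
  then show ?case using eval_closed[of h b] by (simp add: eval_def)
next
  case (Cons s a)
  have "h x \<in> carrier G" for x using Cons.prems by auto
  then show ?case using Cons eval_closed[of h a] eval_closed[of h b]
    by (auto simp: eval_def m_assoc)
qed

lemma commute_inv:
  assumes "x \<in> carrier G" "y \<in> carrier G" "x \<otimes> y = y \<otimes> x"
  shows "inv x \<otimes> y = y \<otimes> inv x"
proof -
  have "x \<otimes> (y \<otimes> inv x) = y"
    using assms by (metis inv_closed inv_solve_right' m_assoc m_closed)
  then show ?thesis
    using assms by (metis inv_closed inv_solve_left' m_closed)
qed

lemma inv_cancel: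
  assumes "x \<in> carrier G" "y \<in> carrier G"
  shows "inv x \<otimes> (x \<otimes> y) = y" "x \<otimes> (inv x \<otimes> y) = y"
  using assms by (simp_all flip: m_assoc)

text \<open>Both defining relations survive evaluation: a letter cancels against its inverse, and
  values that commute still commute after either of them is inverted.\<close>

lemma eval_rel:
  assumes h: "range h \<subseteq> carrier G"
    and comm: "\<And>u v. E u v \<Longrightarrow> h u \<otimes> h v = h v \<otimes> h u"
    and "raag_rel E a b"
  shows "eval h a = eval h b"
  using assms(3)
proof induction
  case (cancel xs v b ys)
  have hv: "h v \<in> carrier G" using h by auto
  have "eval h ([(v, b), (v, \<not> b)]) = \<one>"
    using hv by (auto simp: eval_def)
  then show ?case using h eval_closed[OF h] by (simp only: eval_append[OF h] l_one)
next
  case (commute u v xs a b ys)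
  have hv: "h v \<in> carrier G" "h u \<in> carrier G" using h by auto
  have c: "h u \<otimes> h v = h v \<otimes> h u" using commute by (rule comm)
  have c2: "inv h u \<otimes> h v = h v \<otimes> inv h u" "inv h v \<otimes> h u = h u \<otimes> inv h v"
    using commute_inv hv c by metis+
  have c3: "inv h u \<otimes> inv h v = inv h v \<otimes> inv h u"
    using commute_inv hv c2 inv_closed by metis
  have "eval h ([(u, a), (v, b)]) = eval h ([(v, b), (u, a)])"
    using hv c c2 c3 by (auto simp: eval_def)
  then show ?case by (simp only: eval_append[OF h])
qed auto

end

section \<open>Target groups for homomorphisms: permutations and the integral Heisenberg
  group\<close>

text \<open>Permutations of a whole type rather than of a carrier set, so that plain composition is
  the product and no restriction of functions is involved.\<close>

definition perm_group :: "('y \<Rightarrow> 'y) monoid" where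
  "perm_group = \<lparr>carrier = {p. bij p}, monoid.mult = (\<circ>), one = id\<rparr>"

lemma group_perm_group: "group perm_group"
proof (rule groupI)
  fix p :: "'y \<Rightarrow> 'y" assume "p \<in> carrier perm_group"
  then show "\<exists>q\<in>carrier perm_group. q \<otimes>\<^bsub>perm_group\<^esub> p = \<one>\<^bsub>perm_group\<^esub>"
    by (intro bexI[of _ "inv_into UNIV p"])
      (auto simp: perm_group_def bij_imp_bij_inv bij_is_inj)
qed (auto simp: perm_group_def bij_comp comp_assoc)

lemma perm_group_inv:
  assumes "bij p" "q \<circ> p = id"
  shows "inv\<^bsub>perm_group\<^esub> p = q"
proof (rule group.inv_equality[OF group_perm_group])
  have "q = inv_into UNIV p"
    using assms by (metis bij_def comp_assoc comp_id id_comp surj_iff)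
  then show "q \<in> carrier perm_group"
    using assms by (simp add: perm_group_def bij_imp_bij_inv)
qed (use assms in \<open>auto simp: perm_group_def\<close>)

text \<open>Multiplication of upper unitriangular matrices with superdiagonal \<open>(a, b)\<close> and corner \<open>c\<close>.\<close>

definition heisenberg_group :: "(int \<times> int \<times> int) monoid" where
  "heisenberg_group = \<lparr>carrier = UNIV,
     monoid.mult = (\<lambda>(a, b, c) (a', b', c'). (a + a', b + b', c + c' + a * b')), one = (0, 0, 0)\<rparr>"

lemma group_heisenberg_group: "group heisenberg_group"
proof (rule groupI)
  fix p :: "int \<times> int \<times> int"
  obtain a b c where p: "p = (a, b, c)" by (cases p)
  show "\<exists>q\<in>carrier heisenberg_group. q \<otimes>\<^bsub>heisenberg_group\<^esub> p = \<one>\<^bsub>heisenberg_group\<^esub>"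
    by (intro bexI[of _ "(- a, - b, a * b - c)"]) (auto simp: heisenberg_group_def p)
qed (auto simp: heisenberg_group_def algebra_simps)

text \<open>The group is a parameter pinned down by an equation, so that a covering can use two
  copies of the locale under the short names \<open>L\<close> and \<open>G\<close>.\<close>

locale raag =
  fixes V :: "'v set" and E :: "'v \<Rightarrow> 'v \<Rightarrow> bool"
    and G :: "('v \<times> bool) list set monoid" (structure)
  assumes graph: "simple_graph V E" and G_def: "G = RAAG V E"
begin

abbreviation gen :: "'v \<Rightarrow> ('v \<times> bool) list set" where "gen \<equiv> raag_gen V E"
abbreviation words :: "('v \<times> bool) list set" where "words \<equiv> raag_words V"

definition cls :: "('v \<times> bool) list \<Rightarrow> ('v \<times> bool) list set" where
  "cls w = raag_eq V E `` {w}"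

lemma finite_V: "finite V" using graph by (simp add: simple_graph_def)
lemma E_V: "E u w \<Longrightarrow> u \<in> V \<and> w \<in> V" using graph by (simp add: simple_graph_def)
lemma E_sym: "E u w \<Longrightarrow> E w u" using graph by (simp add: simple_graph_def)
lemma E_irrefl: "\<not> E u u" using graph by (simp add: simple_graph_def)

lemma nbrs_eq: "nbrs V E v = {w. E v w}"
  using E_V by (auto simp: nbrs_def)

lemma star_eq: "star V E v = insert v {w. E v w}"
  by (auto simp: star_def nbrs_eq)

lemma equiv_raag_eq: "equiv words (raag_eq V E)"
  by (rule equivI) (auto simp: raag_eq_def refl_on_def sym_def trans_def
      intro: raag_rel.refl raag_rel.sym raag_rel.trans)

lemma carrier_eq: "carrier G = cls ` words"
  by (auto simp: G_def RAAG_def quotient_def cls_def)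

lemma cls_eq_iff: "a \<in> words \<Longrightarrow> b \<in> words \<Longrightarrow> cls a = cls b \<longleftrightarrow> raag_rel E a b"
  unfolding cls_def using eq_equiv_class_iff[OF equiv_raag_eq] by (auto simp: raag_eq_def)

lemma cls_self: "a \<in> words \<Longrightarrow> a \<in> cls a"
  unfolding cls_def by (auto simp: raag_eq_def raag_rel.refl)

lemma mem_clsD: "b \<in> cls a \<Longrightarrow> a \<in> words \<and> b \<in> words \<and> raag_rel E a b"
  unfolding cls_def by (auto simp: raag_eq_def)

lemma words_append: "a @ b \<in> words \<longleftrightarrow> a \<in> words \<and> b \<in> words"
  by (auto simp: raag_words_def)

lemma words_Nil: "[] \<in> words"
  by (simp add: raag_words_def)

lemma words_Cons: "s # w \<in> words \<longleftrightarrow> fst s \<in> V \<and> w \<in> words"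
  by (auto simp: raag_words_def)

lemma word_inv_words: "w \<in> words \<Longrightarrow> word_inv w \<in> words"
  by (auto simp: raag_words_def word_inv_def)

lemma mult_cls:
  assumes "a \<in> words" "b \<in> words"
  shows "cls a \<otimes> cls b = cls (a @ b)"
proof -
  have "cls (x @ y) = cls (a @ b)" if "x \<in> cls a" "y \<in> cls b" for x y
    using mem_clsD[OF that(1)] mem_clsD[OF that(2)]
    by (subst cls_eq_iff) (auto simp: words_append intro: raag_rel_append2 raag_rel.sym)
  then have "(\<Union>x\<in>cls a. \<Union>y\<in>cls b. cls (x @ y)) = cls (a @ b)"
    using cls_self assms by blast
  then show ?thesis by (simp add: G_def RAAG_def cls_def)
qed

lemma one_cls: "\<one> = cls []"
  by (simp add: G_def RAAG_def cls_def)

lemma is_group: "group G"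
proof (rule groupI)
  fix x assume "x \<in> carrier G"
  then obtain w where w: "w \<in> words" "x = cls w" by (auto simp: carrier_eq)
  have "cls (word_inv w) \<otimes> x = \<one>"
    using w word_inv_words raag_rel_word_inv
    by (simp add: mult_cls one_cls cls_eq_iff words_append words_Nil)
  then show "\<exists>y\<in>carrier G. y \<otimes> x = \<one>"
    using w word_inv_words by (auto simp: carrier_eq)
qed (auto simp: carrier_eq mult_cls one_cls words_append words_Nil)

sublocale group G by (rule is_group)

lemma gen_eq: "gen v = cls [(v, True)]"
  by (simp add: raag_gen_def cls_def)

lemma gen_closed [simp]: "v \<in> V \<Longrightarrow> gen v \<in> carrier G"
  by (auto simp: gen_eq carrier_eq raag_words_def)

definition letter :: "'v \<times> bool \<Rightarrow> ('v \<times> bool) list set" where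
  "letter s = (if snd s then gen (fst s) else inv gen (fst s))"

lemma letter_simps [simp]: "letter (v, True) = gen v" "letter (v, False) = inv gen v"
  by (simp_all add: letter_def)

lemma letter_closed [simp]: "fst s \<in> V \<Longrightarrow> letter s \<in> carrier G"
  by (simp add: letter_def)

lemma letter_flip: "fst s \<in> V \<Longrightarrow> letter (fst s, \<not> snd s) = inv letter s"
  by (simp add: letter_def)

lemma cls_letter: "fst s \<in> V \<Longrightarrow> cls [s] = letter s"
proof (cases s)
  case (Pair v b)
  assume "fst s \<in> V"
  then have v: "v \<in> V" using Pair by simp
  have "cls [(v, False)] \<otimes> cls [(v, True)] = \<one>"
    using v raag_rel.cancel[of E "[]" v False "[]"]
    by (simp add: mult_cls one_cls cls_eq_iff words_append words_Nil words_Cons)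
  then have "inv (cls [(v, True)]) = cls [(v, False)]"
    using v by (intro inv_equality) (auto simp: carrier_eq words_Cons words_Nil)
  then show ?thesis using Pair by (cases b) (auto simp: gen_eq)
qed

lemma cls_Cons: "fst s \<in> V \<Longrightarrow> w \<in> words \<Longrightarrow> cls (s # w) = letter s \<otimes> cls w"
  using mult_cls[of "[s]" w] by (simp add: words_Cons words_Nil cls_letter)

lemma cls_snoc: "fst s \<in> V \<Longrightarrow> w \<in> words \<Longrightarrow> cls (w @ [s]) = cls w \<otimes> letter s"
  using mult_cls[of w "[s]"] by (simp add: words_Cons words_Nil cls_letter)

lemma cls_closed: "w \<in> words \<Longrightarrow> cls w \<in> carrier G"
  by (auto simp: carrier_eq)

lemma carrier_induct [consumes 1, case_names one mult]:
  assumes "a \<in> carrier G" "P \<one>"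
    and "\<And>s a. fst s \<in> V \<Longrightarrow> a \<in> carrier G \<Longrightarrow> P a \<Longrightarrow> P (letter s \<otimes> a)"
  shows "P a"
proof -
  have "w \<in> words \<Longrightarrow> P (cls w)" for w
  proof (induction w)
    case Nil
    then show ?case using assms(2) by (simp add: one_cls)
  next
    case (Cons s w)
    then show ?case using assms(3)[of s "cls w"] by (simp add: words_Cons cls_Cons cls_closed)
  qed
  then show ?thesis using assms(1) by (auto simp: carrier_eq)
qed

lemma gen_commute: "E u v \<Longrightarrow> gen u \<otimes> gen v = gen v \<otimes> gen u"
  using E_V[of u v] raag_rel.commute[of E u v "[]" True True "[]"]
  by (simp add: gen_eq mult_cls words_Cons words_Nil cls_eq_iff)

lemma universal_property:
  assumes K: "group K" and h: "\<And>v. v \<in> V \<Longrightarrow> h v \<in> carrier K"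
    and comm: "\<And>u v. E u v \<Longrightarrow> h u \<otimes>\<^bsub>K\<^esub> h v = h v \<otimes>\<^bsub>K\<^esub> h u"
  obtains \<theta> where "\<theta> \<in> hom G K" "\<And>v. v \<in> V \<Longrightarrow> \<theta> (gen v) = h v"
proof -
  interpret K: group K by fact
  \<comment> \<open>\<open>eval\<close> expects values in the group at every letter of the type,
    hence the default \<open>\<one>\<close> off \<open>V\<close>.\<close>
  define h' where "h' v = (if v \<in> V then h v else \<one>\<^bsub>K\<^esub>)" for v
  have h': "range h' \<subseteq> carrier K" using h by (auto simp: h'_def)
  have comm': "h' u \<otimes>\<^bsub>K\<^esub> h' v = h' v \<otimes>\<^bsub>K\<^esub> h' u" if "E u v" for u v
    using comm[OF that] E_V[OF that] by (simp add: h'_def)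
  \<comment> \<open>An arbitrary representative is evaluated; by \<open>eval_rel\<close> the choice
    does not matter.\<close>
  define \<theta> where "\<theta> A = K.eval h' (SOME a. a \<in> A)" for A
  have \<theta>: "\<theta> (cls a) = K.eval h' a" if "a \<in> words" for a
  proof -
    have "(SOME b. b \<in> cls a) \<in> cls a" using cls_self[OF that] by (rule someI)
    then show ?thesis
      unfolding \<theta>_def using K.eval_rel[OF h' comm', where E=E] mem_clsD raag_rel.sym by metis
  qed
  have "\<theta> \<in> hom G K"
    using \<theta> K.eval_closed[OF h'] K.eval_append[OF h']
    by (intro homI) (auto simp: carrier_eq mult_cls words_append)
  moreover have "\<theta> (gen v) = h v" if "v \<in> V" for v
    using \<theta>[of "[(v, True)]"] that h by (simp add: gen_eq words_Cons words_Nil K.eval_def h'_def)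
  ultimately show ?thesis using that by blast
qed

lemma hom_letter:
  assumes "group K" "\<theta> \<in> hom G K" "fst s \<in> V"
  shows "\<theta> (letter s) = (if snd s then \<theta> (gen (fst s)) else inv\<^bsub>K\<^esub> \<theta> (gen (fst s)))"
proof -
  interpret group_hom G K \<theta> using assms by (simp add: group_hom_def group_hom_axioms_def is_group)
  show ?thesis using assms by (simp add: letter_def)
qed

lemma hom_eqI:
  assumes K: "group K" and \<theta>: "\<theta> \<in> hom G K" "\<psi> \<in> hom G K"
    and eq: "\<And>v. v \<in> V \<Longrightarrow> \<theta> (gen v) = \<psi> (gen v)" and a: "a \<in> carrier G"
  shows "\<theta> a = \<psi> a"
  using a
proof (induction rule: carrier_induct)
  case one
  then show ?case using hom_one[OF \<theta>(1) is_group K] hom_one[OF \<theta>(2) is_group K] by simp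
next
  case (mult s a)
  then show ?case
    using hom_mult[OF \<theta>(1), of "letter s" a] hom_mult[OF \<theta>(2), of "letter s" a]
      hom_letter[OF K \<theta>(1)] hom_letter[OF K \<theta>(2)] eq by simp
qed

lemma auto_eqI:
  assumes "f \<in> auto G" "f' \<in> auto G" "\<And>v. v \<in> V \<Longrightarrow> f (gen v) = f' (gen v)"
  shows "f = f'"
  using assms hom_eqI[OF is_group, of f f']
  by (intro extensionalityI[of f "carrier G"]) (auto simp: auto_def Bij_def)

section \<open>Word length and geodesics\<close>

definition len :: "('v \<times> bool) list set \<Rightarrow> nat" where
  "len a = (LEAST n. \<exists>w\<in>words. a = cls w \<and> n = length w)"

lemma len_le: "w \<in> words \<Longrightarrow> len (cls w) \<le> length w"
  unfolding len_def by (rule Least_le) auto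

lemma geodesic:
  assumes "a \<in> carrier G"
  obtains w where "w \<in> words" "a = cls w" "length w = len a"
proof -
  have "\<exists>n. \<exists>w\<in>words. a = cls w \<and> n = length w" using assms by (auto simp: carrier_eq)
  then have "\<exists>w\<in>words. a = cls w \<and> len a = length w"
    unfolding len_def by (rule LeastI_ex)
  then show ?thesis using that by auto
qed

lemma len_mult:
  assumes "a \<in> carrier G" "b \<in> carrier G"
  shows "len (a \<otimes> b) \<le> len a + len b"
proof -
  obtain u w where "u \<in> words" "a = cls u" "length u = len a"
    "w \<in> words" "b = cls w" "length w = len b" using geodesic assms by metis
  then show ?thesis using len_le[of "u @ w"] by (auto simp: mult_cls words_append)
qed

lemma len_letter: "fst s \<in> V \<Longrightarrow> len (letter s) \<le> 1"
  using len_le[of "[s]"] by (simp add: words_Cons words_Nil cls_letter)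

lemma len_inv:
  assumes "a \<in> carrier G"
  shows "len (inv a) \<le> len a"
proof -
  obtain w where w: "w \<in> words" "a = cls w" "length w = len a" using geodesic assms by metis
  have "cls (word_inv w) \<otimes> a = \<one>"
    using w word_inv_words raag_rel_word_inv
    by (simp add: mult_cls one_cls cls_eq_iff words_append words_Nil)
  then have "inv a = cls (word_inv w)"
    using w assms word_inv_words cls_closed inv_equality by blast
  then show ?thesis using w len_le[OF word_inv_words[of w]] by (simp add: word_inv_def)
qed

text \<open>Deleting the first letter of a geodesic word lowers the length by exactly one, because a
  letter has length at most one.\<close>

lemma geodesic_first_letter:
  assumes "a \<in> carrier G" "a \<noteq> \<one>"
  obtains s a' where "fst s \<in> V" "a' \<in> carrier G" "a = letter s \<otimes> a'" "len a = Suc (len a')"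
proof -
  obtain w where w: "w \<in> words" "a = cls w" "length w = len a" using geodesic assms by metis
  then obtain s w' where sw: "w = s # w'" using assms one_cls by (cases w) auto
  then have s: "fst s \<in> V" "w' \<in> words" using w by (auto simp: words_Cons)
  have a: "a = letter s \<otimes> cls w'" using w sw s cls_Cons by simp
  have "len a \<le> Suc (len (cls w'))"
    using len_mult[of "letter s" "cls w'"] len_letter[of s] a s by (simp add: cls_closed)
  moreover have "len (cls w') \<le> length w'" using len_le s by simp
  ultimately have "len a = Suc (len (cls w'))" using w sw by simp
  then show ?thesis using that a s cls_closed by metis
qed

text \<open>Walk along a geodesic word for \<open>b\<close> starting at \<open>a\<close>, and go
  back from its end until \<open>Q\<close> fails. Cutting a geodesic word there gives the bound on
  the lengths of the two pieces.\<close>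

lemma path_enters:
  assumes "a \<in> carrier G" "b \<in> carrier G" "\<not> Q a" "Q (a \<otimes> b)"
  obtains p s q where "p \<in> carrier G" "fst s \<in> V" "q \<in> carrier G" "b = p \<otimes> letter s \<otimes> q"
    "\<not> Q (a \<otimes> p)" "Q (a \<otimes> p \<otimes> letter s)" "len p + 1 + len q \<le> len b"
proof -
  have *: "\<exists>w1 s w2. w = w1 @ s # w2 \<and> \<not> Q (a \<otimes> cls w1) \<and> Q (a \<otimes> cls (w1 @ [s]))"
    if "w \<in> words" "Q (a \<otimes> cls w)" for w
    using that
  proof (induction w rule: rev_induct)
    case Nil
    then show ?case using assms by (simp add: one_cls[symmetric])
  next
    case (snoc s w)
    show ?case
    proof (cases "Q (a \<otimes> cls w)")
      case True
      then obtain w1 t w2 where "w = w1 @ t # w2" "\<not> Q (a \<otimes> cls w1)" "Q (a \<otimes> cls (w1 @ [t]))"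
        using snoc by (auto simp: words_append)
      then show ?thesis by (intro exI[of _ w1] exI[of _ t] exI[of _ "w2 @ [s]"]) simp
    next
      case False
      then show ?thesis using snoc.prems by (intro exI[of _ w] exI[of _ s] exI[of _ "[]"]) simp
    qed
  qed
  obtain w where w: "w \<in> words" "b = cls w" "length w = len b" using geodesic assms by metis
  then obtain w1 s w2 where s: "w = w1 @ s # w2" "\<not> Q (a \<otimes> cls w1)" "Q (a \<otimes> cls (w1 @ [s]))"
    using *[of w] assms by auto
  have c: "w1 \<in> words" "fst s \<in> V" "w2 \<in> words" using w s by (auto simp: words_append words_Cons)
  have "b = cls w1 \<otimes> letter s \<otimes> cls w2"
    using w s c mult_cls[of "w1 @ [s]" w2]
    by (simp add: cls_snoc words_append words_Cons words_Nil)
  moreover have "len (cls w1) + 1 + len (cls w2) \<le> len b"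
    using len_le[of w1] len_le[of w2] c w s by simp
  moreover have "Q (a \<otimes> cls w1 \<otimes> letter s)"
    using s c assms by (simp add: cls_snoc m_assoc cls_closed)
  ultimately show ?thesis using that[of "cls w1" s "cls w2"] c s cls_closed by blast
qed

text \<open>A crossed homomorphism into the functions on \<open>Y\<close> is a lift of the action on \<open>Y\<close>
  to an action on \<open>Y \<times> \<int>\<close> by translations in the fibres.\<close>

lemma crossed_hom_exists:
  fixes \<alpha> :: "('v \<times> bool) list set \<Rightarrow> 'y \<Rightarrow> 'y"
  assumes one: "\<alpha> \<one> = id"
    and mult: "\<And>a b. a \<in> carrier G \<Longrightarrow> b \<in> carrier G \<Longrightarrow> \<alpha> (a \<otimes> b) = \<alpha> a \<circ> \<alpha> b"
    and B: "\<And>u y. E x u \<Longrightarrow> \<alpha> (gen u) y \<in> B \<longleftrightarrow> y \<in> B"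
  obtains \<delta> :: "('v \<times> bool) list set \<Rightarrow> 'y \<Rightarrow> int" where
    "\<And>a b y. a \<in> carrier G \<Longrightarrow> b \<in> carrier G \<Longrightarrow> \<delta> (a \<otimes> b) y = \<delta> a y + \<delta> b (\<alpha> (inv a) y)"
    "\<And>v y. v \<in> V \<Longrightarrow> \<delta> (gen v) y = of_bool (v = x \<and> y \<in> B)"
proof -
  have inv1: "\<alpha> (inv a) (\<alpha> a y) = y" "\<alpha> a (\<alpha> (inv a) y) = y" if "a \<in> carrier G" for a y
    using mult[of "inv a" a] mult[of a "inv a"] that one
    by (metis comp_apply id_apply inv_closed l_inv r_inv)+
  \<comment> \<open>The action on \<open>Y\<close> is lifted to \<open>Y \<times> \<int>\<close>:
    the generator \<open>x\<close> also moves up by one over the points of \<open>B\<close>, read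
    after moving; \<open>q\<close> is the explicit inverse of \<open>p\<close>.\<close>
  define p where "p u = (\<lambda>(y, n :: int). (\<alpha> (gen u) y, n + of_bool (u = x \<and> \<alpha> (gen u) y \<in> B)))" for u
  define q where "q u = (\<lambda>(y, n :: int). (\<alpha> (inv gen u) y, n - of_bool (u = x \<and> y \<in> B)))" for u
  have qp: "q u \<circ> p u = id" "p u \<circ> q u = id" if "u \<in> V" for u
    using inv1[of "gen u"] that by (auto simp: p_def q_def fun_eq_iff)
  have bij: "bij (p u)" if "u \<in> V" for u
    using qp[OF that] o_bij by blast
  have comm: "p u \<circ> p v = p v \<circ> p u" if "E u v" for u v
  proof -
    have uv: "u \<in> V" "v \<in> V" "u \<noteq> v" using E_V[OF that] E_irrefl that by auto
    have *: "\<alpha> (gen u) (\<alpha> (gen v) y) = \<alpha> (gen v) (\<alpha> (gen u) y)" for y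
      using mult[of "gen u" "gen v"] mult[of "gen v" "gen u"] gen_commute[OF that] uv
      by (metis comp_apply gen_closed)
    \<comment> \<open>If one of the two commuting generators is \<open>x\<close>, the other is
      adjacent to \<open>x\<close> and preserves \<open>B\<close>; so the upward shift is the same
      in either order.\<close>
    have "v = x \<Longrightarrow> \<alpha> (gen v) (\<alpha> (gen u) y) \<in> B \<longleftrightarrow> \<alpha> (gen v) y \<in> B"
      "u = x \<Longrightarrow> \<alpha> (gen v) (\<alpha> (gen u) y) \<in> B \<longleftrightarrow> \<alpha> (gen u) y \<in> B" for y
      using B that E_sym * by metis+
    then show ?thesis using uv * by (auto simp: p_def fun_eq_iff)
  qed
  obtain \<theta> where \<theta>: "\<theta> \<in> hom G perm_group" "\<And>v. v \<in> V \<Longrightarrow> \<theta> (gen v) = p v"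
    using universal_property[OF group_perm_group, of p] bij comm
    by (auto simp: perm_group_def)
  have \<theta>_letter: "\<theta> (letter s) = (if snd s then p (fst s) else q (fst s))" if "fst s \<in> V" for s
    using hom_letter[OF group_perm_group \<theta>(1) that] \<theta>(2)[OF that]
      perm_group_inv[OF bij[OF that] qp(1)[OF that]] by simp
  have \<theta>_mult: "\<theta> (a \<otimes> b) = \<theta> a \<circ> \<theta> b" if "a \<in> carrier G" "b \<in> carrier G" for a b
    using hom_mult[OF \<theta>(1) that] by (simp add: perm_group_def)
  \<comment> \<open>Every element acts on the fibres by translations; the translation over a point
    is the wanted value.\<close>
  have shape: "\<exists>e. \<forall>y n. \<theta> a (y, n) = (\<alpha> a y, n + e y)" if "a \<in> carrier G" for a
    using that
  proof (induction rule: carrier_induct)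
    case one
    then show ?case
      using hom_one[OF \<theta>(1) is_group group_perm_group] assms(1)
      by (intro exI[of _ "\<lambda>_. 0"]) (auto simp: perm_group_def)
  next
    case (mult s a)
    then obtain e where e: "\<And>y n. \<theta> a (y, n) = (\<alpha> a y, n + e y)" by blast
    have \<theta>': "\<theta> (letter s \<otimes> a) (y, n) = \<theta> (letter s) (\<alpha> a y, n + e y)" for y n
      using mult.hyps \<theta>_mult[of "letter s" a] e by simp
    have \<alpha>': "\<alpha> (letter s \<otimes> a) y = \<alpha> (letter s) (\<alpha> a y)" for y
      using mult.hyps assms(2)[of "letter s" a] by simp
    show ?case
    proof (cases "snd s")
      case True
      then have "\<theta> (letter s \<otimes> a) (y, n) = (\<alpha> (letter s \<otimes> a) y,
          n + (e y + of_bool (fst s = x \<and> \<alpha> (letter s) (\<alpha> a y) \<in> B)))" for y n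
        unfolding \<theta>' \<alpha>' using \<theta>_letter[OF mult.hyps(1)] by (simp add: p_def letter_def)
      then show ?thesis by (intro exI allI)
    next
      case False
      then have "\<theta> (letter s \<otimes> a) (y, n) = (\<alpha> (letter s \<otimes> a) y,
          n + (e y - of_bool (fst s = x \<and> \<alpha> a y \<in> B)))" for y n
        unfolding \<theta>' \<alpha>' using \<theta>_letter[OF mult.hyps(1)] by (simp add: q_def letter_def)
      then show ?thesis by (intro exI allI)
    qed
  qed
  \<comment> \<open>The translation is recorded at the target point \<open>y\<close> and not at the
    source; this yields the product rule with \<open>inv a\<close>.\<close>
  define \<delta> where "\<delta> a y = snd (\<theta> a (\<alpha> (inv a) y, 0))" for a y
  have \<theta>_eq: "\<theta> a (y, n) = (\<alpha> a y, n + \<delta> a (\<alpha> a y))" if "a \<in> carrier G" for a y n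
    using shape[OF that] inv1[OF that] by (auto simp: \<delta>_def)
  show ?thesis
  proof (rule that[of \<delta>])
    fix a b y assume ab: "a \<in> carrier G" "b \<in> carrier G"
    define z where "z = \<alpha> (inv (a \<otimes> b)) y"
    have z: "\<alpha> a (\<alpha> b z) = y"
      using inv1(2)[of "a \<otimes> b" y] ab mult by (simp add: z_def)
    then have z': "\<alpha> b z = \<alpha> (inv a) y" using inv1(1)[OF ab(1), of "\<alpha> b z"] by simp
    have "\<theta> (a \<otimes> b) (z, 0) = \<theta> a (\<theta> b (z, 0))" using \<theta>_mult ab by simp
    then show "\<delta> (a \<otimes> b) y = \<delta> a y + \<delta> b (\<alpha> (inv a) y)"
      using ab z z' \<theta>_eq[of "a \<otimes> b"] mult by (simp add: \<theta>_eq)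
  next
    fix v y assume v: "v \<in> V"
    then have "\<theta> (gen v) (\<alpha> (inv gen v) y, 0) = (y, of_bool (v = x \<and> y \<in> B))"
      using \<theta>(2) inv1(2)[of "gen v"] by (simp add: p_def)
    then show "\<delta> (gen v) y = of_bool (v = x \<and> y \<in> B)" by (simp add: \<delta>_def)
  qed
qed

section \<open>Exponent sums\<close>

text \<open>The coordinate at \<open>v\<close> of the abelianization; for \<open>v\<close> outside
  \<open>V\<close> it is the trivial homomorphism.\<close>

definition expo :: "'v \<Rightarrow> ('v \<times> bool) list set \<Rightarrow> int" where
  "expo v = (SOME \<theta>. \<theta> \<in> hom G integer_group \<and> (\<forall>u\<in>V. \<theta> (gen u) = of_bool (u = v)))"

lemma expo_spec: "expo v \<in> hom G integer_group \<and> (\<forall>u\<in>V. expo v (gen u) = of_bool (u = v))"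
proof -
  obtain \<theta> where "\<theta> \<in> hom G integer_group" "\<And>u. u \<in> V \<Longrightarrow> \<theta> (gen u) = of_bool (u = v)"
    using universal_property[OF group_integer_group, of "\<lambda>u. of_bool (u = v)"]
    by (metis UNIV_I add.commute carrier_integer_group mult_integer_group)
  then have "\<exists>\<theta>. \<theta> \<in> hom G integer_group \<and> (\<forall>u\<in>V. \<theta> (gen u) = of_bool (u = v))"
    by blast
  from someI_ex[OF this] show ?thesis unfolding expo_def .
qed

lemma expo_mult [simp]: "a \<in> carrier G \<Longrightarrow> b \<in> carrier G \<Longrightarrow> expo v (a \<otimes> b) = expo v a + expo v b"
  using expo_spec[of v] hom_mult[of "expo v" G integer_group] by simp

lemma expo_gen [simp]: "u \<in> V \<Longrightarrow> expo v (gen u) = of_bool (u = v)"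
  using expo_spec[of v] by simp

lemma expo_one [simp]: "expo v \<one> = 0"
  using expo_mult[of \<one> \<one> v] by simp

lemma expo_inv [simp]: "a \<in> carrier G \<Longrightarrow> expo v (inv a) = - expo v a"
  using expo_mult[of "inv a" a v] by simp

lemma expo_pow [simp]: "a \<in> carrier G \<Longrightarrow> expo v (a [^] (n::nat)) = int n * expo v a"
  by (induction n) (simp_all add: algebra_simps)

section \<open>Subgroups generated by links\<close>

definition lkgrp :: "'v \<Rightarrow> ('v \<times> bool) list set set" where
  "lkgrp v = generate G (gen ` {w. E v w})"

lemma gen_lk_carrier: "gen ` {w. E v w} \<subseteq> carrier G"
  using E_V by auto

lemma subgroup_lkgrp: "subgroup (lkgrp v) G"
  unfolding lkgrp_def by (rule generate_is_subgroup[OF gen_lk_carrier])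

lemma lkgrp_closed [simp]: "k \<in> lkgrp v \<Longrightarrow> k \<in> carrier G"
  using subgroup.mem_carrier[OF subgroup_lkgrp] by simp

lemma lkgrp_one [simp]: "\<one> \<in> lkgrp v"
  using subgroup.one_closed[OF subgroup_lkgrp] .

lemma lkgrp_mult: "k \<in> lkgrp v \<Longrightarrow> l \<in> lkgrp v \<Longrightarrow> k \<otimes> l \<in> lkgrp v"
  using subgroup.m_closed[OF subgroup_lkgrp] .

lemma lkgrp_inv: "k \<in> lkgrp v \<Longrightarrow> inv k \<in> lkgrp v"
  using subgroup.m_inv_closed[OF subgroup_lkgrp] .

lemma lkgrp_inv_iff: "a \<in> carrier G \<Longrightarrow> inv a \<in> lkgrp v \<longleftrightarrow> a \<in> lkgrp v"
  using lkgrp_inv[of a v] lkgrp_inv[of "inv a" v] by auto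

lemma lkgrp_mult_left: "k \<in> lkgrp v \<Longrightarrow> a \<in> carrier G \<Longrightarrow> k \<otimes> a \<in> lkgrp v \<longleftrightarrow> a \<in> lkgrp v"
  using lkgrp_mult[of k v a] lkgrp_mult[of "inv k" v "k \<otimes> a"] lkgrp_inv[of k v]
  by (auto simp: m_assoc[symmetric])

lemma lkgrp_mult_right: "k \<in> lkgrp v \<Longrightarrow> a \<in> carrier G \<Longrightarrow> a \<otimes> k \<in> lkgrp v \<longleftrightarrow> a \<in> lkgrp v"
  using lkgrp_mult[of a v k] lkgrp_mult[of "a \<otimes> k" v "inv k"] lkgrp_inv[of k v]
  by (auto simp: m_assoc)

lemma gen_lkgrp: "E v u \<Longrightarrow> gen u \<in> lkgrp v"
  unfolding lkgrp_def by (rule generate.incl) simp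

lemma lkgrp_induct [consumes 1, case_names one mult]:
  assumes "k \<in> lkgrp v" "P \<one>"
    and "\<And>s k. E v (fst s) \<Longrightarrow> k \<in> lkgrp v \<Longrightarrow> P k \<Longrightarrow> P (letter s \<otimes> k)"
  shows "P k"
proof -
  \<comment> \<open>\<open>generate\<close> also multiplies two generated elements, so the claim is
    strengthened by an arbitrary right factor \<open>k'\<close>; prepending letters then
    suffices.\<close>
  have "\<forall>k'\<in>lkgrp v. P k' \<longrightarrow> P (k \<otimes> k')"
    using assms(1)[unfolded lkgrp_def]
  proof (induction rule: generate.induct)
    case one
    then show ?case by simp
  next
    case (incl h)
    then obtain u where "E v u" "h = letter (u, True)" by auto
    then show ?case using assms(3)[of "(u, True)"] by simp
  next
    case (inv h)
    then obtain u where "E v u" "inv h = letter (u, False)" by auto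
    then show ?case using assms(3)[of "(u, False)"] by simp
  next
    case (eng h1 h2)
    have h: "h1 \<in> lkgrp v" "h2 \<in> lkgrp v" using eng by (simp_all add: lkgrp_def)
    have "P (h1 \<otimes> h2 \<otimes> k')" if "k' \<in> lkgrp v" "P k'" for k'
      using eng.IH that h lkgrp_mult[of h2 v k'] by (simp add: m_assoc)
    then show ?case by blast
  qed
  from bspec[OF this lkgrp_one] show ?thesis using assms(1,2) by simp
qed

lemma lkgrp_commute:
  assumes "v \<in> V" "k \<in> lkgrp v"
  shows "k \<otimes> gen v = gen v \<otimes> k"
  using assms(2)
proof (induction rule: lkgrp_induct)
  case one
  show ?case using assms by simp
next
  case (mult s k)
  have v: "v \<in> V" "fst s \<in> V" using E_V[OF mult(1)] by auto
  have "letter s \<otimes> gen v = gen v \<otimes> letter s"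
    using gen_commute[OF mult(1)] v commute_inv[of "gen (fst s)" "gen v"] by (auto simp: letter_def)
  then show ?case using mult v by (metis gen_closed letter_closed lkgrp_closed m_assoc)
qed

text \<open>Send \<open>y\<close> and \<open>y'\<close> to the two superdiagonal generators of the
  Heisenberg group and all other vertices to the identity. No edge joins \<open>y\<close> and
  \<open>y'\<close>, so this is a homomorphism. The corner entries of \<open>a \<otimes> b\<close>
  and \<open>b \<otimes> a\<close> differ by the determinant of the exponents, which therefore
  vanishes.\<close>

lemma expo_commuting:
  assumes ab: "a \<in> carrier G" "b \<in> carrier G" "a \<otimes> b = b \<otimes> a"
    and y: "y \<in> V" "y' \<in> V" "\<not> E y y'"
  shows "expo y a * expo y' b = expo y' a * expo y b"
proof (cases "y = y'")
  case True
  then show ?thesis by simp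
next
  case False
  have nE: "\<not> E y' y" using y E_sym by blast
  define h :: "'v \<Rightarrow> int \<times> int \<times> int" where "h u = (of_bool (u = y), of_bool (u = y'), 0)" for u
  have comm: "h u \<otimes>\<^bsub>heisenberg_group\<^esub> h v = h v \<otimes>\<^bsub>heisenberg_group\<^esub> h u" if "E u v" for u v
    using that y nE by (auto simp: heisenberg_group_def h_def)
  obtain \<theta> where \<theta>: "\<theta> \<in> hom G heisenberg_group" "\<And>v. v \<in> V \<Longrightarrow> \<theta> (gen v) = h v"
    by (rule universal_property[OF group_heisenberg_group _ comm])
      (assumption | simp add: heisenberg_group_def)+
  have mult: "\<theta> (c \<otimes> d) = (fst (\<theta> c) + fst (\<theta> d), fst (snd (\<theta> c)) + fst (snd (\<theta> d)),
      snd (snd (\<theta> c)) + snd (snd (\<theta> d)) + fst (\<theta> c) * fst (snd (\<theta> d)))"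
    if "c \<in> carrier G" "d \<in> carrier G" for c d
    using hom_mult[OF \<theta>(1) that] by (simp add: heisenberg_group_def case_prod_beta)
  have "(\<lambda>c. fst (\<theta> c)) \<in> hom G integer_group" "(\<lambda>c. fst (snd (\<theta> c))) \<in> hom G integer_group"
    by (auto intro!: homI simp: mult)
  then have "fst (\<theta> c) = expo y c" "fst (snd (\<theta> c)) = expo y' c" if "c \<in> carrier G" for c
    using hom_eqI[OF group_integer_group, of _ "expo y" c] hom_eqI[OF group_integer_group, of _ "expo y'" c]
      expo_spec that \<theta>(2) by (auto simp: h_def)
  then show ?thesis using mult[of a b] mult[of b a] ab by (simp add: mult.commute)
qed

subsection \<open>Fox derivatives and half-spaces\<close>

lemma expo_lkgrp:
  assumes "k \<in> lkgrp v" "\<not> E v w"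
  shows "expo w k = 0"
  using assms(1)
proof (induction rule: lkgrp_induct)
  case one
  then show ?case by simp
next
  case (mult s k)
  then show ?case using assms(2) E_V[of v "fst s"] by (auto simp: letter_def)
qed

text \<open>Fox derivatives take values in the functions on the cosets of \<open>lkgrp x\<close>, here written as
  right \<open>lkgrp x\<close>-invariant functions on the group.\<close>

definition fox :: "'v \<Rightarrow> ('v \<times> bool) list set \<Rightarrow> ('v \<times> bool) list set \<Rightarrow> int" where
  "fox x = (SOME \<delta>. (\<forall>a\<in>carrier G. \<forall>b\<in>carrier G. \<forall>g\<in>carrier G.
       \<delta> (a \<otimes> b) g = \<delta> a g + \<delta> b (inv a \<otimes> g)) \<and>
     (\<forall>v\<in>V. \<forall>g\<in>carrier G. \<delta> (gen v) g = of_bool (v = x \<and> g \<in> lkgrp x)))"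

lemma fox_spec: "(\<forall>a\<in>carrier G. \<forall>b\<in>carrier G. \<forall>g\<in>carrier G.
       fox x (a \<otimes> b) g = fox x a g + fox x b (inv a \<otimes> g)) \<and>
     (\<forall>v\<in>V. \<forall>g\<in>carrier G. fox x (gen v) g = of_bool (v = x \<and> g \<in> lkgrp x))"
proof -
  \<comment> \<open>Left translation, extended by the identity off the carrier because
    \<open>crossed_hom_exists\<close> acts on a whole type.\<close>
  define \<alpha> where "\<alpha> a g = (if g \<in> carrier G then a \<otimes> g else g)" for a g
  obtain \<delta> :: "('v \<times> bool) list set \<Rightarrow> ('v \<times> bool) list set \<Rightarrow> int" where
    "\<And>a b y. a \<in> carrier G \<Longrightarrow> b \<in> carrier G \<Longrightarrow> \<delta> (a \<otimes> b) y = \<delta> a y + \<delta> b (\<alpha> (inv a) y)"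
    "\<And>v y. v \<in> V \<Longrightarrow> \<delta> (gen v) y = of_bool (v = x \<and> y \<in> lkgrp x)"
  proof (rule crossed_hom_exists[of \<alpha> x "lkgrp x"])
    show "\<alpha> \<one> = id" by (auto simp: \<alpha>_def fun_eq_iff)
    show "\<alpha> (a \<otimes> b) = \<alpha> a \<circ> \<alpha> b" if "a \<in> carrier G" "b \<in> carrier G" for a b
      using that by (auto simp: \<alpha>_def m_assoc fun_eq_iff)
    show "\<alpha> (gen u) y \<in> lkgrp x \<longleftrightarrow> y \<in> lkgrp x" if "E x u" for u y
      using that E_V by (auto simp: \<alpha>_def lkgrp_mult_left gen_lkgrp)
  qed blast
  then have "\<exists>\<delta> :: ('v \<times> bool) list set \<Rightarrow> ('v \<times> bool) list set \<Rightarrow> int.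
     (\<forall>a\<in>carrier G. \<forall>b\<in>carrier G. \<forall>g\<in>carrier G. \<delta> (a \<otimes> b) g = \<delta> a g + \<delta> b (inv a \<otimes> g)) \<and>
     (\<forall>v\<in>V. \<forall>g\<in>carrier G. \<delta> (gen v) g = of_bool (v = x \<and> g \<in> lkgrp x))"
    by (intro exI[of _ \<delta>]) (simp add: \<alpha>_def)
  from someI_ex[OF this] show ?thesis unfolding fox_def .
qed

lemma fox_mult:
  "a \<in> carrier G \<Longrightarrow> b \<in> carrier G \<Longrightarrow> g \<in> carrier G \<Longrightarrow>
    fox x (a \<otimes> b) g = fox x a g + fox x b (inv a \<otimes> g)"
  using fox_spec by blast

lemma fox_gen:
  "v \<in> V \<Longrightarrow> g \<in> carrier G \<Longrightarrow> fox x (gen v) g = of_bool (v = x \<and> g \<in> lkgrp x)"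
  using fox_spec by blast

lemma fox_one [simp]: "g \<in> carrier G \<Longrightarrow> fox x \<one> g = 0"
  using fox_mult[of \<one> \<one> g x] by simp

lemma fox_inv:
  "a \<in> carrier G \<Longrightarrow> g \<in> carrier G \<Longrightarrow> fox x (inv a) g = - fox x a (a \<otimes> g)"
  using fox_mult[of "inv a" a g x] by simp

lemma fox_letter:
  assumes "fst s \<in> V" "g \<in> carrier G"
  shows "fox x (letter s) g = (if fst s \<noteq> x then 0
    else if snd s then of_bool (g \<in> lkgrp x) else - of_bool (gen x \<otimes> g \<in> lkgrp x))"
  using assms by (auto simp: letter_def fox_gen fox_inv)

lemma fox_lkgrp:
  assumes "k \<in> lkgrp x" "g \<in> carrier G"
  shows "fox x k g = 0"
  using assms
proof (induction arbitrary: g rule: lkgrp_induct)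
  case one
  then show ?case by simp
next
  case (mult s k)
  then show ?case using E_V[of x "fst s"] E_irrefl by (auto simp: fox_mult fox_letter)
qed

lemma fox_right_invariant:
  assumes "a \<in> carrier G" "k \<in> lkgrp x" "g \<in> carrier G"
  shows "fox x a (g \<otimes> k) = fox x a g"
  using assms(1,3)
proof (induction arbitrary: g rule: carrier_induct)
  case one
  then show ?case using assms by simp
next
  case (mult s a)
  have "inv letter s \<otimes> (g \<otimes> k) = inv letter s \<otimes> g \<otimes> k"
    using mult assms by (simp add: m_assoc)
  moreover have "gen x \<otimes> (g \<otimes> k) = gen x \<otimes> g \<otimes> k" if "fst s = x"
    using mult assms that by (simp add: m_assoc)
  ultimately show ?case
    using mult assms by (auto simp: fox_mult fox_letter lkgrp_mult_right)
qed

text \<open>A derivative is supported on finitely many cosets of \<open>lkgrp x\<close>, and the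
  exponents at vertices not adjacent to \<open>x\<close> are constant on each coset. Bounding these
  exponents takes the place of finite support.\<close>

lemma fox_bounded:
  assumes "a \<in> carrier G"
  shows "\<exists>N. \<forall>g\<in>carrier G. \<forall>w. \<not> E x w \<longrightarrow> fox x a g \<noteq> 0 \<longrightarrow> \<bar>expo w g\<bar> \<le> N"
  using assms
proof (induction rule: carrier_induct)
  case one
  then show ?case by simp
next
  case (mult s a)
  then obtain N where N: "\<And>g w. g \<in> carrier G \<Longrightarrow> \<not> E x w \<Longrightarrow> fox x a g \<noteq> 0 \<Longrightarrow> \<bar>expo w g\<bar> \<le> N"
    by blast
  have letter_expo: "\<bar>expo w (letter s)\<bar> \<le> 1" for w
    using mult by (auto simp: letter_def)
  \<comment> \<open>\<open>\<bar>N\<bar>\<close> because an empty support leaves \<open>N\<close>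
    free to be negative; the summand one covers both the support of the letter and the shift caused
    by it.\<close>
  have "\<bar>expo w g\<bar> \<le> \<bar>N\<bar> + 1"
    if g: "g \<in> carrier G" "\<not> E x w" "fox x (letter s \<otimes> a) g \<noteq> 0" for g w
  proof -
    have "fox x (letter s) g + fox x a (inv letter s \<otimes> g) \<noteq> 0"
      using mult g by (simp add: fox_mult)
    then consider "fox x (letter s) g \<noteq> 0" | "fox x a (inv letter s \<otimes> g) \<noteq> 0"
      by fastforce
    then show ?thesis
    proof cases
      case 1
      then have "(fst s = x \<and> snd s \<and> g \<in> lkgrp x) \<or> (fst s = x \<and> \<not> snd s \<and> gen x \<otimes> g \<in> lkgrp x)"
        using mult g by (auto simp: fox_letter split: if_splits)
      then show ?thesis
        using expo_lkgrp[of g x w] expo_lkgrp[of "gen x \<otimes> g" x w] g mult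
        by (auto simp: of_bool_def split: if_splits)
    next
      case 2
      then have "\<bar>expo w (inv letter s \<otimes> g)\<bar> \<le> N" using N[of "inv letter s \<otimes> g" w] g mult by simp
      then show ?thesis using g mult letter_expo[of w] by simp
    qed
  qed
  then show ?case by blast
qed

text \<open>Translation by powers of \<open>b\<close> drives the exponent at \<open>w\<close> out of
  the bounded range. This removes the far ends of telescoping sums.\<close>

lemma fox_vanishes:
  assumes "a \<in> carrier G" "b \<in> carrier G" "g \<in> carrier G" "\<not> E x w" "expo w b \<noteq> 0"
  shows "\<forall>\<^sub>F n in sequentially. fox x a (b [^] (n::nat) \<otimes> g) = 0"
proof -
  obtain N where "\<forall>g\<in>carrier G. \<forall>w. \<not> E x w \<longrightarrow> fox x a g \<noteq> 0 \<longrightarrow> \<bar>expo w g\<bar> \<le> N"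
    using fox_bounded[OF assms(1)] ..
  then have N: "\<bar>expo w g\<bar> \<le> N" if "g \<in> carrier G" "fox x a g \<noteq> 0" for g
    using that assms(4) by blast
  have "fox x a (b [^] n \<otimes> g) = 0" if n: "n \<ge> nat (N + \<bar>expo w g\<bar> + 1)" for n :: nat
  proof (rule ccontr)
    assume "fox x a (b [^] n \<otimes> g) \<noteq> 0"
    then have "\<bar>int n * expo w b + expo w g\<bar> \<le> N"
      using N[of "b [^] n \<otimes> g"] assms by simp
    moreover have "int n \<le> \<bar>int n * expo w b\<bar>"
      using assms(5) mult_left_mono[of 1 "\<bar>expo w b\<bar>" "int n"] by (simp add: abs_mult)
    ultimately show False using n by linarith
  qed
  then show ?thesis unfolding eventually_sequentially by blast
qed

text \<open>The half-space of all elements that some reduced word starting with the letter \<open>(v, b)\<close>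
  represents.\<close>

definition hs :: "'v \<Rightarrow> bool \<Rightarrow> ('v \<times> bool) list set set" where
  "hs v b = {a \<in> carrier G. fox v a (if b then \<one> else inv gen v) \<noteq> 0}"

lemma gen_lkgrp_conj: "v \<in> V \<Longrightarrow> a \<in> carrier G \<Longrightarrow> gen v \<otimes> a \<otimes> inv gen v \<in> lkgrp v \<longleftrightarrow> a \<in> lkgrp v"
proof -
  assume va: "v \<in> V" "a \<in> carrier G"
  have "gen v \<otimes> k \<otimes> inv gen v = k" if "k \<in> lkgrp v" for k
    using inv_solve_right[of k "gen v \<otimes> k" "gen v"] lkgrp_commute[OF va(1) that] va that by simp
  then have 1: "gen v \<otimes> a \<otimes> inv gen v \<in> lkgrp v" if "a \<in> lkgrp v" using that by simp
  have 2: "a \<in> lkgrp v" if k: "gen v \<otimes> a \<otimes> inv gen v \<in> lkgrp v"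
  proof -
    let ?k = "gen v \<otimes> a \<otimes> inv gen v"
    have "a = inv gen v \<otimes> (?k \<otimes> gen v)" using va by (simp add: m_assoc) (simp flip: m_assoc)
    also have "\<dots> = ?k" using lkgrp_commute[OF va(1) k] va by (simp add: m_assoc[symmetric])
    finally show ?thesis using k by simp
  qed
  show ?thesis using 1 2 by blast
qed

lemma hs_closed: "a \<in> hs v b \<Longrightarrow> a \<in> carrier G"
  by (simp add: hs_def)

lemma hs_one: "v \<in> V \<Longrightarrow> \<one> \<notin> hs v b"
  by (simp add: hs_def)

text \<open>Elements of \<open>lkgrp v\<close> have zero derivative with respect to \<open>v\<close>
  and commute with \<open>gen v\<close>, so they fix both cosets at which \<open>hs\<close> reads
  the derivative.\<close>

lemma hs_lkgrp_mult:
  assumes "v \<in> V" "k \<in> lkgrp v" "a \<in> carrier G"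
  shows "k \<otimes> a \<in> hs v b \<longleftrightarrow> a \<in> hs v b"
proof -
  have "inv k \<otimes> inv gen v = inv gen v \<otimes> inv k"
    using lkgrp_commute[OF assms(1,2)] assms by (simp flip: inv_mult_group)
  then show ?thesis
    using assms fox_right_invariant[of a "inv k" v \<one>] fox_right_invariant[of a "inv k" v "inv gen v"]
    by (auto simp: hs_def fox_mult fox_lkgrp lkgrp_inv)
qed

text \<open>The letter contributes 1 or -1 at its own coset, and the product rule moves the reading
  of \<open>a\<close> to the coset of the opposite half-space, where it is zero.\<close>

lemma hs_letter:
  assumes "v \<in> V" "a \<in> carrier G" "a \<notin> hs v (\<not> b)"
  shows "letter (v, b) \<otimes> a \<in> hs v b"
  using assms by (cases b) (auto simp: hs_def fox_mult fox_gen fox_inv)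

text \<open>Membership changes only if the new letter contributes at the coset defining the
  half-space. This forces its label to be \<open>v\<close> and puts one end of the edge into
  \<open>lkgrp v\<close>.\<close>

lemma hs_crossing:
  assumes "a \<in> carrier G" "fst s \<in> V" "v \<in> V" "(a \<in> hs v b) \<noteq> (a \<otimes> letter s \<in> hs v b)"
  shows "s = (v, b) \<and> a \<in> lkgrp v \<and> a \<notin> hs v b \<or>
    s = (v, \<not> b) \<and> a \<otimes> letter s \<in> lkgrp v \<and> a \<in> hs v b"
proof -
  \<comment> \<open>The coset labelling the hyperplane crossed by the edge from
    \<open>\<one>\<close> to \<open>letter (v, b)\<close>.\<close>
  define g0 where "g0 = (if b then \<one> else inv gen v)"
  have g0: "g0 \<in> carrier G" using assms by (simp add: g0_def)
  have "fox v (a \<otimes> letter s) g0 = fox v a g0 + fox v (letter s) (inv a \<otimes> g0)"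
    using fox_mult assms g0 by simp
  then have "fox v (letter s) (inv a \<otimes> g0) \<noteq> 0" using assms by (auto simp: hs_def g0_def)
  then have s: "fst s = v" "snd s \<and> inv a \<otimes> g0 \<in> lkgrp v \<or> \<not> snd s \<and> gen v \<otimes> (inv a \<otimes> g0) \<in> lkgrp v"
    using assms g0 by (auto simp: fox_letter split: if_splits)
  \<comment> \<open>This decides which end of a crossing edge is inside: \<open>lkgrp v\<close> lies
    outside the half-space, its translate by \<open>letter (v, b)\<close> inside.\<close>
  have lk_hs: "k \<notin> hs v b" "k \<otimes> letter (v, b) \<in> hs v b" if "k \<in> lkgrp v" for k
    using that assms(3) hs_lkgrp_mult[of v k \<one> b] hs_lkgrp_mult[of v k "letter (v, b)" b]
      hs_letter[of v \<one> b] hs_one by auto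
  have *: "a = a \<otimes> letter s \<otimes> letter (v, \<not> snd s)"
    using s(1) assms by (cases s; cases "snd s") (auto simp: m_assoc)
  consider (enter) "snd s = b" "a \<in> lkgrp v" | (leave) "snd s = (\<not> b)" "a \<otimes> letter s \<in> lkgrp v"
  proof (cases b)
    case True
    have "gen v \<otimes> inv a = inv (a \<otimes> inv gen v)" using assms by (simp add: inv_mult_group)
    then show ?thesis using that s True assms
      by (cases s) (auto simp: g0_def lkgrp_inv_iff)
  next
    case False
    have "gen v \<otimes> (a \<otimes> gen v) \<otimes> inv gen v = inv (inv a \<otimes> inv gen v)"
      using assms by (simp add: m_assoc inv_mult_group)
    then have 1: "inv a \<otimes> inv gen v \<in> lkgrp v \<longleftrightarrow> a \<otimes> gen v \<in> lkgrp v"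
      using gen_lkgrp_conj[of v "a \<otimes> gen v"] lkgrp_inv_iff[of "inv a \<otimes> inv gen v" v] assms by simp
    have 2: "gen v \<otimes> (inv a \<otimes> inv gen v) \<in> lkgrp v \<longleftrightarrow> a \<in> lkgrp v"
      using gen_lkgrp_conj[of v "inv a"] lkgrp_inv_iff[of a v] assms by (simp add: m_assoc)
    show ?thesis using that s False 1 2 by (cases s) (auto simp: g0_def)
  qed
  then show ?thesis
  proof cases
    case enter
    then show ?thesis using s lk_hs by (auto simp: prod_eq_iff)
  next
    case leave
    then show ?thesis using s lk_hs(2)[of "a \<otimes> letter s"] * by (auto simp: prod_eq_iff)
  qed
qed

text \<open>On a path from \<open>\<one>\<close> into the intersection, the last entering edge
  enters one of the two half-spaces from \<open>lkgrp v\<close> by its own letter. The exponent at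
  \<open>v\<close> shows that this letter does not lead into the other one.\<close>

lemma hs_disjoint:
  assumes "v \<in> V"
  shows "hs v True \<inter> hs v False = {}"
proof (rule ccontr)
  assume "hs v True \<inter> hs v False \<noteq> {}"
  then obtain a where a: "a \<in> hs v True" "a \<in> hs v False" by blast
  have not: "k \<notin> hs v b" "k \<otimes> letter (v, b) \<notin> hs v (\<not> b)" if "k \<in> lkgrp v" for k b
  proof -
    show "k \<notin> hs v b"
      using that assms hs_lkgrp_mult[of v k \<one> b] hs_one by auto
    have "inv gen v \<notin> lkgrp v" "gen v \<notin> lkgrp v"
      using expo_lkgrp[of "inv gen v" v v] expo_lkgrp[of "gen v" v v] assms E_irrefl by auto
    then have "letter (v, b) \<notin> hs v (\<not> b)"
      using assms by (cases b) (auto simp: hs_def fox_gen fox_inv)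
    then show "k \<otimes> letter (v, b) \<notin> hs v (\<not> b)" using that assms hs_lkgrp_mult by simp
  qed
  define Q where "Q x \<longleftrightarrow> x \<in> hs v True \<and> x \<in> hs v False" for x
  have "\<one> \<in> carrier G" "a \<in> carrier G" "\<not> Q \<one>" "Q (\<one> \<otimes> a)"
    using a hs_one[OF assms] hs_closed[OF a(1)] by (auto simp: Q_def)
  then obtain p s where p: "p \<in> carrier G" "fst s \<in> V" "\<not> Q p" "Q (p \<otimes> letter s)"
    by (rule path_enters) auto
  then obtain b where "p \<notin> hs v b" "p \<otimes> letter s \<in> hs v b" by (auto simp: Q_def)
  then have "s = (v, b)" "p \<in> lkgrp v" using hs_crossing[of p s v b] p assms by auto
  then show False using not[of p b] p(4) by (cases b) (auto simp: Q_def)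
qed

section \<open>Translated half-spaces\<close>

definition hs_at :: "('v \<times> bool) list set \<Rightarrow> 'v \<Rightarrow> bool \<Rightarrow> ('v \<times> bool) list set set" where
  "hs_at g v b = {a \<in> carrier G. inv g \<otimes> a \<in> hs v b}"

lemma hs_at_crossing:
  assumes "g \<in> carrier G" "a \<in> carrier G" "fst s \<in> V" "v \<in> V"
    "(a \<in> hs_at g v b) \<noteq> (a \<otimes> letter s \<in> hs_at g v b)"
  shows "s = (v, b) \<and> inv g \<otimes> a \<in> lkgrp v \<and> a \<notin> hs_at g v b \<or>
    s = (v, \<not> b) \<and> inv g \<otimes> (a \<otimes> letter s) \<in> lkgrp v \<and> a \<in> hs_at g v b"
  using assms hs_crossing[of "inv g \<otimes> a" s v b] by (auto simp: hs_at_def m_assoc)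

text \<open>The letters of \<open>k\<close> are adjacent to \<open>v\<close>, hence different from
  \<open>w\<close>, and only a letter \<open>w\<close> can cross a hyperplane of type
  \<open>w\<close>.\<close>

lemma hs_at_lkgrp_mult:
  assumes "k \<in> lkgrp v" "g \<in> carrier G" "h \<in> carrier G" "w \<in> V" "\<not> E v w"
  shows "g \<otimes> k \<in> hs_at h w c \<longleftrightarrow> g \<in> hs_at h w c"
  using assms(1,2)
proof (induction arbitrary: g rule: lkgrp_induct)
  case one
  then show ?case by simp
next
  case (mult s k)
  have s: "fst s \<in> V" "fst s \<noteq> w" using mult E_V assms by auto
  have "g \<otimes> letter s \<in> hs_at h w c \<longleftrightarrow> g \<in> hs_at h w c"
    using hs_at_crossing[of h g s w c] s mult assms by (cases s) auto
  then show ?case using mult.IH[of "g \<otimes> letter s"] mult s by (simp add: m_assoc)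
qed

text \<open>An end of the crossing edge differs from \<open>g\<close> by an element of
  \<open>lkgrp v\<close>, so it is on the same side of the hyperplane of type \<open>w\<close> as
  \<open>g\<close>; the edge itself has label \<open>v\<close> and does not cross that
  hyperplane.\<close>

lemma hs_at_crossing_avoids:
  assumes "g \<in> carrier G" "h \<in> carrier G" "v \<in> V" "w \<in> V" "v \<noteq> w" "\<not> E v w"
    and g: "g \<notin> hs_at h w c" and a: "a \<in> carrier G" "fst s \<in> V"
    and cross: "(a \<in> hs_at g v b) \<noteq> (a \<otimes> letter s \<in> hs_at g v b)"
  shows "a \<notin> hs_at h w c" "a \<otimes> letter s \<notin> hs_at h w c"
proof -
  have s: "fst s = v" and k: "inv g \<otimes> a \<in> lkgrp v \<or> inv g \<otimes> (a \<otimes> letter s) \<in> lkgrp v"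
    using hs_at_crossing[of g a s v b] assms by auto
  have same: "a \<otimes> letter s \<in> hs_at h w c \<longleftrightarrow> a \<in> hs_at h w c"
    using hs_at_crossing[of h a s w c] s assms by (cases s) auto
  have *: "z \<notin> hs_at h w c" if "inv g \<otimes> z \<in> lkgrp v" "z \<in> carrier G" for z
    using hs_at_lkgrp_mult[OF that(1), of g h w c] that g assms by (simp flip: m_assoc)
  show "a \<notin> hs_at h w c" "a \<otimes> letter s \<notin> hs_at h w c"
    using k *[of a] *[of "a \<otimes> letter s"] a same by auto
qed

text \<open>Hyperplanes with non-adjacent labels do not cross, so along a path starting outside both
  half-spaces each can only be entered while outside the other.\<close>

lemma hs_at_disjoint:
  assumes "g \<in> carrier G" "h \<in> carrier G" "v \<in> V" "w \<in> V" "v \<noteq> w" "\<not> E v w"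
    and "g \<notin> hs_at h w c" "h \<notin> hs_at g v b" "\<one> \<notin> hs_at g v b"
  shows "hs_at g v b \<inter> hs_at h w c = {}"
proof (rule ccontr)
  assume "hs_at g v b \<inter> hs_at h w c \<noteq> {}"
  then obtain a where a: "a \<in> hs_at g v b" "a \<in> hs_at h w c" by blast
  define Q where "Q x \<longleftrightarrow> x \<in> hs_at g v b \<and> x \<in> hs_at h w c" for x
  have "\<one> \<in> carrier G" "a \<in> carrier G" "\<not> Q \<one>" "Q (\<one> \<otimes> a)"
    using a assms by (auto simp: Q_def hs_at_def)
  then obtain p s where p: "p \<in> carrier G" "fst s \<in> V" "\<not> Q p" "Q (p \<otimes> letter s)"
    by (rule path_enters) auto
  have "\<not> E w v" using assms(6) E_sym by blast
  then show False
    using p hs_at_crossing_avoids[of g h v w c p s b] hs_at_crossing_avoids[of h g w v b p s c] assms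
    unfolding Q_def by blast
qed

text \<open>Fox derivatives of both sides of \<open>k v = v k\<close> along the cyclic group generated by \<open>v\<close>.\<close>

lemma centralizer_gen:
  assumes v: "v \<in> V" and k: "k \<in> carrier G" "k \<otimes> gen v = gen v \<otimes> k" "expo v k = 0"
  shows "k \<in> lkgrp v"
proof (rule ccontr)
  assume nk: "k \<notin> lkgrp v"
  have step: "fox v k g - fox v k (inv gen v \<otimes> g) = of_bool (g \<in> lkgrp v) - of_bool (inv k \<otimes> g \<in> lkgrp v)"
    if "g \<in> carrier G" for g
    using fox_mult[of k "gen v" g v] fox_mult[of "gen v" k g v] that k v by (simp add: fox_gen)
  have notin: "a \<notin> lkgrp v" if "expo v a \<noteq> 0" for a
    using that expo_lkgrp[of a v v] E_irrefl by auto
  have kinv: "inv k \<notin> lkgrp v" using nk k lkgrp_inv_iff by simp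
  define x where "x = gen v"
  have x: "x \<in> carrier G" "expo v x = 1" using v by (auto simp: x_def)
  \<comment> \<open>Both indicators in \<open>step\<close> vanish at the nonzero powers of
    \<open>x\<close>, by their exponent at \<open>v\<close>. So the derivative is constant on either
    side of \<open>\<one>\<close>, and zero since it vanishes far out; but for \<open>k\<close>
    outside \<open>lkgrp v\<close> it would jump by one at \<open>\<one>\<close>.\<close>
  have up: "fox v k (x [^] (n::nat)) = fox v k \<one>" for n
  proof (induction n)
    case 0
    then show ?case by simp
  next
    case (Suc n)
    have "inv x \<otimes> x [^] Suc n = x [^] n"
      using x nat_pow_Suc2[of x n] by (simp flip: m_assoc del: nat_pow_Suc)
    moreover have "x [^] Suc n \<notin> lkgrp v" "inv k \<otimes> x [^] Suc n \<notin> lkgrp v"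
      using notin[of "x [^] Suc n"] notin[of "inv k \<otimes> x [^] Suc n"] x k
      by (auto simp del: nat_pow_Suc)
    ultimately show ?case using step[of "x [^] Suc n"] Suc x by (simp add: x_def del: nat_pow_Suc)
  qed
  have down: "fox v k (inv x \<otimes> inv x [^] (n::nat)) = fox v k (inv x)" for n
  proof (induction n)
    case 0
    then show ?case using x by simp
  next
    case (Suc n)
    have e: "inv x [^] Suc n = inv x \<otimes> inv x [^] n"
      using x nat_pow_Suc2[of "inv x" n] by (simp del: nat_pow_Suc)
    have "inv x [^] Suc n \<notin> lkgrp v" "inv k \<otimes> inv x [^] Suc n \<notin> lkgrp v"
      using notin[of "inv x [^] Suc n"] notin[of "inv k \<otimes> inv x [^] Suc n"] x k
      by (auto simp del: nat_pow_Suc)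
    then show ?case using step[of "inv x [^] Suc n"] Suc x e by (simp add: x_def del: nat_pow_Suc)
  qed
  have "\<forall>\<^sub>F n in sequentially. fox v k (x [^] (n::nat) \<otimes> \<one>) = 0"
    using fox_vanishes[of k x \<one> v v] k x E_irrefl by simp
  moreover have "\<forall>\<^sub>F n in sequentially. fox v k (inv x [^] (n::nat) \<otimes> \<one>) = 0"
    using fox_vanishes[of k "inv x" \<one> v v] k x E_irrefl by simp
  ultimately have "\<forall>\<^sub>F n in sequentially. fox v k (x [^] (n::nat) \<otimes> \<one>) = 0 \<and>
      fox v k (inv x [^] (n::nat) \<otimes> \<one>) = 0"
    by (rule eventually_conj)
  then obtain N where N: "\<And>n. n \<ge> N \<Longrightarrow> fox v k (x [^] (n::nat) \<otimes> \<one>) = 0"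
     "\<And>n. n \<ge> N \<Longrightarrow> fox v k (inv x [^] (n::nat) \<otimes> \<one>) = 0"
    unfolding eventually_sequentially by blast
  have "fox v k \<one> = 0" using N(1)[of N] up[of N] x by simp
  moreover have "fox v k (inv x) = 0"
    using N(2)[of "Suc N"] down[of N] x nat_pow_Suc2[of "inv x" N] by (simp del: nat_pow_Suc)
  ultimately show False using step[of \<one>] kinv x by (simp add: x_def k)
qed

subsection \<open>Conjugating automorphisms\<close>

lemma hs_at_split:
  assumes "g \<in> carrier G" "v \<in> V" "\<one> \<notin> hs_at g v b" "a \<in> hs_at g v b"
  obtains p q where "p \<in> carrier G" "q \<in> carrier G" "a = p \<otimes> letter (v, b) \<otimes> q"
    "inv g \<otimes> p \<in> lkgrp v" "len p + 1 + len q \<le> len a"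
proof -
  define Q where "Q x \<longleftrightarrow> x \<in> hs_at g v b" for x
  have "\<one> \<in> carrier G" "a \<in> carrier G" "\<not> Q \<one>" "Q (\<one> \<otimes> a)"
    using assms by (auto simp: Q_def hs_at_def)
  then obtain p s q where p: "p \<in> carrier G" "fst s \<in> V" "q \<in> carrier G" "a = p \<otimes> letter s \<otimes> q"
    "\<not> Q p" "Q (p \<otimes> letter s)" "len p + 1 + len q \<le> len a"
    by (rule path_enters) auto
  then have "s = (v, b)" "inv g \<otimes> p \<in> lkgrp v"
    using hs_at_crossing[of g p s v b] assms by (auto simp: Q_def)
  then show ?thesis using that p by blast
qed

lemma lkgrp_commute_letter:
  assumes "v \<in> V" "k \<in> lkgrp v"
  shows "k \<otimes> letter (v, b) = letter (v, b) \<otimes> k"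
  using lkgrp_commute[OF assms] commute_inv[of "gen v" k] assms by (cases b) auto

text \<open>A geodesic to \<open>a\<close> crosses the hyperplane at some edge starting in the coset
  of \<open>g\<close>. The part of its prefix in \<open>lkgrp v\<close> commutes with the letter of
  the edge, so the left factor deletes exactly this letter.\<close>

lemma hs_at_shorten:
  assumes "g \<in> carrier G" "v \<in> V" "\<one> \<notin> hs_at g v b" "a \<in> hs_at g v b"
  shows "len (g \<otimes> letter (v, \<not> b) \<otimes> inv g \<otimes> a) < len a"
proof -
  obtain p q where p: "p \<in> carrier G" "q \<in> carrier G" "a = p \<otimes> letter (v, b) \<otimes> q"
    "inv g \<otimes> p \<in> lkgrp v" "len p + 1 + len q \<le> len a"
    using hs_at_split assms by metis
  define k l where "k = inv g \<otimes> p" and "l = letter (v, b)"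
  have l: "l \<in> carrier G" "letter (v, \<not> b) = inv l" using assms letter_flip[of "(v, b)"] by (auto simp: l_def)
  have k: "k \<in> carrier G" "p = g \<otimes> k" "k \<otimes> l = l \<otimes> k"
    using p assms lkgrp_commute_letter[of v k b] by (auto simp: k_def l_def simp flip: m_assoc)
  have "a = g \<otimes> (k \<otimes> l) \<otimes> q" using p(3) k(1,2) l assms(1) p(2) by (simp add: l_def m_assoc)
  then have "a = g \<otimes> (l \<otimes> k) \<otimes> q" by (simp only: k(3))
  then have "g \<otimes> inv l \<otimes> inv g \<otimes> a = g \<otimes> k \<otimes> q"
    using p(2) k(1) l assms(1) by (simp add: m_assoc inv_cancel)
  then show ?thesis using len_mult[of p q] p k(2) l by simp
qed

lemma hs_at_one: "hs_at \<one> v b = hs v b"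
  by (auto simp: hs_at_def hs_closed)

text \<open>Were \<open>u\<close> in the opposite half-space, \<open>hs_at_shorten\<close> at
  \<open>\<one>\<close> would make \<open>letter s \<otimes> u\<close> shorter than
  \<open>u\<close>.\<close>

lemma hs_first_letter:
  assumes "fst s \<in> V" "u \<in> carrier G" "len (letter s \<otimes> u) = Suc (len u)"
  shows "u \<notin> hs (fst s) (\<not> snd s)" "letter s \<otimes> u \<in> hs (fst s) (snd s)"
proof -
  show *: "u \<notin> hs (fst s) (\<not> snd s)"
    using hs_at_shorten[of \<one> "fst s" "\<not> snd s" u] assms hs_one by (auto simp: hs_at_one)
  show "letter s \<otimes> u \<in> hs (fst s) (snd s)"
    using hs_letter[OF assms(1,2) *] by simp
qed

lemma conj_expo:
  assumes "f \<in> hom G G" "\<And>v. v \<in> V \<Longrightarrow> g v \<in> carrier G"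
    and f: "\<And>v. v \<in> V \<Longrightarrow> f (gen v) = g v \<otimes> gen v \<otimes> inv (g v)" and "a \<in> carrier G"
  shows "expo w (f a) = expo w a"
  using assms(4)
proof (induction rule: carrier_induct)
  case one
  then show ?case using hom_one[OF assms(1) is_group is_group] by simp
next
  case (mult s a)
  have "expo w (f (letter s)) = expo w (letter s)"
    using hom_letter[OF is_group assms(1) mult(1)] f[OF mult(1)] assms(2) mult(1)
    by (auto simp: letter_def)
  then show ?case
    using mult hom_mult[OF assms(1), of "letter s" a] hom_in_carrier[OF assms(1)] by simp
qed

text \<open>Conjugated back by \<open>g v\<close>, the image of \<open>gen w\<close> commutes with
  \<open>gen v\<close> and has exponent zero at \<open>v\<close>; so \<open>centralizer_gen\<close>
  applies.\<close>

lemma conj_lkgrp: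
  assumes f: "f \<in> hom G G" and g: "\<And>v. v \<in> V \<Longrightarrow> g v \<in> carrier G"
    and fg: "\<And>v. v \<in> V \<Longrightarrow> f (gen v) = g v \<otimes> gen v \<otimes> inv (g v)" and E: "E v w"
  shows "inv (g v) \<otimes> f (gen w) \<otimes> g v \<in> lkgrp v"
proof -
  have vw: "v \<in> V" "w \<in> V" "v \<noteq> w" using E_V[OF E] E_irrefl E by auto
  have fw: "f (gen w) \<in> carrier G" using hom_in_carrier[OF f] vw by simp
  have comm: "f (gen w) \<otimes> f (gen v) = f (gen v) \<otimes> f (gen w)"
    using gen_commute[OF E] hom_mult[OF f] vw by (metis gen_closed)
  have v: "gen v = inv (g v) \<otimes> f (gen v) \<otimes> g v"
    using fg vw g by (simp add: m_assoc inv_cancel)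
  have fv: "f (gen v) \<in> carrier G" using hom_in_carrier[OF f] vw by simp
  have cancel: "(inv (g v) \<otimes> x \<otimes> g v) \<otimes> (inv (g v) \<otimes> y \<otimes> g v) = inv (g v) \<otimes> (x \<otimes> y) \<otimes> g v"
    if "x \<in> carrier G" "y \<in> carrier G" for x y
  proof -
    show ?thesis using that g vw by (simp add: m_assoc inv_cancel)
  qed
  let ?k = "inv (g v) \<otimes> f (gen w) \<otimes> g v"
  have "?k \<otimes> gen v = gen v \<otimes> ?k"
    using cancel[OF fw fv] cancel[OF fv fw] comm v by simp
  moreover have "expo v ?k = 0"
    using conj_expo[OF f g fg, of "gen w" v] fw vw g by simp
  ultimately show ?thesis using centralizer_gen[of v ?k] vw g fw by simp
qed

text \<open>Ping-pong: \<open>f (letter (v, b))\<close> maps the complement of \<open>hs_at (g v) v (\<not> b)\<close> into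
  \<open>hs_at (g v) v b\<close>.\<close>

lemma conj_ping_pong:
  assumes f: "f \<in> hom G G" and g: "\<And>v. v \<in> V \<Longrightarrow> g v \<in> carrier G"
    and fg: "\<And>v. v \<in> V \<Longrightarrow> f (gen v) = g v \<otimes> gen v \<otimes> inv (g v)"
    and one: "\<And>v b. v \<in> V \<Longrightarrow> \<one> \<notin> hs_at (g v) v b"
    and apart: "\<And>v w b. v \<in> V \<Longrightarrow> w \<in> V \<Longrightarrow> v \<noteq> w \<Longrightarrow> \<not> E v w \<Longrightarrow> g w \<notin> hs_at (g v) v b"
  shows "u \<in> carrier G \<Longrightarrow> v \<in> V \<Longrightarrow> f u \<in> hs_at (g v) v b \<longleftrightarrow> u \<in> hs v b"
proof (induction "len u" arbitrary: u v b rule: less_induct)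
  case less
  have f_letter: "f (letter (v, b)) = g v \<otimes> letter (v, b) \<otimes> inv (g v)" if "v \<in> V" for v b
    using hom_letter[OF is_group f, of "(v, b)"] fg[OF that] g[OF that] that
    by (cases b) (auto simp: inv_mult_group m_assoc)
  have F1: "f (letter (v, b)) \<otimes> a \<in> hs_at (g v) v b"
    if "v \<in> V" "a \<in> carrier G" "a \<notin> hs_at (g v) v (\<not> b)" for v b a
  proof -
    have "inv (g v) \<otimes> (f (letter (v, b)) \<otimes> a) = letter (v, b) \<otimes> (inv (g v) \<otimes> a)"
      using f_letter that g by (simp add: m_assoc inv_cancel)
    then show ?thesis
      using hs_letter[of v "inv (g v) \<otimes> a" b] that g f_letter by (auto simp: hs_at_def)
  qed
  \<comment> \<open>By \<open>conj_lkgrp\<close> the images of letters adjacent to \<open>v\<close>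
    act, seen from \<open>g v\<close>, as elements of \<open>lkgrp v\<close> and preserve the
    half-spaces of \<open>v\<close>.\<close>
  have F2: "f (letter s) \<otimes> a \<in> hs_at (g v) v b \<longleftrightarrow> a \<in> hs_at (g v) v b"
    if "E v (fst s)" "a \<in> carrier G" for v b s a
  proof -
    have vs: "v \<in> V" "fst s \<in> V" using E_V[OF that(1)] by auto
    have fl: "f (letter s) \<in> carrier G" "f (gen (fst s)) \<in> carrier G" using hom_in_carrier[OF f] vs by auto
    define k where "k = inv (g v) \<otimes> f (letter s) \<otimes> g v"
    have "inv (inv (g v) \<otimes> f (gen (fst s)) \<otimes> g v) = inv (g v) \<otimes> inv (f (gen (fst s))) \<otimes> g v"
      using g vs fl by (simp add: inv_mult_group m_assoc)
    then have "k \<in> lkgrp v"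
      using conj_lkgrp[OF f g fg that(1)] hom_letter[OF is_group f vs(2)]
        lkgrp_inv[of "inv (g v) \<otimes> f (gen (fst s)) \<otimes> g v" v] by (cases "snd s") (simp_all add: k_def)
    moreover have "inv (g v) \<otimes> (f (letter s) \<otimes> a) = k \<otimes> (inv (g v) \<otimes> a)"
      using g vs fl that by (simp add: k_def m_assoc inv_cancel)
    ultimately show ?thesis using hs_lkgrp_mult[of v k "inv (g v) \<otimes> a" b] vs g that fl
      by (auto simp: hs_at_def)
  qed
  show ?case
  proof (cases "u = \<one>")
    case True
    then show ?thesis using one less.prems hom_one[OF f is_group is_group] hs_one by auto
  next
    case False
    then obtain s u' where s: "fst s \<in> V" "u' \<in> carrier G" "u = letter s \<otimes> u'" "len u = Suc (len u')"
      using geodesic_first_letter less.prems by metis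
    have u': "u' \<notin> hs (fst s) (\<not> snd s)" "u \<in> hs (fst s) (snd s)"
      using hs_first_letter[of s u'] s by auto
    have fu: "f u = f (letter s) \<otimes> f u'" using hom_mult[OF f] s by simp
    have fu': "f u' \<in> carrier G" using hom_in_carrier[OF f] s by simp
    have IH: "f u' \<in> hs_at (g w) w c \<longleftrightarrow> u' \<in> hs w c" if "w \<in> V" for w c
      using less.hyps[of u' w c] s that by simp
    have in_s: "f u \<in> hs_at (g (fst s)) (fst s) (snd s)"
      using F1[of "fst s" "f u'" "snd s"] IH u' s fu fu' by simp
    \<comment> \<open>Both \<open>u\<close> and \<open>f u\<close> lie on the side of the first
      letter \<open>s\<close>. For the same label the opposite side is excluded; an adjacent letter
      changes neither membership; in the remaining case \<open>hs_at_disjoint\<close> keeps both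
      out, for \<open>u\<close> with all translations taken as \<open>\<one>\<close>.\<close>
    consider "v = fst s" | "E v (fst s)" | "v \<noteq> fst s" "\<not> E v (fst s)" by blast
    then show ?thesis
    proof cases
      case 1
      have "inv (g v) \<otimes> f u \<in> hs v (snd s)" using in_s 1 by (simp add: hs_at_def)
      then have "inv (g v) \<otimes> f u \<notin> hs v (\<not> snd s)" "u \<notin> hs v (\<not> snd s)"
        using hs_disjoint[OF less.prems(2)] u' 1 by (cases "snd s"; auto)+
      then show ?thesis using in_s u' 1 by (cases "b = snd s") (auto simp: hs_at_def)
    next
      case 2
      have "letter s \<in> lkgrp v" using gen_lkgrp[OF 2] lkgrp_inv by (simp add: letter_def)
      then have "u \<in> hs v b \<longleftrightarrow> u' \<in> hs v b" using hs_lkgrp_mult[of v "letter s" u' b] s less.prems by simp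
      then show ?thesis using F2[OF 2 fu'] IH fu less.prems by simp
    next
      case 3
      have "\<not> E (fst s) v" using 3 E_sym by blast
      then have "f u \<notin> hs_at (g v) v b"
        using hs_at_disjoint[of "g v" "g (fst s)" v "fst s" "snd s" b] 3 g apart one in_s s less.prems
        by blast
      moreover have "u \<notin> hs v b"
      proof -
        have "hs_at \<one> v b \<inter> hs_at \<one> (fst s) (snd s) = {}"
          using 3 s less.prems hs_one by (intro hs_at_disjoint) (auto simp: hs_at_one)
        then show ?thesis using u' by (auto simp: hs_at_one)
      qed
      ultimately show ?thesis by simp
    qed
  qed
qed

text \<open>By ping-pong, \<open>gen y\<close> lies in the half-space belonging to the first letter
  of a preimage. The single edge from \<open>\<one>\<close> to \<open>gen y\<close> enters it only
  if that letter is \<open>y\<close> itself and \<open>g y\<close> lies in \<open>lkgrp y\<close>,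
  and then the conjugation is trivial.\<close>

lemma conj_apart_imp_identity:
  assumes f: "f \<in> hom G G" and surj: "carrier G \<subseteq> f ` carrier G"
    and g: "\<And>v. v \<in> V \<Longrightarrow> g v \<in> carrier G"
    and fg: "\<And>v. v \<in> V \<Longrightarrow> f (gen v) = g v \<otimes> gen v \<otimes> inv (g v)"
    and one: "\<And>v b. v \<in> V \<Longrightarrow> \<one> \<notin> hs_at (g v) v b"
    and apart: "\<And>v w b. v \<in> V \<Longrightarrow> w \<in> V \<Longrightarrow> v \<noteq> w \<Longrightarrow> \<not> E v w \<Longrightarrow> g w \<notin> hs_at (g v) v b"
    and y: "y \<in> V"
  shows "f (gen y) = gen y"
proof -
  obtain u where u: "u \<in> carrier G" "f u = gen y" using subsetD[OF surj gen_closed[OF y]] by auto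
  have "gen y \<noteq> \<one>" using y expo_gen[of y y] expo_one[of y] by (metis of_bool_eq_1_iff zero_neq_one)
  then have "u \<noteq> \<one>" using u hom_one[OF f is_group is_group] by auto
  then obtain s u' where s: "fst s \<in> V" "u' \<in> carrier G" "u = letter s \<otimes> u'" "len u = Suc (len u')"
    using geodesic_first_letter u by metis
  then have "u \<in> hs (fst s) (snd s)" using hs_first_letter[of s u'] by simp
  then have in_s: "\<one> \<otimes> letter (y, True) \<in> hs_at (g (fst s)) (fst s) (snd s)"
    using conj_ping_pong[OF f g fg one apart u(1) s(1)] u y by simp
  then have "(y, True) = s" "inv (g y) \<in> lkgrp y"
    using hs_at_crossing[of "g (fst s)" \<one> "(y, True)" "fst s" "snd s"] one s y g by auto
  then have "g y \<in> lkgrp y" using lkgrp_inv_iff g y by simp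
  then have "g y \<otimes> gen y = gen y \<otimes> g y" using lkgrp_commute y by simp
  then have "g y \<otimes> gen y \<otimes> inv (g y) = gen y" using y g by (simp add: m_assoc)
  then show ?thesis using fg y by simp
qed

section \<open>Conjugator length and the shortening step\<close>

text \<open>It depends only on the value of \<open>f\<close> at the generator, so it also applies to
  composites that are not restricted to the carrier.\<close>

definition conj_len :: "(('v \<times> bool) list set \<Rightarrow> ('v \<times> bool) list set) \<Rightarrow> 'v \<Rightarrow> nat" where
  "conj_len f v = (LEAST n. \<exists>g\<in>carrier G. f (gen v) = g \<otimes> gen v \<otimes> inv g \<and> n = len g)"

lemma conj_len_le:
  "g \<in> carrier G \<Longrightarrow> f (gen v) = g \<otimes> gen v \<otimes> inv g \<Longrightarrow> conj_len f v \<le> len g"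
  unfolding conj_len_def by (rule Least_le) auto

lemma conj_len_attained:
  assumes "g \<in> carrier G" "f (gen v) = g \<otimes> gen v \<otimes> inv g"
  shows "\<exists>g\<in>carrier G. f (gen v) = g \<otimes> gen v \<otimes> inv g \<and> conj_len f v = len g"
  unfolding conj_len_def by (rule LeastI) (use assms in blast)

text \<open>Otherwise a geodesic for \<open>inv g\<close> would cross the hyperplane: an initial
  part in \<open>lkgrp v\<close> followed by a letter \<open>v\<close>. This prefix \<open>c\<close>
  centralizes \<open>gen v\<close>, and dropping it gives a shorter conjugator.\<close>

lemma conj_len_minimal:
  assumes v: "v \<in> V" and g: "g \<in> carrier G" "f (gen v) = g \<otimes> gen v \<otimes> inv g" "conj_len f v = len g"
  shows "\<one> \<notin> hs_at g v b"
proof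
  assume "\<one> \<in> hs_at g v b"
  then have "inv g \<in> hs_at \<one> v b" using g by (simp add: hs_at_def hs_closed)
  then obtain p q where p: "p \<in> carrier G" "q \<in> carrier G" "inv g = p \<otimes> letter (v, b) \<otimes> q"
    "inv \<one> \<otimes> p \<in> lkgrp v" "len p + 1 + len q \<le> len (inv g)"
    using hs_at_split[of \<one> v b "inv g"] v hs_one by (auto simp: hs_at_one)
  define c where "c = p \<otimes> letter (v, b)"
  have c: "c \<in> carrier G" "inv g = c \<otimes> q" using p v by (auto simp: c_def)
  have "letter (v, b) \<otimes> gen v = gen v \<otimes> letter (v, b)" using v by (cases b) auto
  then have cv: "c \<otimes> gen v = gen v \<otimes> c"
    using lkgrp_commute[of v p] p v unfolding c_def
    by (metis gen_closed fst_conv inv_one l_one letter_closed m_assoc)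
  have "g = inv q \<otimes> inv c" using c p g by (metis inv_inv inv_mult_group)
  then have "f (gen v) = inv q \<otimes> (inv c \<otimes> gen v \<otimes> c) \<otimes> q"
    using g c p v by (simp add: m_assoc inv_mult_group)
  also have "inv c \<otimes> gen v \<otimes> c = gen v"
    using cv c v by (metis gen_closed inv_closed inv_solve_left' m_assoc m_closed)
  finally have "conj_len f v \<le> len (inv q)" using conj_len_le[of "inv q" f v] p by simp
  then show False using len_inv[of q] len_inv[of g] p g by simp
qed

text \<open>For shortest conjugators, \<open>conj_apart_imp_identity\<close> yields some
  \<open>g u\<close> beyond a hyperplane of \<open>v\<close> at \<open>g v\<close>. Precomposing
  with \<open>P\<close> multiplies exactly the conjugators beyond it on the left by a conjugate of a
  letter, which \<open>hs_at_shorten\<close> makes a gain. That some \<open>P\<close> has these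
  values is left open here; see \<open>saturated_half_space\<close>.\<close>

lemma conj_shorten:
  assumes f: "f \<in> hom G G" "carrier G \<subseteq> f ` carrier G" and conj: "conjugating V E f"
    and nontriv: "\<exists>v\<in>V. f (gen v) \<noteq> gen v"
  obtains g v b where "v \<in> V" "\<And>w. w \<in> V \<Longrightarrow> g w \<in> carrier G"
    "\<And>w. w \<in> V \<Longrightarrow> f (gen w) = g w \<otimes> gen w \<otimes> inv (g w)"
    "\<And>P. P \<in> hom G G \<Longrightarrow> (\<And>w. w \<in> V \<Longrightarrow> P (gen w) =
        (if w \<notin> star V E v \<and> g w \<in> hs_at (g v) v b then letter (v, \<not> b) \<otimes> gen w \<otimes> letter (v, b) else gen w)) \<Longrightarrow>
      (\<Sum>w\<in>V. conj_len (\<lambda>a. f (P a)) w) < (\<Sum>w\<in>V. conj_len f w)"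
proof -
  have "\<forall>v\<in>V. \<exists>g\<in>carrier G. f (gen v) = g \<otimes> gen v \<otimes> inv g \<and> conj_len f v = len g"
    using conj conj_len_attained unfolding conjugating_def G_def[symmetric] by blast
  then obtain g where g: "\<And>w. w \<in> V \<Longrightarrow> g w \<in> carrier G"
    and fg: "\<And>w. w \<in> V \<Longrightarrow> f (gen w) = g w \<otimes> gen w \<otimes> inv (g w)"
    and min: "\<And>w. w \<in> V \<Longrightarrow> conj_len f w = len (g w)"
    by metis
  have one: "\<one> \<notin> hs_at (g v) v b" if "v \<in> V" for v b
    using conj_len_minimal[OF that g[OF that] fg[OF that] min[OF that]] .
  obtain v u b where v: "v \<in> V" "u \<in> V" "v \<noteq> u" "\<not> E v u" "g u \<in> hs_at (g v) v b"
  proof (atomize_elim, rule ccontr)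
    assume none: "\<nexists>v u b. v \<in> V \<and> u \<in> V \<and> v \<noteq> u \<and> \<not> E v u \<and> g u \<in> hs_at (g v) v b"
    have "f (gen y) = gen y" if "y \<in> V" for y
      by (rule conj_apart_imp_identity[OF f g fg one _ that]) (use none in blast)+
    then show False using nontriv by blast
  qed
  show ?thesis
  proof (rule that[OF v(1) g fg])
    fix P assume P: "P \<in> hom G G" and P_gen: "\<And>w. w \<in> V \<Longrightarrow> P (gen w) =
        (if w \<notin> star V E v \<and> g w \<in> hs_at (g v) v b then letter (v, \<not> b) \<otimes> gen w \<otimes> letter (v, b) else gen w)"
    define l where "l = letter (v, b)"
    have l: "l \<in> carrier G" "letter (v, \<not> b) = inv l" using v letter_flip[of "(v, b)"] by (auto simp: l_def)
    interpret f: group_hom G G f using f by (simp add: group_hom_def group_hom_axioms_def)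
    have fl: "f l = g v \<otimes> l \<otimes> inv (g v)"
      using hom_letter[OF is_group f(1), of "(v, b)"] fg[OF v(1)] g[OF v(1)] v(1)
      by (cases b) (auto simp: l_def inv_mult_group m_assoc)
    then have fl': "f (inv l) = g v \<otimes> inv l \<otimes> inv (g v)"
      using l g v by (simp add: inv_mult_group m_assoc)
    have less: "conj_len (\<lambda>a. f (P a)) w < conj_len f w"
      if w: "w \<in> V" "w \<notin> star V E v" "g w \<in> hs_at (g v) v b" for w
    proof -
      let ?h = "g v \<otimes> inv l \<otimes> inv (g v) \<otimes> g w"
      have "f (P (gen w)) = f (inv l) \<otimes> f (gen w) \<otimes> f l"
        using P_gen w hom_mult[OF f(1)] l w by (simp add: l_def[symmetric])
      also have "\<dots> = ?h \<otimes> gen w \<otimes> inv ?h"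
        using fl fl' fg[OF w(1)] g v w l by (simp add: m_assoc inv_mult_group)
      finally have "conj_len (\<lambda>a. f (P a)) w \<le> len ?h"
        using g v w l by (intro conj_len_le) auto
      also have "len ?h < len (g w)"
        using hs_at_shorten[of "g v" v b "g w"] one v g w l by simp
      finally show ?thesis using min w by simp
    qed
    have le: "conj_len (\<lambda>a. f (P a)) w \<le> conj_len f w" if "w \<in> V" for w
    proof (cases "w \<notin> star V E v \<and> g w \<in> hs_at (g v) v b")
      case True
      then show ?thesis using less that by (simp add: less_imp_le)
    next
      case False
      then have "f (P (gen w)) = f (gen w)" using P_gen[OF that] by auto
      then show ?thesis by (simp add: conj_len_def)
    qed
    show "(\<Sum>w\<in>V. conj_len (\<lambda>a. f (P a)) w) < (\<Sum>w\<in>V. conj_len f w)"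
    proof (rule sum_strict_mono_ex1[OF finite_V])
      show "\<forall>w\<in>V. conj_len (\<lambda>a. f (P a)) w \<le> conj_len f w" using le by blast
      show "\<exists>w\<in>V. conj_len (\<lambda>a. f (P a)) w < conj_len f w"
        using less v by (intro bexI[of _ u]) (auto simp: star_eq)
    qed
  qed
qed

section \<open>Conjugations by powers of a generator\<close>

lemma hom_inverse_auto:
  assumes P: "P \<in> hom G G" and Q: "Q \<in> hom G G"
    and PQ: "\<And>v. v \<in> V \<Longrightarrow> P (Q (gen v)) = gen v" and QP: "\<And>v. v \<in> V \<Longrightarrow> Q (P (gen v)) = gen v"
  shows "restrict P (carrier G) \<in> auto G"
proof -
  have id: "(\<lambda>a. a) \<in> hom G G" by (simp add: hom_def)
  have PQ': "P (Q a) = a" if "a \<in> carrier G" for a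
    using hom_eqI[OF is_group Group.hom_compose[OF Q P] id _ that] PQ by simp
  have QP': "Q (P a) = a" if "a \<in> carrier G" for a
    using hom_eqI[OF is_group Group.hom_compose[OF P Q] id _ that] QP by simp
  have "bij_betw P (carrier G) (carrier G)"
    by (rule bij_betw_byWitness[where f' = Q])
      (use PQ' QP' hom_in_carrier[OF P] hom_in_carrier[OF Q] in auto)
  moreover have "restrict P (carrier G) \<in> hom G G"
    by (rule homI) (simp_all add: hom_mult[OF P] hom_in_carrier[OF P])
  ultimately show ?thesis by (simp add: auto_def Bij_def)
qed

lemma gen_star_commute:
  assumes "x \<in> V" "u = x \<or> E x u"
  shows "gen x [^] (n::int) \<otimes> gen u \<otimes> gen x [^] (- n) = gen u"
proof -
  have u: "u \<in> V" using assms E_V by auto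
  have c: "gen u \<otimes> gen x = gen x \<otimes> gen u" using assms(2) gen_commute by auto
  have nat: "gen x [^] k \<otimes> gen u = gen u \<otimes> gen x [^] k" for k :: nat
    using group_commutes_pow[of "gen x" "gen u" k] c assms(1) u by simp
  have "inv (gen x [^] k) \<otimes> gen u = gen u \<otimes> inv (gen x [^] k)" for k :: nat
    using commute_inv[of "gen x [^] k" "gen u"] nat assms(1) u by simp
  then have "gen x [^] n \<otimes> gen u = gen u \<otimes> gen x [^] n"
    using nat assms(1) by (cases n rule: int_cases2) (simp_all add: int_pow_int int_pow_neg_int)
  then show ?thesis using assms(1) u by (simp add: m_assoc flip: int_pow_mult)
qed

text \<open>A partial conjugation whose exponent may vary from component to component of the
  complement of the star. These are the factors of the lifts upstairs.\<close>

lemma graded_conj_exists: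
  fixes b :: "'v \<Rightarrow> int"
  assumes x: "x \<in> V"
    and b: "\<And>u u'. E u u' \<Longrightarrow> u \<notin> star V E x \<Longrightarrow> u' \<notin> star V E x \<Longrightarrow> b u = b u'"
  obtains P where "P \<in> auto G" "\<And>u. u \<in> V \<Longrightarrow> P (gen u) = gen x [^] b u \<otimes> gen u \<otimes> gen x [^] (- b u)"
proof -
  have "\<exists>P\<in>hom G G. \<forall>u\<in>V. P (gen u) = gen x [^] b u \<otimes> gen u \<otimes> gen x [^] (- b u)"
    if b: "\<And>u u'. E u u' \<Longrightarrow> u \<notin> star V E x \<Longrightarrow> u' \<notin> star V E x \<Longrightarrow> b u = b u'" for b :: "'v \<Rightarrow> int"
  proof -
    define h where "h n u = gen x [^] n \<otimes> gen u \<otimes> gen x [^] (- n)" for n :: int and u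
    have h_star: "h n u = h m u" if "u \<in> star V E x" for n m u
      using gen_star_commute[OF x] that by (auto simp: h_def star_eq)
    have h_comm: "h n u \<otimes> h n u' = h n u' \<otimes> h n u" if "E u u'" for n u u'
    proof -
      have uu: "u \<in> V" "u' \<in> V" using E_V[OF that] by auto
      have "h n v \<otimes> h n v' = gen x [^] n \<otimes> (gen v \<otimes> gen v') \<otimes> gen x [^] (- n)" if "v \<in> V" "v' \<in> V" for v v'
        using that x by (simp add: h_def m_assoc int_pow_neg inv_cancel)
      then show ?thesis using uu gen_commute[OF that] by simp
    qed
    have comm: "h (b u) u \<otimes> h (b u') u' = h (b u') u' \<otimes> h (b u) u" if "E u u'" for u u'
    proof -
      \<comment> \<open>An end of the edge that lies in the star tolerates every exponent, so one
        exponent serves both ends.\<close>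
      have "\<exists>n. h (b u) u = h n u \<and> h (b u') u' = h n u'"
        using b[OF that] h_star by (metis (no_types))
      then show ?thesis using h_comm[OF that] by metis
    qed
    obtain P where "P \<in> hom G G" "\<And>u. u \<in> V \<Longrightarrow> P (gen u) = h (b u) u"
      by (rule universal_property[OF is_group, of "\<lambda>u. h (b u) u", OF _ comm])
        (assumption | simp add: h_def x)+
    then show ?thesis by (auto simp: h_def)
  qed note ex = this
  obtain P where P: "P \<in> hom G G" "\<And>u. u \<in> V \<Longrightarrow> P (gen u) = gen x [^] b u \<otimes> gen u \<otimes> gen x [^] (- b u)"
    using ex[of b, OF b] by blast
  obtain Q where Q: "Q \<in> hom G G" "\<And>u. u \<in> V \<Longrightarrow> Q (gen u) = gen x [^] (- b u) \<otimes> gen u \<otimes> gen x [^] (b u)"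
    using ex[of "\<lambda>u. - b u"] b by auto
  interpret P: group_hom G G P using P by (simp add: group_hom_def group_hom_axioms_def)
  interpret Q: group_hom G G Q using Q by (simp add: group_hom_def group_hom_axioms_def)
  \<comment> \<open>Both maps fix \<open>gen x\<close>, so opposite exponents cancel and
    \<open>Q\<close> inverts \<open>P\<close>.\<close>
  have Px: "P (gen x) = gen x" "Q (gen x) = gen x"
    using P(2)[OF x] Q(2)[OF x] gen_star_commute[OF x, of x "b x"] gen_star_commute[OF x, of x "- b x"] by auto
  have "restrict P (carrier G) \<in> auto G"
  proof (rule hom_inverse_auto[OF P(1) Q(1)])
    fix v assume v: "v \<in> V"
    show "P (Q (gen v)) = gen v" "Q (P (gen v)) = gen v"
      using v x P(2)[OF v] Q(2)[OF v] Px
      by (simp_all add: P.hom_int_pow Q.hom_int_pow m_assoc int_pow_neg inv_cancel)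
  qed
  then show ?thesis using that[of "restrict P (carrier G)"] P(2) by simp
qed

section \<open>The automorphism group and conjugating automorphisms\<close>

lemma auto_compose: "f \<in> auto G \<Longrightarrow> h \<in> auto G \<Longrightarrow> f \<otimes>\<^bsub>AutoGroup G\<^esub> h = compose (carrier G) f h"
  by (simp add: AutoGroup_def BijGroup_def auto_def)

lemma auto_one: "\<one>\<^bsub>AutoGroup G\<^esub> = (\<lambda>a\<in>carrier G. a)"
  by (simp add: AutoGroup_def BijGroup_def)

lemma carrier_AutoGroup: "carrier (AutoGroup G) = auto G"
  by (simp add: AutoGroup_def)

lemma auto_closed: "f \<in> auto G \<Longrightarrow> a \<in> carrier G \<Longrightarrow> f a \<in> carrier G"
  by (auto simp: auto_def hom_in_carrier)

lemma auto_hom: "f \<in> auto G \<Longrightarrow> f \<in> hom G G"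
  by (simp add: auto_def)

lemma auto_surj: "f \<in> auto G \<Longrightarrow> carrier G \<subseteq> f ` carrier G"
  by (auto simp: auto_def Bij_def bij_betw_def)

sublocale aut: group "AutoGroup G" by (rule AutoGroup)

lemma auto_inv:
  assumes f: "f \<in> auto G" and a: "a \<in> carrier G"
  shows "f ((inv\<^bsub>AutoGroup G\<^esub> f) a) = a" "(inv\<^bsub>AutoGroup G\<^esub> f) (f a) = a"
proof -
  have i: "inv\<^bsub>AutoGroup G\<^esub> f \<in> auto G" using f aut.inv_closed[of f] carrier_AutoGroup by simp
  have "compose (carrier G) f (inv\<^bsub>AutoGroup G\<^esub> f) = (\<lambda>a\<in>carrier G. a)"
    "compose (carrier G) (inv\<^bsub>AutoGroup G\<^esub> f) f = (\<lambda>a\<in>carrier G. a)"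
    using aut.r_inv[of f] aut.l_inv[of f] f i carrier_AutoGroup by (simp_all add: auto_compose auto_one)
  then show "f ((inv\<^bsub>AutoGroup G\<^esub> f) a) = a" "(inv\<^bsub>AutoGroup G\<^esub> f) (f a) = a"
    using a by (metis compose_eq restrict_apply')+
qed

lemma auto_inv_auto: "f \<in> auto G \<Longrightarrow> inv\<^bsub>AutoGroup G\<^esub> f \<in> auto G"
  using aut.inv_closed[of f] carrier_AutoGroup by simp

lemma auto_compose_auto: "f \<in> auto G \<Longrightarrow> h \<in> auto G \<Longrightarrow> compose (carrier G) f h \<in> auto G"
  using aut.m_closed[of f h] carrier_AutoGroup auto_compose by simp

lemma conjugating_id: "conjugating V E (\<lambda>a\<in>carrier G. a)"
  unfolding conjugating_def G_def[symmetric] by (intro ballI bexI[of _ \<one>]) auto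

lemma conjugating_compose:
  assumes f: "f \<in> auto G" "conjugating V E f" and h: "conjugating V E h"
  shows "conjugating V E (compose (carrier G) f h)"
  unfolding conjugating_def G_def[symmetric]
proof
  fix v assume v: "v \<in> V"
  obtain a b where a: "a \<in> carrier G" "f (gen v) = a \<otimes> gen v \<otimes> inv a"
    and b: "b \<in> carrier G" "h (gen v) = b \<otimes> gen v \<otimes> inv b"
    using assms v unfolding conjugating_def G_def[symmetric] by metis
  interpret f: group_hom G G f using auto_hom[OF f(1)] by (simp add: group_hom_def group_hom_axioms_def)
  have "compose (carrier G) f h (gen v) = (f b \<otimes> a) \<otimes> gen v \<otimes> inv (f b \<otimes> a)"
    using a b v by (simp add: compose_eq m_assoc inv_mult_group)
  then show "\<exists>g\<in>carrier G. compose (carrier G) f h (gen v) = g \<otimes> gen v \<otimes> inv g"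
    using a b by (intro bexI[of _ "f b \<otimes> a"]) auto
qed

lemma conjugating_inv:
  assumes f: "f \<in> auto G" "conjugating V E f"
  shows "conjugating V E (inv\<^bsub>AutoGroup G\<^esub> f)"
  unfolding conjugating_def G_def[symmetric]
proof
  fix v assume v: "v \<in> V"
  obtain a where a: "a \<in> carrier G" "f (gen v) = a \<otimes> gen v \<otimes> inv a"
    using f(2) v unfolding conjugating_def G_def[symmetric] by metis
  let ?i = "inv\<^bsub>AutoGroup G\<^esub> f"
  interpret i: group_hom G G ?i
    using auto_hom[OF auto_inv_auto[OF f(1)]] by (simp add: group_hom_def group_hom_axioms_def)
  have fc: "f (gen v) \<in> carrier G" using auto_closed[OF f(1)] v by simp
  have "gen v = inv a \<otimes> f (gen v) \<otimes> a" using a v by (simp add: m_assoc inv_cancel)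
  then have "?i (gen v) = inv (?i a) \<otimes> ?i (f (gen v)) \<otimes> ?i a" using a fc
    by (metis i.hom_inv i.hom_mult inv_closed m_closed)
  also have "\<dots> = inv (?i a) \<otimes> gen v \<otimes> inv (inv (?i a))" using auto_inv(2)[OF f(1), of "gen v"] v a(1) by simp
  finally show "\<exists>g\<in>carrier G. ?i (gen v) = g \<otimes> gen v \<otimes> inv g"
    using a by (intro bexI[of _ "inv (?i a)"]) auto
qed

lemma partial_conj_conjugating:
  assumes "v \<in> V" "is_partial_conj V E v C f"
  shows "conjugating V E f"
  unfolding conjugating_def G_def[symmetric]
proof
  fix w assume w: "w \<in> V"
  show "\<exists>g\<in>carrier G. f (gen w) = g \<otimes> gen w \<otimes> inv g"
    using assms w unfolding is_partial_conj_def G_def[symmetric]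
    by (intro bexI[of _ "if w \<in> C then gen v else \<one>"]) auto
qed

end

section \<open>Coverings\<close>

locale raag_cover =
  up: raag VL EL L + dn: raag VG EG G
  for VL :: "'w set" and EL :: "'w \<Rightarrow> 'w \<Rightarrow> bool" and L
    and VG :: "'v set" and EG :: "'v \<Rightarrow> 'v \<Rightarrow> bool" and G +
  fixes \<phi> :: "'w \<Rightarrow> 'v"
  assumes cover: "covering_map VL EL VG EG \<phi>" and no_isolated: "no_isolated VG EG"
begin

abbreviation ind :: "('w \<times> bool) list set \<Rightarrow> ('v \<times> bool) list set" where
  "ind \<equiv> induced_hom VL EL VG EG \<phi>"

lemma \<phi>_image: "\<phi> ` VL = VG"
  using cover by (simp add: covering_map_def)

lemma \<phi>_V [simp]: "u \<in> VL \<Longrightarrow> \<phi> u \<in> VG"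
  using \<phi>_image by blast

lemma \<phi>_E: "EL u u' \<Longrightarrow> EG (\<phi> u) (\<phi> u')"
  using cover by (simp add: covering_map_def)

lemma \<phi>_bij: "u \<in> VL \<Longrightarrow> bij_betw \<phi> {w. EL u w} {w. EG (\<phi> u) w}"
  using cover by (simp add: covering_map_def up.nbrs_eq dn.nbrs_eq)

lemma \<phi>_inj_nbrs:
  assumes "EL u y" "EL u y'" "\<phi> y = \<phi> y'"
  shows "y = y'"
  using \<phi>_bij[of u] assms up.E_V[OF assms(1)] by (auto simp: bij_betw_def inj_on_def)

lemma \<phi>_lift_edge:
  assumes "u \<in> VL" "EG (\<phi> u) w"
  obtains u' where "EL u u'" "\<phi> u' = w"
proof -
  have "w \<in> \<phi> ` {w. EL u w}" using \<phi>_bij[OF assms(1)] assms(2) by (simp add: bij_betw_def)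
  then show ?thesis using that by auto
qed

lemma neighbour_exists:
  assumes "u \<in> VL"
  obtains u' where "EL u u'"
  using no_isolated \<phi>_V[OF assms] \<phi>_lift_edge[OF assms] unfolding no_isolated_def by metis

section \<open>Fibres and the induced homomorphism\<close>

definition fib :: "'v \<Rightarrow> 'w set" where
  "fib x = {z \<in> VL. \<phi> z = x}"

lemma finite_fib: "finite (fib x)"
  using up.finite_V by (simp add: fib_def)

lemma fib_not_adjacent: "z \<in> fib x \<Longrightarrow> z' \<in> fib x \<Longrightarrow> \<not> EL z z'"
  using \<phi>_E dn.E_irrefl by (force simp: fib_def)

lemma ind_cls:
  assumes "a \<in> up.words"
  shows "ind (up.cls a) = dn.cls (map (\<lambda>(x, b). (\<phi> x, b)) a)"
proof -
  have *: "raag_rel EG (map (\<lambda>(x, b). (\<phi> x, b)) p) (map (\<lambda>(x, b). (\<phi> x, b)) q)" if "raag_rel EL p q" for p q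
    using that
  proof induction
    case (commute u v xs a b ys)
    then show ?case using raag_rel.commute[of EG "\<phi> u" "\<phi> v"] \<phi>_E by simp
  next
    case (cancel xs v b ys)
    then show ?case using raag_rel.cancel[of EG _ "\<phi> v" b] by simp
  qed (auto intro: raag_rel.refl raag_rel.sym raag_rel.trans)
  have words: "map (\<lambda>(x, b). (\<phi> x, b)) p \<in> dn.words" if "p \<in> up.words" for p
    using that by (auto simp: raag_words_def)
  let ?s = "SOME b. b \<in> up.cls a"
  have "?s \<in> up.cls a" using up.cls_self[OF assms] by (rule someI)
  then have s: "?s \<in> up.words" "raag_rel EL a ?s" using up.mem_clsD by blast+
  have "ind (up.cls a) = dn.cls (map (\<lambda>(x, b). (\<phi> x, b)) ?s)"
    using up.cls_closed[OF assms] by (simp add: induced_hom_def up.G_def dn.cls_def)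
  also have "\<dots> = dn.cls (map (\<lambda>(x, b). (\<phi> x, b)) a)"
    using words s assms * raag_rel.sym by (subst dn.cls_eq_iff) blast+
  finally show ?thesis .
qed

lemma ind_hom: "ind \<in> hom L G"
proof (rule homI)
  have words: "map (\<lambda>(x, b). (\<phi> x, b)) p \<in> dn.words" if "p \<in> up.words" for p
    using that by (auto simp: raag_words_def)
  show "ind a \<in> carrier G" if "a \<in> carrier L" for a
    using that words by (auto simp: up.carrier_eq ind_cls dn.cls_closed)
  show "ind (a \<otimes>\<^bsub>L\<^esub> b) = ind a \<otimes>\<^bsub>G\<^esub> ind b" if "a \<in> carrier L" "b \<in> carrier L" for a b
    using that words by (auto simp: up.carrier_eq ind_cls up.mult_cls dn.mult_cls up.words_append)
qed

sublocale ind: group_hom L G ind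
  using ind_hom by (simp add: group_hom_def group_hom_axioms_def up.is_group dn.is_group)

lemma ind_gen [simp]: "u \<in> VL \<Longrightarrow> ind (up.gen u) = dn.gen (\<phi> u)"
  by (simp add: up.gen_eq dn.gen_eq ind_cls up.words_Cons up.words_Nil)

lemma sum_fib_expo:
  assumes "a \<in> carrier L"
  shows "(\<Sum>y\<in>fib w. up.expo y a) = dn.expo w (ind a)"
  using assms
proof (induction rule: up.carrier_induct)
  case one
  then show ?case by simp
next
  case (mult s a)
  have "(\<Sum>y\<in>fib w. of_bool (fst s = y)) = (of_bool (\<phi> (fst s) = w) :: int)"
    using mult(1) finite_fib[of w] sum.delta[of "fib w" "fst s" "\<lambda>_. 1 :: int"]
    by (simp add: of_bool_def fib_def eq_commute cong: if_cong)
  then have "(\<Sum>y\<in>fib w. up.expo y (up.letter s)) = dn.expo w (ind (up.letter s))"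
    using mult(1) by (simp add: up.letter_def sum_negf)
  then show ?case using mult by (simp add: sum.distrib)
qed

text \<open>Commuting elements have proportional exponents on non-adjacent vertices, and the exponents of
  the image of \<open>u\<close> sum to zero over every fibre but its own.\<close>

lemma lift_permutes_homology:
  assumes F: "F \<in> hom L L" and lift: "\<And>a. a \<in> carrier L \<Longrightarrow> ind (F a) = f (ind a)"
    and f_expo: "\<And>w v. v \<in> VG \<Longrightarrow> dn.expo w (f (dn.gen v)) = of_bool (v = w)"
  obtains \<sigma> where "\<And>u. u \<in> VL \<Longrightarrow> \<sigma> u \<in> VL" "\<And>u. u \<in> VL \<Longrightarrow> \<phi> (\<sigma> u) = \<phi> u"
    "\<And>u u'. EL u u' \<Longrightarrow> EL (\<sigma> u) (\<sigma> u')"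
    "\<And>u y. u \<in> VL \<Longrightarrow> y \<in> VL \<Longrightarrow> up.expo y (F (up.gen u)) = of_bool (y = \<sigma> u)"
proof -
  define e where "e u y = up.expo y (F (up.gen u))" for u y
  have Fc: "F (up.gen u) \<in> carrier L" if "u \<in> VL" for u
    using hom_in_carrier[OF F] that by simp
  have fibsum: "(\<Sum>y\<in>fib w. e u y) = of_bool (\<phi> u = w)" if "u \<in> VL" for u w
    using sum_fib_expo[OF Fc[OF that]] lift[of "up.gen u"] f_expo that by (simp add: e_def)
  have comm: "e u y * e u' y' = e u y' * e u' y"
    if "EL u u'" "y \<in> VL" "y' \<in> VL" "\<not> EL y y'" for u u' y y'
  proof -
    have uu: "u \<in> VL" "u' \<in> VL" using up.E_V[OF that(1)] by auto
    have "F (up.gen u) \<otimes>\<^bsub>L\<^esub> F (up.gen u') = F (up.gen u') \<otimes>\<^bsub>L\<^esub> F (up.gen u)"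
      using up.gen_commute[OF that(1)] hom_mult[OF F] uu by (metis up.gen_closed)
    then show ?thesis unfolding e_def
      using up.expo_commuting[OF Fc[OF uu(1)] Fc[OF uu(2)] _ that(2-4)] by simp
  qed
  \<comment> \<open>Sum \<open>comm\<close> over the fibre of \<open>u\<close>: the exponents of the
    image of \<open>u\<close> add up to one there, those of the image of its neighbour to
    zero.\<close>
  have nbr_zero: "e u' y = 0" if "EL u u'" "y \<in> fib (\<phi> u)" for u u' y
  proof -
    have uu: "u \<in> VL" "u' \<in> VL" using up.E_V[OF that(1)] by auto
    have "\<phi> u' \<noteq> \<phi> u" using \<phi>_E[OF that(1)] dn.E_irrefl by metis
    have y: "y \<in> VL" "\<And>z. z \<in> fib (\<phi> u) \<Longrightarrow> z \<in> VL \<and> \<not> EL y z"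
      using that fib_not_adjacent by (auto simp: fib_def)
    have "e u' y = (\<Sum>z\<in>fib (\<phi> u). e u z) * e u' y" using fibsum[OF uu(1)] by simp
    also have "\<dots> = (\<Sum>z\<in>fib (\<phi> u). e u y * e u' z)"
      unfolding sum_distrib_right using comm[OF that(1) y(1)] y(2) by (intro sum.cong) auto
    also have "\<dots> = e u y * (\<Sum>z\<in>fib (\<phi> u). e u' z)" by (simp add: sum_distrib_left)
    also have "\<dots> = 0" using fibsum[OF uu(2)] \<open>\<phi> u' \<noteq> \<phi> u\<close> by simp
    finally show ?thesis .
  qed
  have ex_nz: "\<exists>y\<in>fib (\<phi> u). e u y \<noteq> 0" if "u \<in> VL" for u
    using fibsum[OF that, of "\<phi> u"] by (metis of_bool_eq(2) sum.neutral zero_neq_one)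
  have adj: "EL y y'" if "EL u u'" "y \<in> fib (\<phi> u)" "y' \<in> fib (\<phi> u')" "e u y \<noteq> 0" "e u' y' \<noteq> 0" for u u' y y'
  proof (rule ccontr)
    assume "\<not> EL y y'"
    then have "e u y * e u' y' = e u y' * e u' y" using comm that by (auto simp: fib_def)
    then show False using nbr_zero[OF that(1,2)] that by simp
  qed
  \<comment> \<open>A vertex \<open>y'\<close> in the image of a neighbour is adjacent to both
    candidates, and the covering is injective on the neighbours of \<open>y'\<close>.\<close>
  have uniq: "y = z" if "u \<in> VL" "y \<in> fib (\<phi> u)" "z \<in> fib (\<phi> u)" "e u y \<noteq> 0" "e u z \<noteq> 0" for u y z
  proof -
    obtain u' where u': "EL u u'" using neighbour_exists \<open>u \<in> VL\<close> .
    then obtain y' where y': "y' \<in> fib (\<phi> u')" "e u' y' \<noteq> 0" using ex_nz up.E_V by blast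
    then have "EL y' y" "EL y' z" using adj[OF u'] that up.E_sym by blast+
    then show ?thesis using \<phi>_inj_nbrs that by (auto simp: fib_def)
  qed
  define \<sigma> where "\<sigma> u = (SOME y. y \<in> fib (\<phi> u) \<and> e u y \<noteq> 0)" for u
  have \<sigma>: "\<sigma> u \<in> fib (\<phi> u)" "e u (\<sigma> u) \<noteq> 0" if "u \<in> VL" for u
    using someI_ex[of "\<lambda>y. y \<in> fib (\<phi> u) \<and> e u y \<noteq> 0"] ex_nz[OF that] unfolding \<sigma>_def by blast+
  have \<sigma>_E: "EL (\<sigma> u) (\<sigma> u')" if "EL u u'" for u u'
    using adj[OF that] \<sigma> up.E_V[OF that] by blast
  \<comment> \<open>All vertices with nonzero exponent are adjacent to \<open>\<sigma> u'\<close>,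
    so each fibre has at most one of them; in a fibre other than that of \<open>u\<close> the
    exponents sum to zero, so it has none.\<close>
  have off: "e u y = 0" if "u \<in> VL" "y \<in> VL" "\<phi> y \<noteq> \<phi> u" for u y
  proof (rule ccontr)
    assume nz: "e u y \<noteq> 0"
    obtain u' where u': "EL u u'" using neighbour_exists \<open>u \<in> VL\<close> .
    have u'V: "u' \<in> VL" using up.E_V[OF u'] by simp
    have adj_y: "EL (\<sigma> u') z" if "z \<in> VL" "e u z \<noteq> 0" for z
    proof (rule ccontr)
      assume "\<not> EL (\<sigma> u') z"
      then have "\<not> EL z (\<sigma> u')" using up.E_sym by blast
      then have "e u z * e u' (\<sigma> u') = e u (\<sigma> u') * e u' z"
        using comm[OF u' that(1)] \<sigma>(1)[OF u'V] by (auto simp: fib_def)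
      moreover have "e u (\<sigma> u') = 0"
        using nbr_zero[of u' u "\<sigma> u'"] u' up.E_sym \<sigma>(1)[OF u'V] by blast
      ultimately show False using that \<sigma>(2)[OF u'V] by simp
    qed
    have "e u z = 0" if "z \<in> fib (\<phi> y)" "z \<noteq> y" for z
    proof (rule ccontr)
      assume "e u z \<noteq> 0"
      then have "EL (\<sigma> u') z" "EL (\<sigma> u') y" using adj_y nz that \<open>y \<in> VL\<close> by (auto simp: fib_def)
      then show False using \<phi>_inj_nbrs that by (auto simp: fib_def)
    qed
    then have "(\<Sum>z\<in>fib (\<phi> y). e u z) = (\<Sum>z\<in>{y}. e u z)"
      using \<open>y \<in> VL\<close> finite_fib by (intro sum.mono_neutral_right) (auto simp: fib_def)
    then show False using fibsum[OF that(1), of "\<phi> y"] that nz by simp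
  qed
  have e_eq: "e u y = of_bool (y = \<sigma> u)" if u: "u \<in> VL" and y: "y \<in> VL" for u y
  proof -
    have zero: "e u z = 0" if "z \<in> fib (\<phi> u)" "z \<noteq> \<sigma> u" for z
      using uniq[OF u that(1) \<sigma>(1)[OF u]] \<sigma>(2)[OF u] that by blast
    then have "(\<Sum>z\<in>fib (\<phi> u). e u z) = (\<Sum>z\<in>{\<sigma> u}. e u z)"
      using \<sigma>(1)[OF u] finite_fib by (intro sum.mono_neutral_right) auto
    then have "e u (\<sigma> u) = 1" using fibsum[OF u, of "\<phi> u"] by simp
    then show ?thesis using zero[of y] off[OF u y] y by (auto simp: fib_def)
  qed
  show ?thesis
  proof (rule that[of \<sigma>])
    show "\<sigma> u \<in> VL" "\<phi> (\<sigma> u) = \<phi> u" if "u \<in> VL" for u using \<sigma>[OF that] by (auto simp: fib_def)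
    show "EL (\<sigma> u) (\<sigma> u')" if "EL u u'" for u u' using \<sigma>_E[OF that] .
    show "up.expo y (F (up.gen u)) = of_bool (y = \<sigma> u)" if "u \<in> VL" "y \<in> VL" for u y
      using e_eq[OF that] by (simp add: e_def)
  qed
qed

text \<open>On homology the lift \<open>F\<close> permutes the generators by a graph map
  \<open>\<sigma>\<close> over the identity. The inverse lift gives a map \<open>\<tau>\<close> with
  \<open>\<sigma> (\<tau> u) = u\<close>, and precomposing \<open>F\<close> with
  \<open>\<tau>\<close> undoes the permutation without changing what is lifted.\<close>

lemma homology_trivial_lift:
  assumes f: "f \<in> auto G" and conj: "conjugating VG EG f" and lift: "liftable VL EL VG EG \<phi> f"
  obtains F where "F \<in> hom L L" "\<And>a. a \<in> carrier L \<Longrightarrow> ind (F a) = f (ind a)"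
    "\<And>y a. y \<in> VL \<Longrightarrow> a \<in> carrier L \<Longrightarrow> up.expo y (F a) = up.expo y a"
proof -
  obtain F where F: "F \<in> auto L" "\<And>a. a \<in> carrier L \<Longrightarrow> ind (F a) = f (ind a)"
    using lift unfolding liftable_def up.G_def by metis
  have fh: "f \<in> hom G G" and Fh: "F \<in> hom L L" using f F by (auto simp: auto_def)
  have f_bij: "bij_betw f (carrier G) (carrier G)" and F_bij: "bij_betw F (carrier L) (carrier L)"
    using f F by (auto simp: auto_def Bij_def)
  have "\<forall>v\<in>VG. \<exists>g\<in>carrier G. f (dn.gen v) = g \<otimes>\<^bsub>G\<^esub> dn.gen v \<otimes>\<^bsub>G\<^esub> inv\<^bsub>G\<^esub> g"
    using conj unfolding conjugating_def dn.G_def by blast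
  then obtain g where g: "\<And>v. v \<in> VG \<Longrightarrow> g v \<in> carrier G"
    and fg: "\<And>v. v \<in> VG \<Longrightarrow> f (dn.gen v) = g v \<otimes>\<^bsub>G\<^esub> dn.gen v \<otimes>\<^bsub>G\<^esub> inv\<^bsub>G\<^esub> (g v)"
    by metis
  have f_expo: "dn.expo w (f a) = dn.expo w a" if "a \<in> carrier G" for w a
    using dn.conj_expo[OF fh g fg that] .
  define f' F' where "f' = inv_into (carrier G) f" and "F' = inv_into (carrier L) F"
  have ff': "f (f' a) = a" "f' a \<in> carrier G" "f' (f a) = a" if "a \<in> carrier G" for a
    using that f_bij by (auto simp: f'_def bij_betw_inv_into_right bij_betw_inv_into_left bij_betw_imp_surj_on inv_into_into)
  have FF': "F (F' a) = a" "F' a \<in> carrier L" "F' (F a) = a" if "a \<in> carrier L" for a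
    using that F_bij by (auto simp: F'_def bij_betw_inv_into_right bij_betw_inv_into_left bij_betw_imp_surj_on inv_into_into)
  have F'h: "F' \<in> hom L L"
  proof (rule homI)
    show "F' (a \<otimes>\<^bsub>L\<^esub> b) = F' a \<otimes>\<^bsub>L\<^esub> F' b" if "a \<in> carrier L" "b \<in> carrier L" for a b
    proof -
      have "F (F' a \<otimes>\<^bsub>L\<^esub> F' b) = a \<otimes>\<^bsub>L\<^esub> b" using hom_mult[OF Fh] FF' that by simp
      then show ?thesis using FF'(3)[of "F' a \<otimes>\<^bsub>L\<^esub> F' b"] FF' that by simp
    qed
  qed (use FF' in auto)
  have lift': "ind (F' a) = f' (ind a)" if "a \<in> carrier L" for a
    using F(2)[of "F' a"] FF' ff'(3)[of "ind (F' a)"] that by simp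
  have f'_expo: "dn.expo w (f' a) = dn.expo w a" if "a \<in> carrier G" for w a
    using f_expo[of "f' a"] ff' that by simp
  obtain \<sigma> where \<sigma>: "\<And>u. u \<in> VL \<Longrightarrow> \<sigma> u \<in> VL" "\<And>u. u \<in> VL \<Longrightarrow> \<phi> (\<sigma> u) = \<phi> u"
    "\<And>u u'. EL u u' \<Longrightarrow> EL (\<sigma> u) (\<sigma> u')"
    "\<And>u y. u \<in> VL \<Longrightarrow> y \<in> VL \<Longrightarrow> up.expo y (F (up.gen u)) = of_bool (y = \<sigma> u)"
    using lift_permutes_homology[OF Fh F(2)] f_expo by (metis dn.expo_gen dn.gen_closed)
  obtain \<tau> where \<tau>: "\<And>u. u \<in> VL \<Longrightarrow> \<tau> u \<in> VL" "\<And>u. u \<in> VL \<Longrightarrow> \<phi> (\<tau> u) = \<phi> u"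
    "\<And>u u'. EL u u' \<Longrightarrow> EL (\<tau> u) (\<tau> u')"
    "\<And>u y. u \<in> VL \<Longrightarrow> y \<in> VL \<Longrightarrow> up.expo y (F' (up.gen u)) = of_bool (y = \<tau> u)"
    using lift_permutes_homology[OF F'h lift'] f'_expo by (metis dn.expo_gen dn.gen_closed)
  \<comment> \<open>The matrix of \<open>F\<close> on homology has the columns prescribed by
    \<open>\<sigma>\<close>.\<close>
  have F_expo: "up.expo y (F a) = (\<Sum>u\<in>VL. up.expo u a * of_bool (y = \<sigma> u))" if "y \<in> VL" "a \<in> carrier L" for y a
    using that(2)
  proof (induction rule: up.carrier_induct)
    case one
    then show ?case using hom_one[OF Fh up.is_group up.is_group] by simp
  next
    case (mult s a)
    have "(\<Sum>u\<in>VL. of_bool (fst s = u) * of_bool (y = \<sigma> u)) =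
        (\<Sum>u\<in>VL. if u = fst s then of_bool (y = \<sigma> u) else 0 :: int)"
      by (rule sum.cong) auto
    then have sgl: "(\<Sum>u\<in>VL. of_bool (fst s = u) * of_bool (y = \<sigma> u)) = (of_bool (y = \<sigma> (fst s)) :: int)"
      using mult(1) up.finite_V by simp
    have "up.expo y (F (up.letter s)) = (\<Sum>u\<in>VL. up.expo u (up.letter s) * of_bool (y = \<sigma> u))"
      using up.hom_letter[OF up.is_group Fh mult(1)] mult(1) \<sigma>(4) that(1) sgl hom_in_carrier[OF Fh]
      by (simp add: up.letter_def sum_negf)
    then show ?case
      using mult hom_mult[OF Fh, of "up.letter s" a] hom_in_carrier[OF Fh]
      by (simp add: sum.distrib algebra_simps)
  qed
  have \<sigma>\<tau>: "\<sigma> (\<tau> u) = u" if "u \<in> VL" for u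
  proof -
    have "up.expo u (F (F' (up.gen u))) = (\<Sum>v\<in>VL. of_bool (v = \<tau> u) * of_bool (u = \<sigma> v))"
      using F_expo[OF that, of "F' (up.gen u)"] FF' \<tau>(4)[OF that] that by (auto intro!: sum.cong)
    also have "\<dots> = (\<Sum>v\<in>VL. if v = \<tau> u then of_bool (u = \<sigma> v) else 0)"
      by (rule sum.cong) auto
    also have "\<dots> = of_bool (u = \<sigma> (\<tau> u))"
      using \<tau>(1)[OF that] up.finite_V by simp
    finally show ?thesis using FF'(1)[of "up.gen u"] that by (simp add: of_bool_def split: if_splits)
  qed
  have comm: "F (up.gen (\<tau> u)) \<otimes>\<^bsub>L\<^esub> F (up.gen (\<tau> v)) = F (up.gen (\<tau> v)) \<otimes>\<^bsub>L\<^esub> F (up.gen (\<tau> u))"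
    if "EL u v" for u v
    using up.gen_commute[OF \<tau>(3)[OF that]] hom_mult[OF Fh] \<tau>(1) up.E_V[OF that] by (metis up.gen_closed)
  \<comment> \<open>\<open>H\<close> is \<open>F\<close> after the endomorphism induced by the graph
    map \<open>\<tau>\<close>.\<close>
  obtain H where H: "H \<in> hom L L" "\<And>v. v \<in> VL \<Longrightarrow> H (up.gen v) = F (up.gen (\<tau> v))"
    by (rule up.universal_property[OF up.is_group, of "\<lambda>v. F (up.gen (\<tau> v))", OF _ comm])
      (assumption | simp add: hom_in_carrier[OF Fh] \<tau>(1))+
  show ?thesis
  proof (rule that[OF H(1)])
    show "ind (H a) = f (ind a)" if "a \<in> carrier L" for a
    proof (rule up.hom_eqI[OF dn.is_group _ _ _ that])
      show "(\<lambda>a. ind (H a)) \<in> hom L G"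
        using Group.hom_compose[OF H(1) ind_hom] by (simp add: comp_def)
      show "(\<lambda>a. f (ind a)) \<in> hom L G"
        using Group.hom_compose[OF ind_hom fh] by (simp add: comp_def)
      show "ind (H (up.gen v)) = f (ind (up.gen v))" if "v \<in> VL" for v
        using H(2)[OF that] F(2)[of "up.gen (\<tau> v)"] \<tau>(1,2)[OF that] that by simp
    qed
    show "up.expo y (H a) = up.expo y a" if "y \<in> VL" "a \<in> carrier L" for y a
    proof (rule up.hom_eqI[OF group_integer_group _ _ _ that(2)])
      show "(\<lambda>a. up.expo y (H a)) \<in> hom L integer_group"
        using Group.hom_compose[OF H(1)] up.expo_spec[of y] by (auto simp: comp_def)
      show "up.expo y \<in> hom L integer_group" using up.expo_spec[of y] by simp
      show "up.expo y (H (up.gen v)) = up.expo y (up.gen v)" if "v \<in> VL" for v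
        using H(2)[OF that] \<sigma>(4)[OF \<tau>(1)[OF that] \<open>y \<in> VL\<close>] \<sigma>\<tau>[OF that] that by (auto simp: of_bool_def)
    qed
  qed
qed

subsection \<open>Fox derivatives upstairs\<close>

text \<open>Besides its image in the base group, \<open>twist z\<close> records the exponents off \<open>lk(z)\<close> upstairs,
  so that vertices outside \<open>st(z)\<close> that are mapped into \<open>lk(\<phi> z)\<close> still act freely.\<close>

definition twist :: "'w \<Rightarrow> ('w \<times> bool) list set \<Rightarrow> ('v \<times> bool) list set \<times> ('w \<Rightarrow> int)
    \<Rightarrow> ('v \<times> bool) list set \<times> ('w \<Rightarrow> int)" where
  "twist z a = (\<lambda>(g, h). (if g \<in> carrier G then ind a \<otimes>\<^bsub>G\<^esub> g else g,
     \<lambda>y. h y + (if y \<in> VL \<and> \<not> EL z y then up.expo y a else 0)))"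

lemma twist_one: "twist z \<one>\<^bsub>L\<^esub> = id"
  by (auto simp: twist_def fun_eq_iff)

lemma twist_mult:
  "a \<in> carrier L \<Longrightarrow> b \<in> carrier L \<Longrightarrow> twist z (a \<otimes>\<^bsub>L\<^esub> b) = twist z a \<circ> twist z b"
  by (auto simp: twist_def fun_eq_iff dn.m_assoc)

text \<open>The Fox derivative with respect to \<open>z\<close>, with left translation replaced by
  the action \<open>twist z\<close>; its base coset is \<open>lkgrp (\<phi> z)\<close> with zero
  exponents.\<close>

definition dfox :: "'w \<Rightarrow> ('w \<times> bool) list set \<Rightarrow> ('v \<times> bool) list set \<times> ('w \<Rightarrow> int) \<Rightarrow> int" where
  "dfox z = (SOME \<delta>. (\<forall>a\<in>carrier L. \<forall>b\<in>carrier L. \<forall>y.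
      \<delta> (a \<otimes>\<^bsub>L\<^esub> b) y = \<delta> a y + \<delta> b (twist z (inv\<^bsub>L\<^esub> a) y)) \<and>
    (\<forall>u\<in>VL. \<forall>y. \<delta> (up.gen u) y = of_bool (u = z \<and> fst y \<in> dn.lkgrp (\<phi> z) \<and> snd y = (\<lambda>_. 0))))"

lemma dfox_spec: "(\<forall>a\<in>carrier L. \<forall>b\<in>carrier L. \<forall>y.
      dfox z (a \<otimes>\<^bsub>L\<^esub> b) y = dfox z a y + dfox z b (twist z (inv\<^bsub>L\<^esub> a) y)) \<and>
    (\<forall>u\<in>VL. \<forall>y. dfox z (up.gen u) y = of_bool (u = z \<and> fst y \<in> dn.lkgrp (\<phi> z) \<and> snd y = (\<lambda>_. 0)))"
proof -
  define B where "B = {y :: ('v \<times> bool) list set \<times> ('w \<Rightarrow> int). fst y \<in> dn.lkgrp (\<phi> z) \<and> snd y = (\<lambda>_. 0)}"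
  \<comment> \<open>A neighbour of \<open>z\<close> acts on the group coordinate through
    \<open>lkgrp (\<phi> z)\<close> and leaves the recorded exponents alone, since only vertices not
    adjacent to \<open>z\<close> are recorded.\<close>
  have B: "twist z (up.gen u) y \<in> B \<longleftrightarrow> y \<in> B" if "EL z u" for u y
  proof -
    obtain g h where y: "y = (g, h)" by (cases y)
    have u: "u \<in> VL" "dn.gen (\<phi> u) \<in> dn.lkgrp (\<phi> z)"
      using up.E_V[OF that] dn.gen_lkgrp[OF \<phi>_E[OF that]] by auto
    have "(\<lambda>y. h y + (if y \<in> VL \<and> \<not> EL z y then up.expo y (up.gen u) else 0)) = h"
      using that u by (auto simp: fun_eq_iff)
    then show ?thesis using u by (auto simp: B_def y twist_def dn.lkgrp_mult_left)
  qed
  obtain \<delta> where \<delta>: "\<And>a b y. a \<in> carrier L \<Longrightarrow> b \<in> carrier L \<Longrightarrow>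
      \<delta> (a \<otimes>\<^bsub>L\<^esub> b) y = (\<delta> a y :: int) + \<delta> b (twist z (inv\<^bsub>L\<^esub> a) y)"
    "\<And>u y. u \<in> VL \<Longrightarrow> \<delta> (up.gen u) y = of_bool (u = z \<and> y \<in> B)"
    by (rule up.crossed_hom_exists[OF twist_one twist_mult B]) blast+
  have "\<exists>\<delta>. (\<forall>a\<in>carrier L. \<forall>b\<in>carrier L. \<forall>y.
      \<delta> (a \<otimes>\<^bsub>L\<^esub> b) y = (\<delta> a y :: int) + \<delta> b (twist z (inv\<^bsub>L\<^esub> a) y)) \<and>
    (\<forall>u\<in>VL. \<forall>y. \<delta> (up.gen u) y = of_bool (u = z \<and> fst y \<in> dn.lkgrp (\<phi> z) \<and> snd y = (\<lambda>_. 0)))"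
    using \<delta> by (intro exI[of _ \<delta>]) (simp add: B_def)
  from someI_ex[OF this] show ?thesis unfolding dfox_def .
qed

lemma dfox_mult:
  "a \<in> carrier L \<Longrightarrow> b \<in> carrier L \<Longrightarrow>
    dfox z (a \<otimes>\<^bsub>L\<^esub> b) y = dfox z a y + dfox z b (twist z (inv\<^bsub>L\<^esub> a) y)"
  using dfox_spec by blast

lemma dfox_gen:
  "u \<in> VL \<Longrightarrow> dfox z (up.gen u) (g, h) = of_bool (u = z \<and> g \<in> dn.lkgrp (\<phi> z) \<and> h = (\<lambda>_. 0))"
  using dfox_spec by simp

lemma dfox_one [simp]: "dfox z \<one>\<^bsub>L\<^esub> y = 0"
  using dfox_mult[of "\<one>\<^bsub>L\<^esub>" "\<one>\<^bsub>L\<^esub>" z y] by (simp add: twist_one)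

lemma dfox_inv: "a \<in> carrier L \<Longrightarrow> dfox z (inv\<^bsub>L\<^esub> a) y = - dfox z a (twist z a y)"
  using dfox_mult[of "inv\<^bsub>L\<^esub> a" a z y] by simp

section \<open>Functions of bounded support\<close>

text \<open>A substitute for finite support. The bound on \<open>h\<close> leaves finitely many
  \<open>h\<close> over each \<open>g\<close> and stops orbits that move \<open>h\<close>; the bound
  on the exponents of \<open>g\<close> survives after \<open>h\<close> is summed out.\<close>

definition bdd :: "'v \<Rightarrow> int \<Rightarrow> (('v \<times> bool) list set \<times> ('w \<Rightarrow> int) \<Rightarrow> int) \<Rightarrow> bool" where
  "bdd x N m \<longleftrightarrow> (\<forall>g\<in>carrier G. \<forall>h. m (g, h) \<noteq> 0 \<longrightarrow>
     (\<forall>y. \<bar>h y\<bar> \<le> N) \<and> (\<forall>y. y \<notin> VL \<longrightarrow> h y = 0) \<and> (\<forall>w. \<not> EG x w \<longrightarrow> \<bar>dn.expo w g\<bar> \<le> N))"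

lemma bddD:
  assumes "bdd x N m" "g \<in> carrier G" "m (g, h) \<noteq> 0"
  shows "\<bar>h y\<bar> \<le> N" "y \<notin> VL \<Longrightarrow> h y = 0" "\<not> EG x w \<Longrightarrow> \<bar>dn.expo w g\<bar> \<le> N"
  using assms unfolding bdd_def by blast+

lemma bdd_mono: "bdd x N m \<Longrightarrow> N \<le> N' \<Longrightarrow> bdd x N' m"
  unfolding bdd_def by (meson order_trans)

lemma bdd_combine:
  assumes "bdd x N m" "bdd x N' m'"
    and "\<And>g h. g \<in> carrier G \<Longrightarrow> k (g, h) \<noteq> 0 \<Longrightarrow> m (g, h) \<noteq> 0 \<or> m' (g, h) \<noteq> 0"
  shows "bdd x (max N N') k"
  using bdd_mono[OF assms(1), of "max N N'"] bdd_mono[OF assms(2), of "max N N'"] assms(3)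
  unfolding bdd_def by (metis max.cobounded1 max.cobounded2)

lemma bdd_twist:
  assumes "bdd x N m" "a \<in> carrier L" and y: "\<And>y. y \<in> VL \<Longrightarrow> \<bar>up.expo y a\<bar> \<le> 1"
    and w: "\<And>w. \<bar>dn.expo w (ind a)\<bar> \<le> 1"
  shows "bdd x (N + 1) (\<lambda>y. m (twist z a y))"
  unfolding bdd_def
proof (intro ballI allI impI)
  fix g h assume g: "g \<in> carrier G" and nz: "m (twist z a (g, h)) \<noteq> 0"
  let ?h = "\<lambda>y. h y + (if y \<in> VL \<and> \<not> EL z y then up.expo y a else 0)"
  have nz': "m (ind a \<otimes>\<^bsub>G\<^esub> g, ?h) \<noteq> 0" and g': "ind a \<otimes>\<^bsub>G\<^esub> g \<in> carrier G"
    using nz g assms(2) by (auto simp: twist_def)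
  have "\<bar>h y\<bar> \<le> N + 1" for y
    using bddD(1)[OF assms(1) g' nz', of y] y[of y] by (auto split: if_splits)
  moreover have "h y = 0" if "y \<notin> VL" for y
    using bddD(2)[OF assms(1) g' nz' that] that by simp
  moreover have "\<bar>dn.expo v g\<bar> \<le> N + 1" if "\<not> EG x v" for v
    using bddD(3)[OF assms(1) g' nz' that] w[of v] g assms(2) by simp
  ultimately show "(\<forall>y. \<bar>h y\<bar> \<le> N + 1) \<and> (\<forall>y. y \<notin> VL \<longrightarrow> h y = 0) \<and>
      (\<forall>w. \<not> EG x w \<longrightarrow> \<bar>dn.expo w g\<bar> \<le> N + 1)" by blast
qed

lemma bdd_dfox_gen:
  assumes "u \<in> VL"
  shows "bdd (\<phi> z) 0 (dfox z (up.gen u))"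
  using dn.expo_lkgrp by (auto simp: bdd_def dfox_gen[OF assms])

lemma expo_letter_le:
  assumes "fst s \<in> VL"
  shows "\<bar>up.expo y (up.letter s)\<bar> \<le> 1" "\<bar>dn.expo w (ind (up.letter s))\<bar> \<le> 1"
    "\<bar>up.expo y (inv\<^bsub>L\<^esub> up.letter s)\<bar> \<le> 1" "\<bar>dn.expo w (ind (inv\<^bsub>L\<^esub> up.letter s))\<bar> \<le> 1"
  using assms by (auto simp: up.letter_def)

lemma bdd_dfox_letter:
  assumes "fst s \<in> VL"
  shows "bdd (\<phi> z) 1 (dfox z (up.letter s))"
proof (cases "snd s")
  case True
  then show ?thesis using bdd_mono[OF bdd_dfox_gen[OF assms], where N' = 1] by (simp add: up.letter_def)
next
  case False
  have "bdd (\<phi> z) (0 + 1) (\<lambda>y. dfox z (up.gen (fst s)) (twist z (up.gen (fst s)) y))"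
    using assms by (intro bdd_twist bdd_dfox_gen) auto
  then show ?thesis using False assms by (simp add: up.letter_def bdd_def dfox_inv)
qed

lemma bdd_dfox:
  assumes "a \<in> carrier L"
  shows "\<exists>N\<ge>0. bdd (\<phi> z) N (dfox z a)"
  using assms
proof (induction rule: up.carrier_induct)
  case one
  then show ?case by (auto simp: bdd_def)
next
  case (mult s a)
  then obtain N where N: "N \<ge> 0" "bdd (\<phi> z) N (dfox z a)" by blast
  have "bdd (\<phi> z) (N + 1) (\<lambda>y. dfox z a (twist z (inv\<^bsub>L\<^esub> up.letter s) y))"
    using mult(1) expo_letter_le[OF mult(1)] by (intro bdd_twist N) auto
  from bdd_combine[OF bdd_dfox_letter[OF mult(1)] this, of "dfox z (up.letter s \<otimes>\<^bsub>L\<^esub> a)"]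
  have "bdd (\<phi> z) (max 1 (N + 1)) (dfox z (up.letter s \<otimes>\<^bsub>L\<^esub> a))"
    using mult by (auto simp: dfox_mult)
  then show ?case using N by (intro exI[of _ "max 1 (N + 1)"]) auto
qed

lemma bdd_finite:
  assumes "bdd x N m" "g \<in> carrier G"
  shows "finite {h. m (g, h) \<noteq> 0}"
proof (rule finite_subset)
  show "{h. m (g, h) \<noteq> 0} \<subseteq> {h. \<forall>y. (y \<in> VL \<longrightarrow> h y \<in> {- N..N}) \<and> (y \<notin> VL \<longrightarrow> h y = 0)}"
    using bddD[OF assms] by (auto simp: abs_le_iff minus_le_iff)
  show "finite {h. \<forall>y. (y \<in> VL \<longrightarrow> h y \<in> {- N..N}) \<and> (y \<notin> VL \<longrightarrow> h y = 0)}"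
    by (rule finite_set_of_finite_funs) (auto simp: up.finite_V)
qed

text \<open>Push-forward along the projection to the base group; \<open>bdd_finite\<close>
  guarantees that the sum is finite for bounded functions.\<close>

definition tot :: "(('v \<times> bool) list set \<times> ('w \<Rightarrow> int) \<Rightarrow> int) \<Rightarrow> ('v \<times> bool) list set \<Rightarrow> int" where
  "tot m g = (\<Sum>h | m (g, h) \<noteq> 0. m (g, h))"

lemma tot_eq:
  assumes "finite S" "{h. m (g, h) \<noteq> 0} \<subseteq> S"
  shows "tot m g = (\<Sum>h\<in>S. m (g, h))"
  unfolding tot_def using assms by (intro sum.mono_neutral_left) auto

lemma tot_add:
  assumes "bdd x N m" "bdd x N' m'" "g \<in> carrier G"
    and k: "\<And>h. k (g, h) = m (g, h) + c * m' (g, h)"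
  shows "tot k g = tot m g + c * tot m' g"
proof -
  let ?S = "{h. m (g, h) \<noteq> 0} \<union> {h. m' (g, h) \<noteq> 0}"
  have S: "finite ?S" using bdd_finite assms by blast
  have "tot k g = (\<Sum>h\<in>?S. k (g, h))" using k by (intro tot_eq[OF S]) auto
  also have "\<dots> = (\<Sum>h\<in>?S. m (g, h)) + c * (\<Sum>h\<in>?S. m' (g, h))"
    by (simp add: k sum.distrib sum_distrib_left)
  also have "\<dots> = tot m g + c * tot m' g"
    using tot_eq[OF S, of m g] tot_eq[OF S, of m' g] by simp
  finally show ?thesis .
qed

lemma tot_twist:
  assumes "g \<in> carrier G"
  shows "tot (\<lambda>y. m (twist z a y)) g = tot m (ind a \<otimes>\<^bsub>G\<^esub> g)"
proof -
  define s where "s = (\<lambda>y. if y \<in> VL \<and> \<not> EL z y then up.expo y a else 0)"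
  have tw: "twist z a (g, h) = (ind a \<otimes>\<^bsub>G\<^esub> g, \<lambda>y. h y + s y)" for h
    using assms by (simp add: twist_def s_def)
  show ?thesis unfolding tot_def tw
    by (rule sum.reindex_bij_witness[where j = "\<lambda>h y. h y + s y" and i = "\<lambda>h y. h y - s y"])
      (auto simp: fun_eq_iff)
qed

text \<open>The part of the derivative downstairs that comes from the single point \<open>z\<close>
  of the fibre.\<close>

definition eta :: "'w \<Rightarrow> ('w \<times> bool) list set \<Rightarrow> ('v \<times> bool) list set \<Rightarrow> int" where
  "eta z a = tot (dfox z a)"

lemma eta_mult:
  assumes "a \<in> carrier L" "b \<in> carrier L" "g \<in> carrier G"
  shows "eta z (a \<otimes>\<^bsub>L\<^esub> b) g = eta z a g + eta z b (inv\<^bsub>G\<^esub> (ind a) \<otimes>\<^bsub>G\<^esub> g)"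
proof -
  have fin: "finite {h. dfox z a (g, h) \<noteq> 0}" if "a \<in> carrier L" "g \<in> carrier G" for a g
    using bdd_dfox[OF that(1), of z] bdd_finite that(2) by blast
  define s where "s = (\<lambda>y. if y \<in> VL \<and> \<not> EL z y then up.expo y (inv\<^bsub>L\<^esub> a) else 0)"
  have tw: "twist z (inv\<^bsub>L\<^esub> a) (g, h) = (inv\<^bsub>G\<^esub> (ind a) \<otimes>\<^bsub>G\<^esub> g, \<lambda>y. h y + s y)" for h
    using assms by (simp add: twist_def s_def)
  let ?S = "{h. dfox z a (g, h) \<noteq> 0} \<union> {h. dfox z b (twist z (inv\<^bsub>L\<^esub> a) (g, h)) \<noteq> 0}"
  have sub: "{h. dfox z b (twist z (inv\<^bsub>L\<^esub> a) (g, h)) \<noteq> 0}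
      \<subseteq> (\<lambda>h y. h y - s y) ` {h. dfox z b (inv\<^bsub>G\<^esub> (ind a) \<otimes>\<^bsub>G\<^esub> g, h) \<noteq> 0}"
  proof
    fix h assume "h \<in> {h. dfox z b (twist z (inv\<^bsub>L\<^esub> a) (g, h)) \<noteq> 0}"
    then show "h \<in> (\<lambda>h y. h y - s y) ` {h. dfox z b (inv\<^bsub>G\<^esub> (ind a) \<otimes>\<^bsub>G\<^esub> g, h) \<noteq> 0}"
      by (intro image_eqI[of _ _ "\<lambda>y. h y + s y"]) (auto simp: tw)
  qed
  have "finite {h. dfox z b (twist z (inv\<^bsub>L\<^esub> a) (g, h)) \<noteq> 0}"
    using assms by (intro finite_subset[OF sub] finite_imageI fin) auto
  then have S: "finite ?S" using fin[OF assms(1,3)] by simp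
  have "eta z (a \<otimes>\<^bsub>L\<^esub> b) g = (\<Sum>h\<in>?S. dfox z (a \<otimes>\<^bsub>L\<^esub> b) (g, h))"
    unfolding eta_def using assms by (intro tot_eq[OF S]) (auto simp: dfox_mult)
  also have "\<dots> = (\<Sum>h\<in>?S. dfox z a (g, h)) + (\<Sum>h\<in>?S. dfox z b (twist z (inv\<^bsub>L\<^esub> a) (g, h)))"
    using assms by (simp add: dfox_mult sum.distrib)
  also have "(\<Sum>h\<in>?S. dfox z a (g, h)) = eta z a g"
    unfolding eta_def by (rule tot_eq[OF S, symmetric]) blast
  also have "(\<Sum>h\<in>?S. dfox z b (twist z (inv\<^bsub>L\<^esub> a) (g, h))) = tot (\<lambda>y. dfox z b (twist z (inv\<^bsub>L\<^esub> a) y)) g"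
    by (rule tot_eq[OF S, symmetric]) blast
  also have "\<dots> = eta z b (inv\<^bsub>G\<^esub> (ind a) \<otimes>\<^bsub>G\<^esub> g)"
    unfolding eta_def using tot_twist[OF assms(3)] assms by simp
  finally show ?thesis .
qed

lemma eta_gen:
  assumes "u \<in> VL"
  shows "eta z (up.gen u) g = of_bool (u = z \<and> g \<in> dn.lkgrp (\<phi> z))"
proof -
  have "eta z (up.gen u) g = (\<Sum>h\<in>{\<lambda>_. 0}. dfox z (up.gen u) (g, h))"
    unfolding eta_def using assms by (intro tot_eq) (auto simp: dfox_gen)
  then show ?thesis using assms by (simp add: dfox_gen)
qed

text \<open>Both sides obey the same product rule over left translation by \<open>ind\<close>, and
  they agree on generators.\<close>

lemma sum_fib_eta:
  assumes "a \<in> carrier L" "g \<in> carrier G"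
  shows "(\<Sum>z\<in>fib x. eta z a g) = dn.fox x (ind a) g"
  using assms
proof (induction arbitrary: g rule: up.carrier_induct)
  case one
  then show ?case using eta_mult[of "\<one>\<^bsub>L\<^esub>" "\<one>\<^bsub>L\<^esub>" g] by simp
next
  case (mult s a)
  have gen: "(\<Sum>z\<in>fib x. eta z (up.gen u) g) = dn.fox x (dn.gen (\<phi> u)) g"
    if "u \<in> VL" "g \<in> carrier G" for u g
  proof -
    have "(\<Sum>z\<in>fib x. eta z (up.gen u) g) = (\<Sum>z\<in>fib x. if z = u then of_bool (g \<in> dn.lkgrp x) else 0)"
      using that by (intro sum.cong) (auto simp: eta_gen fib_def)
    then show ?thesis using that finite_fib by (auto simp: fib_def dn.fox_gen)
  qed
  have "eta z (inv\<^bsub>L\<^esub> up.gen u) g = - eta z (up.gen u) (dn.gen (\<phi> u) \<otimes>\<^bsub>G\<^esub> g)"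
    if "u \<in> VL" "g \<in> carrier G" for z u g
    using eta_mult[of "inv\<^bsub>L\<^esub> up.gen u" "up.gen u" g z] eta_mult[of "\<one>\<^bsub>L\<^esub>" "\<one>\<^bsub>L\<^esub>" g z] that by simp
  then have "(\<Sum>z\<in>fib x. eta z (up.letter s) g) = dn.fox x (ind (up.letter s)) g"
    using gen mult by (auto simp: up.letter_def dn.fox_inv sum_negf)
  then show ?case using mult by (simp add: eta_mult sum.distrib dn.fox_mult)
qed

section \<open>Connectedness in the complement of a star\<close>

definition off :: "'w \<Rightarrow> 'w \<Rightarrow> bool" where
  "off z u \<longleftrightarrow> u \<in> VL \<and> u \<noteq> z \<and> \<not> EL z u"

lemma off_V: "off z u \<Longrightarrow> u \<in> VL" by (simp add: off_def)

text \<open>The reflexive closure makes this an equivalence on all vertices: one inside the star of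
  \<open>z\<close> is related only to itself.\<close>

definition conn :: "'w \<Rightarrow> 'w \<Rightarrow> 'w \<Rightarrow> bool" where
  "conn z = (\<lambda>a b. EL a b \<and> off z a \<and> off z b)\<^sup>*\<^sup>*"

subsection \<open>Lifting partial conjugations\<close>

lemma conn_refl: "conn z u u"
  by (simp add: conn_def)

lemma conn_trans: "conn z u v \<Longrightarrow> conn z v w \<Longrightarrow> conn z u w"
  unfolding conn_def by (rule rtranclp_trans)

lemma conn_edge: "EL u v \<Longrightarrow> off z u \<Longrightarrow> off z v \<Longrightarrow> conn z u v"
  unfolding conn_def by (rule r_into_rtranclp) simp

lemma conn_sym: "conn z u v \<Longrightarrow> conn z v u"
  unfolding conn_def
proof (induction rule: rtranclp_induct)
  case base
  then show ?case by simp
next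
  case (step v w)
  then show ?case using up.E_sym by (blast intro: converse_rtranclp_into_rtranclp)
qed

text \<open>The star of one point of a fibre avoids the star of any other: fibres have no edges, and
  a common neighbour would contradict injectivity on its neighbours.\<close>

lemma off_fib:
  assumes "z \<in> fib x" "j \<in> fib x" "z \<noteq> j"
  shows "off z j" "EL j v \<Longrightarrow> off z v"
proof -
  show "off z j" using assms fib_not_adjacent by (auto simp: off_def fib_def)
  show "off z v" if "EL j v"
  proof -
    have "\<not> EL z v"
      using \<phi>_inj_nbrs[of v j z] that assms up.E_sym by (auto simp: fib_def)
    moreover have "v \<noteq> z" using fib_not_adjacent assms that by blast
    ultimately show ?thesis using up.E_V[OF that] by (auto simp: off_def)
  qed
qed

lemma off_outside: "z \<in> fib x \<Longrightarrow> u \<in> VL \<Longrightarrow> \<phi> u \<notin> star VG EG x \<Longrightarrow> off z u"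
  using \<phi>_E by (auto simp: off_def fib_def dn.star_eq)

text \<open>Follow a path off the star of \<open>z\<close>. Until it meets the star of
  \<open>j\<close> it is also a path off that star; once it meets it, it can be led to
  \<open>j\<close>, as the star of \<open>j\<close> avoids that of \<open>z\<close>.\<close>

lemma conn_split:
  assumes z: "z \<in> fib x" "j \<in> fib x" "z \<noteq> j" and u: "off j u"
    and "conn z u u'" "\<not> conn j u u'"
  shows "conn z u j"
proof -
  have "conn z u u' \<and> (conn j u u' \<and> off j u' \<or> conn z u j)"
    using assms(5) unfolding conn_def[of z]
  proof (induction rule: rtranclp_induct)
    case base
    then show ?case using u conn_refl by (auto simp: conn_def)
  next
    case (step v w)
    have vw: "EL v w" "off z v" "off z w" using step by auto
    have zv: "conn z u v" using step.hyps(1) by (simp add: conn_def)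
    have zw: "conn z u w" using conn_trans[OF zv conn_edge[OF vw]] .
    show ?case
    proof (cases "conn z u j")
      case True
      then show ?thesis using zw by (simp add: conn_def)
    next
      case False
      then have jv: "conn j u v" "off j v" using step.IH by (auto simp: conn_def)
      have "off j w"
      proof (rule ccontr)
        assume "\<not> off j w"
        then have "w = j \<or> EL w j" using up.E_V[OF vw(1)] up.E_sym by (auto simp: off_def)
        then have "conn z w j" using conn_refl conn_edge[of w j z] off_fib(1)[OF z] vw by blast
        then show False using False conn_trans zw by blast
      qed
      then show ?thesis using conn_trans[OF jv(1) conn_edge[OF vw(1) jv(2)]] zw
        by (simp add: conn_def)
    qed
  qed
  then show ?thesis using assms(6) by blast
qed

text \<open>The stars of the fibre separate the complement in a tree-like fashion: if \<open>st(j)\<close> separates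
  two vertices that no other star separates, then both lie on the side of \<open>j\<close> of every other
  star. Hence only one class for the remaining stars is cut by \<open>st(j)\<close>.\<close>

lemma saturated_decomposition:
  fixes h :: "'w \<Rightarrow> int"
  assumes "finite I" "I \<subseteq> fib x"
    and "\<And>u u'. u \<in> VL \<Longrightarrow> \<phi> u \<notin> star VG EG x \<Longrightarrow> u' \<in> VL \<Longrightarrow> \<phi> u' \<notin> star VG EG x \<Longrightarrow>
      (\<And>z. z \<in> I \<Longrightarrow> conn z u u') \<Longrightarrow> h u = h u'"
  shows "\<exists>b k. (\<forall>z\<in>I. \<forall>u u'. conn z u u' \<longrightarrow> b z u = b z u') \<and>
    (\<forall>u\<in>VL. \<phi> u \<notin> star VG EG x \<longrightarrow> h u = k + (\<Sum>z\<in>I. b z u))"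
  using assms
proof (induction I arbitrary: h rule: finite_induct)
  case empty
  show ?case
  proof (cases "\<exists>u0\<in>VL. \<phi> u0 \<notin> star VG EG x")
    case True
    then obtain u0 where "u0 \<in> VL" "\<phi> u0 \<notin> star VG EG x" by blast
    then have "\<forall>u\<in>VL. \<phi> u \<notin> star VG EG x \<longrightarrow> h u = h u0" using empty.prems(2) by blast
    then show ?thesis by auto
  qed auto
next
  case (insert j I)
  define R where "R = {u \<in> VL. \<phi> u \<notin> star VG EG x}"
  have j: "j \<in> fib x" and I: "I \<subseteq> fib x" using insert.prems by auto
  have sat: "h u = h u'" if "u \<in> R" "u' \<in> R" "\<And>z. z \<in> insert j I \<Longrightarrow> conn z u u'" for u u'
    using insert.prems(2) that unfolding R_def by blast
  \<comment> \<open>\<open>a\<close> is to be the summand of \<open>j\<close>. On a component off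
    \<open>st(j)\<close> it takes the value of \<open>h\<close> at a vertex that the remaining stars
    do not separate from \<open>j\<close>; \<open>sat\<close> makes the choice irrelevant, and
    without such a vertex zero will do.\<close>
  define Q where "Q y q \<longleftrightarrow> q \<in> R \<and> (\<forall>z\<in>I. conn z q j) \<and> conn j q y" for y q
  define a where "a y = (if \<exists>q. Q y q then h (SOME q. Q y q) else 0)" for y
  have a_conn: "a y = a y'" if "conn j y y'" for y y'
  proof -
    have "Q y = Q y'" using that conn_trans conn_sym unfolding Q_def by blast
    then show ?thesis by (simp add: a_def)
  qed
  have a_eq: "a u = h u" if "u \<in> R" "\<And>z. z \<in> I \<Longrightarrow> conn z u j" for u
  proof -
    have "Q u u" using that conn_refl by (simp add: Q_def)
    then have q: "Q u (SOME q. Q u q)" by (rule someI)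
    have "h (SOME q. Q u q) = h u"
    proof (rule sat)
      fix z assume "z \<in> insert j I"
      then show "conn z (SOME q. Q u q) u"
        using q that(2) conn_trans conn_sym unfolding Q_def by blast
    qed (use q that in \<open>auto simp: Q_def\<close>)
    then show ?thesis using \<open>Q u u\<close> by (auto simp: a_def)
  qed
  have "h u - a u = h u' - a u'"
    if u: "u \<in> R" "u' \<in> R" "\<And>z. z \<in> I \<Longrightarrow> conn z u u'" for u u'
  proof (cases "conn j u u'")
    case True
    then have "h u = h u'" using sat u by blast
    then show ?thesis using a_conn[OF True] by simp
  next
    case False
    \<comment> \<open>Only \<open>st(j)\<close> separates the two vertices, so both are on the side
      of \<open>j\<close> for every remaining star; there \<open>a\<close> equals \<open>h\<close>
      and both differences are zero.\<close>
    have "off j u" "off j u'" using off_outside j u by (auto simp: R_def)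
    then have "conn z u j" "conn z u' j" if "z \<in> I" for z
      using conn_split[of z x j u u'] conn_split[of z x j u' u] that j I u(3)[OF that] False
        conn_sym insert.hyps by blast+
    then show ?thesis using a_eq u by simp
  qed
  then obtain b k where b: "\<forall>z\<in>I. \<forall>u u'. conn z u u' \<longrightarrow> b z u = b z u'"
    "\<forall>u\<in>VL. \<phi> u \<notin> star VG EG x \<longrightarrow> h u - a u = k + (\<Sum>z\<in>I. b z u)"
    using insert.IH[OF I, of "\<lambda>u. h u - a u"] unfolding R_def by blast
  define b' where "b' = b(j := a)"
  have "(\<Sum>z\<in>insert j I. b' z u) = a u + (\<Sum>z\<in>I. b z u)" for u
    using insert.hyps by (auto simp: b'_def intro!: sum.cong)
  then have "\<forall>u\<in>VL. \<phi> u \<notin> star VG EG x \<longrightarrow> h u = k + (\<Sum>z\<in>insert j I. b' z u)"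
    using b(2) by (auto simp: algebra_simps)
  moreover have "\<forall>z\<in>insert j I. \<forall>u u'. conn z u u' \<longrightarrow> b' z u = b' z u'"
    using b(1) a_conn by (auto simp: b'_def)
  ultimately show ?case by blast
qed

text \<open>Compose the graded conjugations by the points of \<open>I\<close>. All these points lie
  over \<open>x\<close>, so downstairs every factor conjugates by powers of \<open>gen x\<close> and
  the exponents add up.\<close>

lemma product_lift:
  fixes b :: "'w \<Rightarrow> 'w \<Rightarrow> int"
  assumes "finite I" "I \<subseteq> fib x" and b: "\<And>z u u'. z \<in> I \<Longrightarrow> conn z u u' \<Longrightarrow> b z u = b z u'"
  shows "\<exists>F\<in>auto L. \<forall>u\<in>VL. ind (F (up.gen u)) =
    dn.gen x [^]\<^bsub>G\<^esub> (\<Sum>z\<in>I. b z u) \<otimes>\<^bsub>G\<^esub> dn.gen (\<phi> u) \<otimes>\<^bsub>G\<^esub> dn.gen x [^]\<^bsub>G\<^esub> (- (\<Sum>z\<in>I. b z u))"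
  using assms
proof (induction I rule: finite_induct)
  case empty
  show ?case
    by (intro bexI[of _ "\<lambda>a\<in>carrier L. a"] up.id_in_auto) (simp add: int_pow_0)
next
  case (insert j I)
  have j: "j \<in> VL" "\<phi> j = x" using insert.prems by (auto simp: fib_def)
  have x: "x \<in> VG" using j by auto
  let ?c = "\<lambda>n w. dn.gen x [^]\<^bsub>G\<^esub> (n :: int) \<otimes>\<^bsub>G\<^esub> w \<otimes>\<^bsub>G\<^esub> dn.gen x [^]\<^bsub>G\<^esub> (- n)"
  obtain F where F: "F \<in> auto L" "\<And>u. u \<in> VL \<Longrightarrow> ind (F (up.gen u)) = ?c (\<Sum>z\<in>I. b z u) (dn.gen (\<phi> u))"
    using insert by auto
  have "b j u = b j u'" if "EL u u'" "u \<notin> star VL EL j" "u' \<notin> star VL EL j" for u u'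
    using insert.prems(2)[of j u u'] conn_edge[OF that(1)] that up.E_V[OF that(1)]
    by (auto simp: up.star_eq off_def)
  then obtain P where P: "P \<in> auto L" "\<And>u. u \<in> VL \<Longrightarrow>
      P (up.gen u) = up.gen j [^]\<^bsub>L\<^esub> b j u \<otimes>\<^bsub>L\<^esub> up.gen u \<otimes>\<^bsub>L\<^esub> up.gen j [^]\<^bsub>L\<^esub> (- b j u)"
    using up.graded_conj_exists[OF j(1), of "b j"] by metis
  interpret F: group_hom L L F using up.auto_hom[OF F(1)] by (simp add: group_hom_def group_hom_axioms_def up.is_group)
  have Fj: "ind (F (up.gen j)) = dn.gen x"
    using F(2)[OF j(1)] j dn.gen_star_commute[OF x, of x] by simp
  have "ind (F (P (up.gen u))) = ?c (\<Sum>z\<in>insert j I. b z u) (dn.gen (\<phi> u))" if u: "u \<in> VL" for u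
  proof -
    let ?s = "\<Sum>z\<in>I. b z u"
    have "ind (F (P (up.gen u))) = ?c (b j u) (?c ?s (dn.gen (\<phi> u)))"
      using P(2)[OF u] F(2)[OF u] Fj u j by (simp add: F.hom_int_pow ind.hom_int_pow)
    also have "\<dots> = dn.gen x [^]\<^bsub>G\<^esub> (b j u + ?s) \<otimes>\<^bsub>G\<^esub> dn.gen (\<phi> u) \<otimes>\<^bsub>G\<^esub> dn.gen x [^]\<^bsub>G\<^esub> (- ?s + - b j u)"
      unfolding dn.int_pow_mult[OF dn.gen_closed[OF x]] using u x by (simp add: dn.m_assoc)
    also have "- ?s + - b j u = - (b j u + ?s)" by simp
    finally show ?thesis using insert.hyps by simp
  qed
  then show ?case using up.auto_compose_auto[OF F(1) P(1)]
    by (intro bexI[of _ "compose (carrier L) F P"]) (auto simp: compose_eq)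
qed

section \<open>Saturated sets\<close>

text \<open>The preimage of \<open>C\<close> is a union of classes of vertices that no star of the
  fibre over \<open>x\<close> separates. One implication suffices, \<open>conn\<close> being
  symmetric.\<close>

definition saturated :: "'v \<Rightarrow> 'v set \<Rightarrow> bool" where
  "saturated x C \<longleftrightarrow> C \<subseteq> VG - star VG EG x \<and>
     (\<forall>u\<in>VL. \<forall>u'\<in>VL. \<phi> u \<notin> star VG EG x \<longrightarrow> \<phi> u' \<notin> star VG EG x \<longrightarrow>
       (\<forall>z\<in>fib x. conn z u u') \<longrightarrow> \<phi> u \<in> C \<longrightarrow> \<phi> u' \<in> C)"

text \<open>An edge off the star of \<open>x\<close> lifts to an edge that is off the star of every
  point over \<open>x\<close>.\<close>

lemma saturated_components:
  assumes "saturated x C"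
  shows "union_of_components_compl_star VG EG x C"
proof -
  have "y \<in> C" if y: "y \<in> VG - star VG EG x" and w: "w \<in> C" "EG w y" for w y
  proof -
    have w': "w \<in> VG" "w \<notin> star VG EG x" using assms w by (auto simp: saturated_def)
    obtain u where u: "u \<in> VL" "\<phi> u = w" using \<phi>_image w' by blast
    obtain u' where u': "EL u u'" "\<phi> u' = y" using \<phi>_lift_edge u w by blast
    have uV: "u' \<in> VL" using up.E_V[OF u'(1)] by simp
    have "conn z u u'" if "z \<in> fib x" for z
      using conn_edge[OF u'(1)] off_outside[OF that] u uV w' y u' by auto
    then show ?thesis using assms u u' uV w w' y unfolding saturated_def by blast
  qed
  then show ?thesis using assms by (auto simp: union_of_components_compl_star_def saturated_def)
qed

text \<open>Decompose the indicator of the preimage of \<open>C\<close> into one function per point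
  of the fibre and lift by \<open>product_lift\<close>. Over the star of \<open>x\<close> exponents
  are irrelevant, as conjugation by powers of \<open>gen x\<close> is trivial there.\<close>

lemma saturated_liftable:
  assumes x: "x \<in> VG" and C: "saturated x C" and P: "P \<in> auto G"
    and P_gen: "\<And>w. w \<in> VG \<Longrightarrow> P (dn.gen w) =
      dn.gen x [^]\<^bsub>G\<^esub> (of_bool (w \<in> C) :: int) \<otimes>\<^bsub>G\<^esub> dn.gen w \<otimes>\<^bsub>G\<^esub> dn.gen x [^]\<^bsub>G\<^esub> (- of_bool (w \<in> C) :: int)"
  shows "liftable VL EL VG EG \<phi> P"
proof -
  have sat: "of_bool (\<phi> u \<in> C) = (of_bool (\<phi> u' \<in> C) :: int)"
    if "u \<in> VL" "\<phi> u \<notin> star VG EG x" "u' \<in> VL" "\<phi> u' \<notin> star VG EG x"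
      "\<And>z. z \<in> fib x \<Longrightarrow> conn z u u'" for u u'
  proof -
    have "\<phi> u \<in> C \<longleftrightarrow> \<phi> u' \<in> C"
      using C that conn_sym unfolding saturated_def by blast
    then show ?thesis by simp
  qed
  have "\<exists>b k. (\<forall>z\<in>fib x. \<forall>u u'. conn z u u' \<longrightarrow> b z u = b z u') \<and>
      (\<forall>u\<in>VL. \<phi> u \<notin> star VG EG x \<longrightarrow> of_bool (\<phi> u \<in> C) = (k :: int) + (\<Sum>z\<in>fib x. b z u))"
    by (rule saturated_decomposition[OF finite_fib subset_refl, where h = "\<lambda>u. of_bool (\<phi> u \<in> C)"])
      (rule sat)
  then obtain b0 :: "'w \<Rightarrow> 'w \<Rightarrow> int" and k where b0: "\<forall>z\<in>fib x. \<forall>u u'. conn z u u' \<longrightarrow> b0 z u = b0 z u'"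
    "\<forall>u\<in>VL. \<phi> u \<notin> star VG EG x \<longrightarrow> of_bool (\<phi> u \<in> C) = k + (\<Sum>z\<in>fib x. b0 z u)"
    by (elim exE conjE)
  obtain z0 where z0: "z0 \<in> fib x" using \<phi>_image x by (auto simp: fib_def)
  \<comment> \<open>The constant is absorbed into the summand of one arbitrary point
    \<open>z0\<close> of the fibre.\<close>
  define b where "b z u = b0 z u + (if z = z0 then k else 0)" for z u
  have b_conn: "b z u = b z u'" if "z \<in> fib x" "conn z u u'" for z u u'
    using b0(1) that by (auto simp: b_def)
  have b_sum: "(\<Sum>z\<in>fib x. b z u) = of_bool (\<phi> u \<in> C)" if "u \<in> VL" "\<phi> u \<notin> star VG EG x" for u
    using b0(2) that z0 finite_fib by (simp add: b_def sum.distrib)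
  obtain F where F: "F \<in> auto L" "\<And>u. u \<in> VL \<Longrightarrow> ind (F (up.gen u)) =
    dn.gen x [^]\<^bsub>G\<^esub> (\<Sum>z\<in>fib x. b z u) \<otimes>\<^bsub>G\<^esub> dn.gen (\<phi> u) \<otimes>\<^bsub>G\<^esub> dn.gen x [^]\<^bsub>G\<^esub> (- (\<Sum>z\<in>fib x. b z u))"
    using product_lift[OF finite_fib subset_refl, of x b, OF b_conn] by blast
  have "P (ind a) = ind (F a)" if "a \<in> carrier L" for a
  proof (rule up.hom_eqI[OF dn.is_group _ _ _ that])
    show "(\<lambda>a. P (ind a)) \<in> hom L G"
      using Group.hom_compose[OF ind_hom dn.auto_hom[OF P]] by (simp add: comp_def)
    show "(\<lambda>a. ind (F a)) \<in> hom L G"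
      using Group.hom_compose[OF up.auto_hom[OF F(1)] ind_hom] by (simp add: comp_def)
    fix u assume u: "u \<in> VL"
    show "P (ind (up.gen u)) = ind (F (up.gen u))"
    proof (cases "\<phi> u \<in> star VG EG x")
      case True
      then have "\<phi> u = x \<or> EG x (\<phi> u)" by (auto simp: dn.star_eq)
      from dn.gen_star_commute[OF x this] show ?thesis
        using P_gen[of "\<phi> u"] F(2)[OF u] u by simp
    next
      case False
      then show ?thesis using P_gen[of "\<phi> u"] F(2)[OF u] u b_sum[OF u] by simp
    qed
  qed
  then show ?thesis using F(1) unfolding liftable_def up.G_def by blast
qed

section \<open>Closure properties of liftability\<close>

lemma liftable_id: "liftable VL EL VG EG \<phi> (\<lambda>a\<in>carrier G. a)"
  unfolding liftable_def up.G_def[symmetric]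
  by (intro bexI[of _ "\<lambda>a\<in>carrier L. a"] up.id_in_auto) simp

lemma liftable_compose:
  assumes "liftable VL EL VG EG \<phi> f" "liftable VL EL VG EG \<phi> h"
  shows "liftable VL EL VG EG \<phi> (compose (carrier G) f h)"
proof -
  obtain F H where F: "F \<in> auto L" "\<And>a. a \<in> carrier L \<Longrightarrow> f (ind a) = ind (F a)"
    and H: "H \<in> auto L" "\<And>a. a \<in> carrier L \<Longrightarrow> h (ind a) = ind (H a)"
    using assms unfolding liftable_def up.G_def[symmetric] by metis
  have "compose (carrier G) f h (ind a) = ind (compose (carrier L) F H a)" if "a \<in> carrier L" for a
    using that F(2)[of "H a"] H(2)[OF that] up.auto_closed[OF H(1) that] by (simp add: compose_eq)
  then show ?thesis
    using up.auto_compose_auto[OF F(1) H(1)] unfolding liftable_def up.G_def[symmetric] by blast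
qed

lemma liftable_inv:
  assumes f: "f \<in> auto G" and "liftable VL EL VG EG \<phi> f"
  shows "liftable VL EL VG EG \<phi> (inv\<^bsub>AutoGroup G\<^esub> f)"
proof -
  obtain F where F: "F \<in> auto L" "\<And>a. a \<in> carrier L \<Longrightarrow> f (ind a) = ind (F a)"
    using assms(2) unfolding liftable_def up.G_def[symmetric] by metis
  let ?F = "inv\<^bsub>AutoGroup L\<^esub> F"
  have "(inv\<^bsub>AutoGroup G\<^esub> f) (ind a) = ind (?F a)" if a: "a \<in> carrier L" for a
  proof -
    have c: "?F a \<in> carrier L" using up.auto_closed[OF up.auto_inv_auto[OF F(1)] a] .
    have "f (ind (?F a)) = ind a" using F(2)[OF c] up.auto_inv(1)[OF F(1) a] by simp
    then show ?thesis using dn.auto_inv(2)[OF f, of "ind (?F a)"] c by simp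
  qed
  then show ?thesis
    using up.auto_inv_auto[OF F(1)] unfolding liftable_def up.G_def[symmetric] by blast
qed

end

section \<open>Lifts of conjugating automorphisms\<close>

locale conj_lift = raag_cover VL EL L VG EG G \<phi>
  for VL :: "'w set" and EL :: "'w \<Rightarrow> 'w \<Rightarrow> bool" and L
    and VG :: "'v set" and EG :: "'v \<Rightarrow> 'v \<Rightarrow> bool" and G and \<phi> +
  fixes f :: "('v \<times> bool) list set \<Rightarrow> ('v \<times> bool) list set"
    and g :: "'v \<Rightarrow> ('v \<times> bool) list set"
    and F :: "('w \<times> bool) list set \<Rightarrow> ('w \<times> bool) list set"
  assumes f_hom: "f \<in> hom G G" and g_closed: "v \<in> VG \<Longrightarrow> g v \<in> carrier G"
    and f_gen: "v \<in> VG \<Longrightarrow> f (dn.gen v) = g v \<otimes>\<^bsub>G\<^esub> dn.gen v \<otimes>\<^bsub>G\<^esub> inv\<^bsub>G\<^esub> (g v)"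
    and F_hom: "F \<in> hom L L" and F_lift: "a \<in> carrier L \<Longrightarrow> ind (F a) = f (ind a)"
    and F_expo: "y \<in> VL \<Longrightarrow> a \<in> carrier L \<Longrightarrow> up.expo y (F a) = up.expo y a"
begin

section \<open>Orbits under images of generators\<close>

abbreviation Fg :: "'w \<Rightarrow> ('w \<times> bool) list set" where "Fg u \<equiv> F (up.gen u)"

text \<open>The translation by which the inverse of \<open>Fg u\<close> acts on the group coordinate
  in \<open>twist_Fg\<close>.\<close>

definition p :: "'w \<Rightarrow> ('v \<times> bool) list set" where
  "p u = inv\<^bsub>G\<^esub> (f (dn.gen (\<phi> u)))"

lemma f_expo: "a \<in> carrier G \<Longrightarrow> dn.expo w (f a) = dn.expo w a"
  using dn.conj_expo[OF f_hom g_closed f_gen] by simp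

lemma Fg_closed: "u \<in> VL \<Longrightarrow> Fg u \<in> carrier L"
  using hom_in_carrier[OF F_hom] by simp

lemma ind_Fg: "u \<in> VL \<Longrightarrow> ind (Fg u) = f (dn.gen (\<phi> u))"
  using F_lift[of "up.gen u"] by simp

lemma f_gen_closed: "v \<in> VG \<Longrightarrow> f (dn.gen v) \<in> carrier G"
  using hom_in_carrier[OF f_hom] by simp

lemma p_closed: "u \<in> VL \<Longrightarrow> p u \<in> carrier G"
  by (simp add: p_def f_gen_closed)

lemma p_expo: "u \<in> VL \<Longrightarrow> dn.expo w (p u) = - of_bool (\<phi> u = w)"
  by (simp add: p_def f_gen_closed f_expo)

definition dec :: "'w \<Rightarrow> int \<Rightarrow> ('w \<Rightarrow> int) \<Rightarrow> 'w \<Rightarrow> int" where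
  "dec u n h = (\<lambda>y. h y - (if y = u then n else 0))"

lemma dec_simps [simp]:
  "dec u n h u = h u - n" "y \<noteq> u \<Longrightarrow> dec u n h y = h y"
  "dec u 0 h = h" "dec u m (dec u n h) = dec u (n + m) h"
  by (auto simp: dec_def fun_eq_iff)

lemma dec_commute: "dec u m (dec v n h) = dec v n (dec u m h)"
  by (auto simp: dec_def fun_eq_iff)

lemma twist_Fg:
  assumes "off z u" "k \<in> carrier G"
  shows "twist z (inv\<^bsub>L\<^esub> (Fg u)) (k, h) = (p u \<otimes>\<^bsub>G\<^esub> k, dec u 1 h)"
  using assms by (auto simp: twist_def off_def p_def dec_def ind_Fg Fg_closed F_expo fun_eq_iff)

lemma dfox_pow_Suc:
  assumes "off z u" "k \<in> carrier G"
  shows "dfox z (Fg u [^]\<^bsub>L\<^esub> Suc n) (k, h) =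
    dfox z (Fg u) (k, h) + dfox z (Fg u [^]\<^bsub>L\<^esub> n) (p u \<otimes>\<^bsub>G\<^esub> k, dec u 1 h)"
  using assms Fg_closed[OF off_V[OF assms(1)]] up.nat_pow_Suc2[of "Fg u" n]
  by (simp add: dfox_mult twist_Fg del: up.nat_pow_Suc)

lemma dfox_pow_support:
  assumes "off z u" "k \<in> carrier G" "dfox z (Fg u [^]\<^bsub>L\<^esub> (n :: nat)) (k, h) \<noteq> 0"
  shows "\<exists>j<n. dfox z (Fg u) (p u [^]\<^bsub>G\<^esub> j \<otimes>\<^bsub>G\<^esub> k, dec u (int j) h) \<noteq> 0"
  using assms(2,3)
proof (induction n arbitrary: k h)
  case 0
  then show ?case by simp
next
  case (Suc n)
  have pu: "p u \<in> carrier G" using p_closed off_V assms(1) by blast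
  show ?case
  proof (cases "dfox z (Fg u) (k, h) = 0")
    case True
    then have "dfox z (Fg u [^]\<^bsub>L\<^esub> n) (p u \<otimes>\<^bsub>G\<^esub> k, dec u 1 h) \<noteq> 0"
      using Suc.prems dfox_pow_Suc[OF assms(1)] by simp
    then obtain j where j: "j < n" "dfox z (Fg u) (p u [^]\<^bsub>G\<^esub> j \<otimes>\<^bsub>G\<^esub> (p u \<otimes>\<^bsub>G\<^esub> k), dec u (1 + int j) h) \<noteq> 0"
      using Suc.IH[of "p u \<otimes>\<^bsub>G\<^esub> k" "dec u 1 h"] Suc.prems pu by auto
    then show ?thesis using pu Suc.prems
      by (intro exI[of _ "Suc j"]) (auto simp: dn.m_assoc algebra_simps)
  next
    case False
    then show ?thesis using Suc.prems by (intro exI[of _ 0]) simp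
  qed
qed

text \<open>The sum of \<open>dfox z (Fg u)\<close> over the forward orbit under \<open>twist z (inv (Fg u))\<close>: after
  \<open>N + h u + 1\<close> steps the coordinate \<open>u\<close> has dropped below \<open>- N\<close> and all further terms vanish.\<close>

definition csol :: "'w \<Rightarrow> 'w \<Rightarrow> int \<Rightarrow> ('v \<times> bool) list set \<times> ('w \<Rightarrow> int) \<Rightarrow> int" where
  "csol z u N = (\<lambda>(k, h). dfox z (Fg u [^]\<^bsub>L\<^esub> nat (N + h u + 1)) (k, h))"

lemma csol_eq:
  assumes "off z u" "bdd (\<phi> z) N (dfox z (Fg u))" "k \<in> carrier G"
  shows "dfox z (Fg u) (k, h) = csol z u N (k, h) - csol z u N (p u \<otimes>\<^bsub>G\<^esub> k, dec u 1 h)"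
\<comment> \<open>For \<open>h u \<ge> - N\<close> one step along the orbit lowers the power by one
  and the difference is its first term. Below that, \<open>nat\<close> truncates both powers to
  zero, and the derivative vanishes too.\<close>
proof (cases "h u \<ge> - N")
  case True
  then have n: "nat (N + h u + 1) = Suc (nat (N + h u))" by simp
  show ?thesis using dfox_pow_Suc[OF assms(1,3), of "nat (N + h u)" h]
    unfolding csol_def by (simp add: n del: up.nat_pow_Suc)
next
  case False
  then have "dfox z (Fg u) (k, h) = 0"
    using bddD(1)[OF assms(2,3), of h u] by force
  then show ?thesis using False by (simp add: csol_def)
qed

text \<open>A nonzero value stems from a nonzero term \<open>j\<close> steps along the orbit; the
  steps change only the coordinate \<open>u\<close> of \<open>h\<close> and the exponent at
  \<open>\<phi> u\<close>.\<close>

lemma csol_support: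
  assumes u: "off z u" and N: "bdd (\<phi> z) N (dfox z (Fg u))" and k: "k \<in> carrier G"
    and nz: "csol z u N (k, h) \<noteq> 0"
  obtains j :: nat where "int j \<le> N + h u" "\<bar>h u - int j\<bar> \<le> N" "\<And>y. y \<noteq> u \<Longrightarrow> \<bar>h y\<bar> \<le> N"
    "\<And>y. y \<notin> VL \<Longrightarrow> h y = 0" "\<And>w. \<not> EG (\<phi> z) w \<Longrightarrow> \<bar>dn.expo w k - int j * of_bool (\<phi> u = w)\<bar> \<le> N"
proof -
  have uV: "u \<in> VL" and pu: "p u \<in> carrier G" using p_closed off_V u by auto
  obtain j where j: "j < nat (N + h u + 1)"
    and nz: "dfox z (Fg u) (p u [^]\<^bsub>G\<^esub> j \<otimes>\<^bsub>G\<^esub> k, dec u (int j) h) \<noteq> 0"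
    using dfox_pow_support[OF u k] nz by (auto simp: csol_def)
  have c: "p u [^]\<^bsub>G\<^esub> j \<otimes>\<^bsub>G\<^esub> k \<in> carrier G" using pu k by simp
  note b = bddD[OF N c nz]
  show ?thesis
  proof (rule that[of j])
    show "int j \<le> N + h u" using j by linarith
    show "\<bar>h u - int j\<bar> \<le> N" using b(1)[of u] by simp
    show "\<bar>h y\<bar> \<le> N" if "y \<noteq> u" for y using b(1)[of y] that by simp
    show "h y = 0" if "y \<notin> VL" for y using b(2)[OF that] that uV by (cases "y = u") auto
    show "\<bar>dn.expo w k - int j * of_bool (\<phi> u = w)\<bar> \<le> N" if "\<not> EG (\<phi> z) w" for w
      using b(3)[OF that] pu k p_expo[OF uV] by (simp add: algebra_simps)
  qed
qed

lemma Fg_commute: "EL u u' \<Longrightarrow> Fg u \<otimes>\<^bsub>L\<^esub> Fg u' = Fg u' \<otimes>\<^bsub>L\<^esub> Fg u"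
  using up.gen_commute[of u u'] hom_mult[OF F_hom] up.E_V[of u u'] by (metis up.gen_closed)

text \<open>This is where the neighbour \<open>u'\<close> is needed: along the orbits of \<open>Fg u'\<close> the total sums of
  \<open>dfox z (Fg u)\<close> over the orbits of \<open>Fg u\<close> are constant, hence zero.\<close>

lemma csol_eq_0:
  assumes u: "off z u" "off z u'" and E: "EL u u'"
    and N: "bdd (\<phi> z) N (dfox z (Fg u))" "bdd (\<phi> z) N (dfox z (Fg u'))"
    and k: "k \<in> carrier G" and h: "N < h u"
  shows "csol z u N (k, h) = 0"
proof (rule ccontr)
  assume nz: "csol z u N (k, h) \<noteq> 0"
  have uV: "u \<in> VL" "u' \<in> VL" "u \<noteq> u'" using off_V u E up.E_irrefl by auto
  have pu: "p u \<in> carrier G" "p u' \<in> carrier G" using p_closed uV by auto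
  have Fc: "Fg u \<in> carrier L" "Fg u' \<in> carrier L" using Fg_closed uV by auto
  have N0: "N \<ge> 0"
    using csol_support[OF u(1) N(1) k nz] by (metis abs_ge_zero order_trans)
  have twist_pow: "twist z (inv\<^bsub>L\<^esub> (Fg u [^]\<^bsub>L\<^esub> n)) (k, h) = (p u [^]\<^bsub>G\<^esub> n \<otimes>\<^bsub>G\<^esub> k, dec u (int n) h)"
    if "k \<in> carrier G" for n k h
    using that
  proof (induction n arbitrary: k h)
    case 0
    then show ?case by (simp add: twist_one)
  next
    case (Suc n)
    have "inv\<^bsub>L\<^esub> (Fg u [^]\<^bsub>L\<^esub> Suc n) = inv\<^bsub>L\<^esub> (Fg u [^]\<^bsub>L\<^esub> n) \<otimes>\<^bsub>L\<^esub> inv\<^bsub>L\<^esub> (Fg u)"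
      using Fc up.nat_pow_Suc2[of "Fg u" n] by (simp add: up.inv_mult_group del: up.nat_pow_Suc)
    then have "twist z (inv\<^bsub>L\<^esub> (Fg u [^]\<^bsub>L\<^esub> Suc n)) (k, h) =
        twist z (inv\<^bsub>L\<^esub> (Fg u [^]\<^bsub>L\<^esub> n)) (p u \<otimes>\<^bsub>G\<^esub> k, dec u 1 h)"
      using Fc Suc.prems by (simp add: twist_mult twist_Fg[OF u(1)] del: up.nat_pow_Suc)
    also have "\<dots> = (p u [^]\<^bsub>G\<^esub> n \<otimes>\<^bsub>G\<^esub> (p u \<otimes>\<^bsub>G\<^esub> k), dec u (1 + int n) h)"
      using Suc.IH[of "p u \<otimes>\<^bsub>G\<^esub> k"] Suc.prems pu by simp
    finally show ?case using Suc.prems pu by (simp add: dn.m_assoc algebra_simps)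
  qed
  have step: "csol z u N (k, h) = csol z u N (p u' \<otimes>\<^bsub>G\<^esub> k, dec u' 1 h)"
    if k: "k \<in> carrier G" and h: "N < h u" for k h
  proof -
    \<comment> \<open>After \<open>n\<close> steps the coordinate \<open>u\<close> is
      \<open>- N - 1\<close>, while at the start it exceeds \<open>N\<close>. So the derivative of
      \<open>Fg u'\<close> vanishes at both ends, and differentiating \<open>comm\<close> leaves
      equality of the two sums.\<close>
    define n where "n = nat (N + h u + 1)"
    have comm: "Fg u [^]\<^bsub>L\<^esub> n \<otimes>\<^bsub>L\<^esub> Fg u' = Fg u' \<otimes>\<^bsub>L\<^esub> Fg u [^]\<^bsub>L\<^esub> n"
      using up.group_commutes_pow[OF Fg_commute[OF E] Fc] .
    have z1: "dfox z (Fg u') (k, h) = 0"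
      using bddD(1)[OF N(2) k, of h u] h by force
    have nn: "h u - int n = - N - 1" using h N0 by (simp add: n_def)
    have kn: "p u [^]\<^bsub>G\<^esub> n \<otimes>\<^bsub>G\<^esub> k \<in> carrier G" using k pu by simp
    have z2: "dfox z (Fg u') (twist z (inv\<^bsub>L\<^esub> (Fg u [^]\<^bsub>L\<^esub> n)) (k, h)) = 0"
      using bddD(1)[OF N(2) kn, of "dec u (int n) h" u] nn twist_pow[OF k, of n h] by force
    have "dfox z (Fg u [^]\<^bsub>L\<^esub> n) (k, h) =
        dfox z (Fg u [^]\<^bsub>L\<^esub> n) (p u' \<otimes>\<^bsub>G\<^esub> k, dec u' 1 h)"
      using dfox_mult[of "Fg u [^]\<^bsub>L\<^esub> n" "Fg u'" z "(k, h)"] dfox_mult[of "Fg u'" "Fg u [^]\<^bsub>L\<^esub> n" z "(k, h)"]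
        comm z1 z2 Fc twist_Fg[OF u(2) k] by simp
    then show ?thesis using uV by (simp add: csol_def n_def)
  qed
  have iter: "csol z u N (p u' [^]\<^bsub>G\<^esub> n \<otimes>\<^bsub>G\<^esub> k, dec u' (int n) h) = csol z u N (k, h)" for n :: nat
  proof (induction n)
    case 0
    then show ?case using k by simp
  next
    case (Suc n)
    have "csol z u N (p u' [^]\<^bsub>G\<^esub> n \<otimes>\<^bsub>G\<^esub> k, dec u' (int n) h) =
        csol z u N (p u' \<otimes>\<^bsub>G\<^esub> (p u' [^]\<^bsub>G\<^esub> n \<otimes>\<^bsub>G\<^esub> k), dec u' (int n + 1) h)"
      using step[of "p u' [^]\<^bsub>G\<^esub> n \<otimes>\<^bsub>G\<^esub> k" "dec u' (int n) h"] k pu uV h by simp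
    moreover have "p u' \<otimes>\<^bsub>G\<^esub> (p u' [^]\<^bsub>G\<^esub> n \<otimes>\<^bsub>G\<^esub> k) = p u' [^]\<^bsub>G\<^esub> Suc n \<otimes>\<^bsub>G\<^esub> k"
      using dn.nat_pow_Suc2[of "p u'" n] pu k by (simp add: dn.m_assoc del: dn.nat_pow_Suc)
    ultimately show ?case using Suc by (simp add: algebra_simps del: dn.nat_pow_Suc)
  qed
  \<comment> \<open>Far enough to push the coordinate \<open>u'\<close> below \<open>- N\<close>,
    where \<open>csol_support\<close> rules out a nonzero value.\<close>
  define n where "n = nat (h u' + N + 1)"
  have "csol z u N (p u' [^]\<^bsub>G\<^esub> n \<otimes>\<^bsub>G\<^esub> k, dec u' (int n) h) \<noteq> 0"
    using iter nz by simp
  then have "\<bar>(dec u' (int n) h) u'\<bar> \<le> N"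
    using csol_support[OF u(1) N(1), of "p u' [^]\<^bsub>G\<^esub> n \<otimes>\<^bsub>G\<^esub> k"] k pu uV
    by (metis dn.m_closed dn.nat_pow_closed)
  then show False unfolding dec_simps(1) n_def by linarith
qed

section \<open>Bounded solutions and their propagation along edges\<close>

text \<open>The equation says that the derivative of \<open>Fg u\<close> is
  \<open>(1 - Fg u) c\<close>.\<close>

definition sol :: "'w \<Rightarrow> 'w \<Rightarrow> (('v \<times> bool) list set \<times> ('w \<Rightarrow> int) \<Rightarrow> int) \<Rightarrow> bool" where
  "sol z u c \<longleftrightarrow> (\<exists>N. bdd (\<phi> z) N c) \<and> (\<forall>k\<in>carrier G. \<forall>h.
     dfox z (Fg u) (k, h) = c (k, h) - c (p u \<otimes>\<^bsub>G\<^esub> k, dec u 1 h))"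

text \<open>\<open>csol\<close> solves the equation for any vertex off \<open>z\<close>; the
  neighbour \<open>u'\<close> is what makes it bounded, through \<open>csol_eq_0\<close>.\<close>

lemma sol_exists:
  assumes u: "off z u" "off z u'" and E: "EL u u'"
  shows "\<exists>c. sol z u c"
proof -
  obtain N1 N2 where N12: "bdd (\<phi> z) N1 (dfox z (Fg u))" "bdd (\<phi> z) N2 (dfox z (Fg u'))" "N1 \<ge> 0"
    using bdd_dfox Fg_closed off_V u by meson
  define N where "N = max N1 N2"
  have N: "bdd (\<phi> z) N (dfox z (Fg u))" "bdd (\<phi> z) N (dfox z (Fg u'))" "N \<ge> 0"
    using bdd_mono[OF N12(1)] bdd_mono[OF N12(2)] N12(3) by (auto simp: N_def)
  have "bdd (\<phi> z) (3 * N) (csol z u N)"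
    unfolding bdd_def
  proof (intro ballI allI impI)
    fix k h assume k: "k \<in> carrier G" and nz: "csol z u N (k, h) \<noteq> 0"
    obtain j :: nat where j: "int j \<le> N + h u" "\<bar>h u - int j\<bar> \<le> N" "\<And>y. y \<noteq> u \<Longrightarrow> \<bar>h y\<bar> \<le> N"
      "\<And>y. y \<notin> VL \<Longrightarrow> h y = 0" "\<And>w. \<not> EG (\<phi> z) w \<Longrightarrow> \<bar>dn.expo w k - int j * of_bool (\<phi> u = w)\<bar> \<le> N"
      using csol_support[OF u(1) N(1) k nz] by blast
    have hu: "h u \<le> N" using csol_eq_0[OF u E N(1,2) k] nz by force
    \<comment> \<open>From \<open>h u \<le> N\<close> follows \<open>j \<le> 2 * N\<close>; undoing
      \<open>j\<close> steps costs at most that much beyond the bound \<open>N\<close>.\<close>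
    have "\<bar>h y\<bar> \<le> 3 * N" for y using j(1,2) j(3)[of y] hu N(3) by (cases "y = u") auto
    moreover have "\<bar>dn.expo w k\<bar> \<le> 3 * N" if "\<not> EG (\<phi> z) w" for w
      using j(5)[OF that] j(1) hu N(3) by (cases "\<phi> u = w") auto
    ultimately show "(\<forall>y. \<bar>h y\<bar> \<le> 3 * N) \<and> (\<forall>y. y \<notin> VL \<longrightarrow> h y = 0) \<and>
        (\<forall>w. \<not> EG (\<phi> z) w \<longrightarrow> \<bar>dn.expo w k\<bar> \<le> 3 * N)" using j(4) by blast
  qed
  then show ?thesis using csol_eq[OF u(1) N(1)] unfolding sol_def by blast
qed

text \<open>A nonzero value would be carried along an orbit on which the coordinate \<open>u\<close>
  is unbounded. In particular bounded solutions are unique.\<close>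

lemma bdd_invariant_zero:
  assumes u: "off z u" and m: "bdd (\<phi> z) N m"
    and inv: "\<And>k h. k \<in> carrier G \<Longrightarrow> m (k, h) = m (p u \<otimes>\<^bsub>G\<^esub> k, dec u 1 h)"
    and k: "k \<in> carrier G"
  shows "m (k, h) = 0"
proof (rule ccontr)
  assume nz: "m (k, h) \<noteq> 0"
  have pu: "p u \<in> carrier G" using p_closed off_V u by blast
  have iter: "m (p u [^]\<^bsub>G\<^esub> n \<otimes>\<^bsub>G\<^esub> k, dec u (int n) h) = m (k, h)" for n :: nat
  proof (induction n)
    case 0
    then show ?case using k by simp
  next
    case (Suc n)
    have "p u \<otimes>\<^bsub>G\<^esub> (p u [^]\<^bsub>G\<^esub> n \<otimes>\<^bsub>G\<^esub> k) = p u [^]\<^bsub>G\<^esub> Suc n \<otimes>\<^bsub>G\<^esub> k"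
      using dn.nat_pow_Suc2[of "p u" n] pu k by (simp add: dn.m_assoc del: dn.nat_pow_Suc)
    then show ?case using Suc inv[of "p u [^]\<^bsub>G\<^esub> n \<otimes>\<^bsub>G\<^esub> k" "dec u (int n) h"] k pu
      by (simp add: algebra_simps del: dn.nat_pow_Suc)
  qed
  define n where "n = nat (h u + N + 1)"
  have nz': "m (p u [^]\<^bsub>G\<^esub> n \<otimes>\<^bsub>G\<^esub> k, dec u (int n) h) \<noteq> 0" using iter nz by simp
  have "p u [^]\<^bsub>G\<^esub> n \<otimes>\<^bsub>G\<^esub> k \<in> carrier G" using pu k by simp
  then have "\<bar>(dec u (int n) h) u\<bar> \<le> N"
    using bddD(1)[OF m _ nz'] by blast
  then show False unfolding dec_simps(1) n_def by linarith
qed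

text \<open>Differentiating \<open>Fg u \<otimes> Fg u' = Fg u' \<otimes> Fg u\<close> shows that
  the defect \<open>m\<close> of the equation for \<open>u'\<close> is invariant under the step of
  \<open>Fg u\<close>; being bounded, it is zero.\<close>

lemma sol_transfer:
  assumes u: "off z u" "off z u'" and E: "EL u u'" and c: "sol z u c"
  shows "sol z u' c"
proof -
  have uV: "u \<in> VL" "u' \<in> VL" "u \<noteq> u'" using off_V u E up.E_irrefl by auto
  have pu: "p u \<in> carrier G" "p u' \<in> carrier G" using p_closed uV by auto
  have Fc: "Fg u \<in> carrier L" "Fg u' \<in> carrier L" using Fg_closed uV by auto
  obtain N where N: "bdd (\<phi> z) N c" using c unfolding sol_def by blast
  obtain N' where N': "bdd (\<phi> z) N' (dfox z (Fg u'))" using bdd_dfox Fc by blast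
  have ceq: "dfox z (Fg u) (k, h) = c (k, h) - c (p u \<otimes>\<^bsub>G\<^esub> k, dec u 1 h)" if "k \<in> carrier G" for k h
    using c that unfolding sol_def by blast
  define c' where "c' y = c (twist z (inv\<^bsub>L\<^esub> (Fg u')) y)" for y
  define m where "m y = dfox z (Fg u') y - c y + c' y" for y
  have "bdd (\<phi> z) (N + 1) c'"
    unfolding c'_def using Fc F_expo uV ind_Fg f_expo f_gen_closed
    by (intro bdd_twist[OF N]) auto
  moreover have "bdd (\<phi> z) (max N' N) (\<lambda>y. dfox z (Fg u') y - c y)"
    by (rule bdd_combine[OF N' N]) auto
  ultimately have bm: "bdd (\<phi> z) (max (N + 1) (max N' N)) m"
    by (rule bdd_combine) (auto simp: m_def)
  have c'eq: "c' (k, h) = c (p u' \<otimes>\<^bsub>G\<^esub> k, dec u' 1 h)" if "k \<in> carrier G" for k h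
    using twist_Fg[OF u(2) that] by (simp add: c'_def)
  have pcomm: "p u \<otimes>\<^bsub>G\<^esub> p u' = p u' \<otimes>\<^bsub>G\<^esub> p u"
  proof -
    have "ind (Fg u \<otimes>\<^bsub>L\<^esub> Fg u') = ind (Fg u' \<otimes>\<^bsub>L\<^esub> Fg u)" using Fg_commute[OF E] by simp
    then show ?thesis using Fc uV f_gen_closed
      by (simp add: ind_Fg p_def flip: dn.inv_mult_group)
  qed
  have minv: "m (k, h) = m (p u \<otimes>\<^bsub>G\<^esub> k, dec u 1 h)" if k: "k \<in> carrier G" for k h
  proof -
    have "dfox z (Fg u) (k, h) + dfox z (Fg u') (p u \<otimes>\<^bsub>G\<^esub> k, dec u 1 h) =
        dfox z (Fg u') (k, h) + dfox z (Fg u) (p u' \<otimes>\<^bsub>G\<^esub> k, dec u' 1 h)"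
      using dfox_mult[of "Fg u" "Fg u'" z "(k, h)"] dfox_mult[of "Fg u'" "Fg u" z "(k, h)"]
        Fg_commute[OF E] Fc twist_Fg[OF u(1) k] twist_Fg[OF u(2) k] by simp
    moreover have "p u \<otimes>\<^bsub>G\<^esub> (p u' \<otimes>\<^bsub>G\<^esub> k) = p u' \<otimes>\<^bsub>G\<^esub> (p u \<otimes>\<^bsub>G\<^esub> k)"
      using pcomm pu k by (simp flip: dn.m_assoc)
    moreover have "dec u 1 (dec u' 1 h) = dec u' 1 (dec u 1 h)"
      by (rule dec_commute)
    ultimately show ?thesis
      using ceq[OF k] ceq[of "p u' \<otimes>\<^bsub>G\<^esub> k" "dec u' 1 h"] c'eq[OF k]
        c'eq[of "p u \<otimes>\<^bsub>G\<^esub> k" "dec u 1 h"] k pu uV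
      by (simp add: m_def)
  qed
  have zero: "m (k, h) = 0" if "k \<in> carrier G" for k h
    using bdd_invariant_zero[OF u(1) bm minv that] .
  have "dfox z (Fg u') (k, h) = c (k, h) - c (p u' \<otimes>\<^bsub>G\<^esub> k, dec u' 1 h)"
    if "k \<in> carrier G" for k h
    using zero[OF that, of h] unfolding m_def c'eq[OF that] by simp
  then show ?thesis using N unfolding sol_def by blast
qed

text \<open>The case \<open>u = u'\<close> is kept apart because \<open>sol_exists\<close> yields a
  solution only for a vertex with a neighbour off \<open>z\<close>; a nontrivial path supplies
  one.\<close>

lemma conn_sol:
  assumes "conn z u u'"
  shows "u = u' \<or> off z u' \<and> (\<exists>c. sol z u c \<and> sol z u' c)"
  using assms unfolding conn_def
proof (induction rule: rtranclp_induct)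
  case base
  then show ?case by simp
next
  case (step v w)
  then have vw: "EL v w" "off z v" "off z w" by auto
  obtain c where "sol z v c" using sol_exists[OF vw(2,3,1)] by blast
  then have "\<exists>c. sol z v c \<and> sol z u c"
    using step.IH by auto
  then show ?case using sol_transfer[OF vw(2,3,1)] vw by blast
qed

section \<open>Limits along powers\<close>

text \<open>Summing out the exponents turns the equation of \<open>sol\<close> into a telescoping
  sum over powers.\<close>

lemma eta_pow:
  assumes u: "off z u" and c: "sol z u c" and k: "k \<in> carrier G"
  shows "eta z (Fg u [^]\<^bsub>L\<^esub> (n :: nat)) k = tot c k - tot c (p u [^]\<^bsub>G\<^esub> n \<otimes>\<^bsub>G\<^esub> k)"
  using k
proof (induction n arbitrary: k)
  case 0
  then show ?case using eta_mult[of "\<one>\<^bsub>L\<^esub>" "\<one>\<^bsub>L\<^esub>" k z] by simp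
next
  case (Suc n)
  have uV: "u \<in> VL" using off_V u by simp
  have pu: "p u \<in> carrier G" and Fc: "Fg u \<in> carrier L" using p_closed Fg_closed uV by auto
  obtain N where N: "bdd (\<phi> z) N c" using c unfolding sol_def by blast
  define c' where "c' y = c (twist z (inv\<^bsub>L\<^esub> (Fg u)) y)" for y
  have bc': "bdd (\<phi> z) (N + 1) c'"
    unfolding c'_def using Fc F_expo uV ind_Fg f_expo f_gen_closed
    by (intro bdd_twist[OF N]) auto
  have "eta z (Fg u) k = tot c k + (- 1) * tot c' k"
    unfolding eta_def using c twist_Fg[OF u Suc.prems] Suc.prems
    by (intro tot_add[OF N bc']) (auto simp: sol_def c'_def)
  moreover have "tot c' k = tot c (p u \<otimes>\<^bsub>G\<^esub> k)"
    unfolding c'_def using tot_twist[OF Suc.prems] Fc ind_Fg uV by (simp add: p_def)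
  moreover have "eta z (Fg u [^]\<^bsub>L\<^esub> Suc n) k = eta z (Fg u) k + eta z (Fg u [^]\<^bsub>L\<^esub> n) (p u \<otimes>\<^bsub>G\<^esub> k)"
    using up.nat_pow_Suc2[of "Fg u" n] Fc Suc.prems eta_mult ind_Fg uV
    by (simp add: p_def del: up.nat_pow_Suc)
  ultimately show ?case using Suc.IH[of "p u \<otimes>\<^bsub>G\<^esub> k"] Suc.prems pu by (simp add: dn.m_assoc)
qed

lemma tot_vanishes:
  assumes u: "u \<in> VL" "\<not> EG (\<phi> z) (\<phi> u)" and c: "bdd (\<phi> z) N c" and k: "k \<in> carrier G"
  shows "\<forall>\<^sub>F n in sequentially. tot c (p u [^]\<^bsub>G\<^esub> (n :: nat) \<otimes>\<^bsub>G\<^esub> k) = 0"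
proof -
  have pu: "p u \<in> carrier G" using p_closed u by auto
  have "tot c (p u [^]\<^bsub>G\<^esub> n \<otimes>\<^bsub>G\<^esub> k) = 0" if n: "n \<ge> nat (N + \<bar>dn.expo (\<phi> u) k\<bar> + 1)" for n :: nat
  proof -
    have "c (p u [^]\<^bsub>G\<^esub> n \<otimes>\<^bsub>G\<^esub> k, h) = 0" for h
    proof (rule ccontr)
      assume nz: "c (p u [^]\<^bsub>G\<^esub> n \<otimes>\<^bsub>G\<^esub> k, h) \<noteq> 0"
      have "p u [^]\<^bsub>G\<^esub> n \<otimes>\<^bsub>G\<^esub> k \<in> carrier G" using pu k by simp
      from bddD(3)[OF c this nz u(2)] have "\<bar>dn.expo (\<phi> u) k - int n\<bar> \<le> N"
        using pu k p_expo[OF u(1)] by simp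
      then show False using n by linarith
    qed
    then show ?thesis by (simp add: tot_def)
  qed
  then show ?thesis unfolding eventually_sequentially by blast
qed

text \<open>Since \<open>w\<close> differs from \<open>x\<close>, the derivative of
  \<open>f (gen w)\<close> is \<open>(1 - f (gen w))\<close> applied to that of \<open>g w\<close>.
  Powers telescope, and the far end disappears by \<open>fox_vanishes\<close>.\<close>

lemma fox_pow_limit:
  assumes w: "w \<in> VG" "w \<noteq> x" "\<not> EG x w" and k: "k \<in> carrier G"
  shows "\<forall>\<^sub>F n in sequentially. dn.fox x (f (dn.gen w) [^]\<^bsub>G\<^esub> (n :: nat)) k = dn.fox x (g w) k"
proof -
  define q where "q = inv\<^bsub>G\<^esub> (f (dn.gen w))"
  have q: "q \<in> carrier G" "f (dn.gen w) \<in> carrier G" using f_gen_closed w by (auto simp: q_def)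
  have step: "dn.fox x (f (dn.gen w)) k = dn.fox x (g w) k - dn.fox x (g w) (q \<otimes>\<^bsub>G\<^esub> k)"
    if "k \<in> carrier G" for k
  proof -
    have "q \<otimes>\<^bsub>G\<^esub> k = g w \<otimes>\<^bsub>G\<^esub> (inv\<^bsub>G\<^esub> dn.gen w \<otimes>\<^bsub>G\<^esub> (inv\<^bsub>G\<^esub> (g w) \<otimes>\<^bsub>G\<^esub> k))"
      using f_gen w g_closed that by (simp add: q_def dn.inv_mult_group dn.m_assoc)
    then show ?thesis
      using f_gen[OF w(1)] w g_closed that
      by (simp add: dn.fox_mult dn.fox_gen dn.fox_inv dn.m_assoc dn.inv_mult_group)
  qed
  have "dn.fox x (f (dn.gen w) [^]\<^bsub>G\<^esub> (n :: nat)) k = dn.fox x (g w) k - dn.fox x (g w) (q [^]\<^bsub>G\<^esub> n \<otimes>\<^bsub>G\<^esub> k)" for n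
    using k
  proof (induction n arbitrary: k)
    case 0
    then show ?case by simp
  next
    case (Suc n)
    have "dn.fox x (f (dn.gen w) [^]\<^bsub>G\<^esub> Suc n) k =
        dn.fox x (f (dn.gen w)) k + dn.fox x (f (dn.gen w) [^]\<^bsub>G\<^esub> n) (q \<otimes>\<^bsub>G\<^esub> k)"
      using dn.nat_pow_Suc2[of "f (dn.gen w)" n] q Suc.prems
      by (simp add: dn.fox_mult q_def del: dn.nat_pow_Suc)
    then show ?case using Suc.IH[of "q \<otimes>\<^bsub>G\<^esub> k"] step[OF Suc.prems] Suc.prems q
      by (simp add: dn.m_assoc)
  qed
  moreover have "\<forall>\<^sub>F n in sequentially. dn.fox x (g w) (q [^]\<^bsub>G\<^esub> (n :: nat) \<otimes>\<^bsub>G\<^esub> k) = 0"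
    using dn.fox_vanishes[of "g w" q k x w] w g_closed q k f_expo
    by (simp add: q_def)
  ultimately show ?thesis by simp
qed

text \<open>For each \<open>z\<close> over \<open>x\<close> the two vertices share a solution, so
  high powers of their images have the same \<open>eta\<close>. Summed over the fibre, these powers
  have derivatives that tend to those of \<open>g (\<phi> u)\<close> and
  \<open>g (\<phi> u')\<close>.\<close>

lemma fox_conn:
  assumes u: "u \<in> VL" "\<phi> u \<noteq> x" "\<not> EG x (\<phi> u)" and u': "u' \<in> VL" "\<phi> u' \<noteq> x" "\<not> EG x (\<phi> u')"
    and conn: "\<And>z. z \<in> fib x \<Longrightarrow> conn z u u'" and k: "k \<in> carrier G"
  shows "dn.fox x (g (\<phi> u)) k = dn.fox x (g (\<phi> u')) k"
proof -
  have eta_ev: "\<forall>\<^sub>F n in sequentially. eta z (Fg u [^]\<^bsub>L\<^esub> (n :: nat)) k = eta z (Fg u' [^]\<^bsub>L\<^esub> n) k"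
    if z: "z \<in> fib x" for z
  proof (cases "u = u'")
    case True
    then show ?thesis by simp
  next
    case False
    have zx: "\<phi> z = x" using z by (simp add: fib_def)
    have off: "off z u" "off z u'" using u u' zx \<phi>_E by (auto simp: off_def)
    obtain c where c: "sol z u c" "sol z u' c" using conn_sol[OF conn[OF z]] False by blast
    obtain N where N: "bdd (\<phi> z) N c" using c unfolding sol_def by blast
    have "\<forall>\<^sub>F n in sequentially. tot c (p u [^]\<^bsub>G\<^esub> (n :: nat) \<otimes>\<^bsub>G\<^esub> k) = 0"
      "\<forall>\<^sub>F n in sequentially. tot c (p u' [^]\<^bsub>G\<^esub> (n :: nat) \<otimes>\<^bsub>G\<^esub> k) = 0"
      using tot_vanishes[OF _ _ N k] u u' zx by auto
    then show ?thesis
      by eventually_elim (simp add: eta_pow[OF off(1) c(1) k] eta_pow[OF off(2) c(2) k])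
  qed
  have sum: "(\<Sum>z\<in>fib x. eta z (Fg v [^]\<^bsub>L\<^esub> (n :: nat)) k) = dn.fox x (f (dn.gen (\<phi> v)) [^]\<^bsub>G\<^esub> n) k"
    if "v \<in> VL" for v n
    using sum_fib_eta[of "Fg v [^]\<^bsub>L\<^esub> n" k x] Fg_closed[OF that] k ind_Fg[OF that]
    by (simp add: ind.hom_nat_pow)
  have "\<forall>\<^sub>F n in sequentially. \<forall>z\<in>fib x. eta z (Fg u [^]\<^bsub>L\<^esub> (n :: nat)) k = eta z (Fg u' [^]\<^bsub>L\<^esub> n) k"
    using eta_ev finite_fib by (simp add: eventually_ball_finite)
  moreover have "\<forall>\<^sub>F n in sequentially. dn.fox x (f (dn.gen (\<phi> u)) [^]\<^bsub>G\<^esub> (n :: nat)) k = dn.fox x (g (\<phi> u)) k"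
    "\<forall>\<^sub>F n in sequentially. dn.fox x (f (dn.gen (\<phi> u')) [^]\<^bsub>G\<^esub> (n :: nat)) k = dn.fox x (g (\<phi> u')) k"
    using fox_pow_limit u u' k by auto
  ultimately have "\<forall>\<^sub>F n :: nat in sequentially. dn.fox x (g (\<phi> u)) k = dn.fox x (g (\<phi> u')) k"
  proof eventually_elim
    case (elim n)
    have "dn.fox x (g (\<phi> u)) k = (\<Sum>z\<in>fib x. eta z (Fg u [^]\<^bsub>L\<^esub> n) k)"
      using sum[OF u(1)] elim(2) by simp
    also have "\<dots> = (\<Sum>z\<in>fib x. eta z (Fg u' [^]\<^bsub>L\<^esub> n) k)"
      using elim(1) by (intro sum.cong) auto
    also have "\<dots> = dn.fox x (g (\<phi> u')) k"
      using sum[OF u'(1)] elim(3) by simp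
    finally show ?case .
  qed
  then show ?thesis by simp
qed

end

context raag_cover
begin

section \<open>Generation by liftable partial conjugations\<close>

text \<open>By the product rule, whether \<open>g w\<close> lies in the half-space is decided by one
  value of its derivative with respect to \<open>x\<close> and a term that depends on
  \<open>x\<close> alone; \<open>fox_conn\<close> says that this value is constant on
  classes.\<close>

lemma saturated_half_space:
  assumes f: "f \<in> auto G" "conjugating VG EG f" "liftable VL EL VG EG \<phi> f"
    and g: "\<And>w. w \<in> VG \<Longrightarrow> g w \<in> carrier G"
    and fg: "\<And>w. w \<in> VG \<Longrightarrow> f (dn.gen w) = g w \<otimes>\<^bsub>G\<^esub> dn.gen w \<otimes>\<^bsub>G\<^esub> inv\<^bsub>G\<^esub> (g w)"
    and x: "x \<in> VG"
  shows "saturated x {w \<in> VG. w \<notin> star VG EG x \<and> g w \<in> dn.hs_at (g x) x b}"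
proof -
  obtain F where F: "F \<in> hom L L" "\<And>a. a \<in> carrier L \<Longrightarrow> ind (F a) = f (ind a)"
    "\<And>y a. y \<in> VL \<Longrightarrow> a \<in> carrier L \<Longrightarrow> up.expo y (F a) = up.expo y a"
    using homology_trivial_lift[OF f] by metis
  interpret conj_lift VL EL L VG EG G \<phi> f g F
    by unfold_locales (use dn.auto_hom[OF f(1)] g fg F in auto)
  have "g (\<phi> u') \<in> dn.hs_at (g x) x b"
    if u: "u \<in> VL" "u' \<in> VL" "\<phi> u \<notin> star VG EG x" "\<phi> u' \<notin> star VG EG x"
      "\<forall>z\<in>fib x. conn z u u'" "g (\<phi> u) \<in> dn.hs_at (g x) x b" for u u'
  proof -
    \<comment> \<open>The coset at which \<open>hs x b\<close> reads the derivative.\<close>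
    define k0 where "k0 = (if b then \<one>\<^bsub>G\<^esub> else inv\<^bsub>G\<^esub> dn.gen x)"
    have k0: "k0 \<in> carrier G" using x by (simp add: k0_def)
    have "dn.fox x (g (\<phi> u)) (g x \<otimes>\<^bsub>G\<^esub> k0) = dn.fox x (g (\<phi> u')) (g x \<otimes>\<^bsub>G\<^esub> k0)"
      using fox_conn[of u x u'] u g x k0 by (auto simp: dn.star_eq)
    then show ?thesis
      using u g x k0 by (simp add: dn.hs_at_def dn.hs_def dn.fox_mult flip: k0_def)
  qed
  then show ?thesis unfolding saturated_def by auto
qed

lemma LPAut_eq:
  "LPAut VL EL VG EG \<phi> = {f \<in> auto G. conjugating VG EG f \<and> liftable VL EL VG EG \<phi> f}"
  by (simp add: LPAut_def dn.G_def)

abbreviation liftable_partial_conjugations where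
  "liftable_partial_conjugations \<equiv> {f \<in> partial_conjugations VG EG. liftable VL EL VG EG \<phi> f}"

lemma liftable_partial_conjugations_subset:
  "liftable_partial_conjugations \<subseteq> LPAut VL EL VG EG \<phi>"
  using dn.partial_conj_conjugating
  by (auto simp: LPAut_eq partial_conjugations_def is_partial_conj_def dn.G_def)

lemma generate_subset_LPAut:
  "generate (AutoGroup G) liftable_partial_conjugations \<subseteq> LPAut VL EL VG EG \<phi>"
proof
  fix f assume "f \<in> generate (AutoGroup G) liftable_partial_conjugations"
  then show "f \<in> LPAut VL EL VG EG \<phi>"
  proof induction
    case one
    then show ?case
      using dn.id_in_auto dn.conjugating_id liftable_id unfolding LPAut_eq dn.auto_one by blast
  next
    case (incl h)
    then show ?case using liftable_partial_conjugations_subset by blast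
  next
    case (inv h)
    then have "h \<in> LPAut VL EL VG EG \<phi>" using liftable_partial_conjugations_subset by blast
    then show ?case
      using dn.auto_inv_auto dn.conjugating_inv liftable_inv by (simp add: LPAut_eq)
  next
    case (eng h1 h2)
    then show ?case
      using dn.auto_compose_auto dn.conjugating_compose liftable_compose
      by (simp add: LPAut_eq dn.auto_compose)
  qed
qed

text \<open>Induction on the total conjugator length: the set of vertices beyond a hyperplane is
  saturated, so the shortening partial conjugation exists, lifts, and can be split off from
  \<open>f\<close>.\<close>

lemma LPAut_subset_generate:
  "f \<in> LPAut VL EL VG EG \<phi> \<Longrightarrow> f \<in> generate (AutoGroup G) liftable_partial_conjugations"
proof (induction "\<Sum>w\<in>VG. dn.conj_len f w" arbitrary: f rule: less_induct)
  case less
  have f: "f \<in> auto G" "conjugating VG EG f" "liftable VL EL VG EG \<phi> f"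
    using less.prems by (auto simp: LPAut_eq)
  show ?case
  proof (cases "\<forall>v\<in>VG. f (dn.gen v) = dn.gen v")
    case True
    then have "f = (\<lambda>a\<in>carrier G. a)"
      using dn.auto_eqI[OF f(1) dn.id_in_auto] by simp
    then show ?thesis using generate.one[of "AutoGroup G"] by (simp add: dn.auto_one)
  next
    case False
    then have nontriv: "\<exists>v\<in>VG. f (dn.gen v) \<noteq> dn.gen v" by blast
    obtain g x b where x: "x \<in> VG" and g: "\<And>w. w \<in> VG \<Longrightarrow> g w \<in> carrier G"
      and fg: "\<And>w. w \<in> VG \<Longrightarrow> f (dn.gen w) = g w \<otimes>\<^bsub>G\<^esub> dn.gen w \<otimes>\<^bsub>G\<^esub> inv\<^bsub>G\<^esub> (g w)"
      and short: "\<And>P. P \<in> hom G G \<Longrightarrow> (\<And>w. w \<in> VG \<Longrightarrow> P (dn.gen w) =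
        (if w \<notin> star VG EG x \<and> g w \<in> dn.hs_at (g x) x b
         then dn.letter (x, \<not> b) \<otimes>\<^bsub>G\<^esub> dn.gen w \<otimes>\<^bsub>G\<^esub> dn.letter (x, b) else dn.gen w)) \<Longrightarrow>
        (\<Sum>w\<in>VG. dn.conj_len (\<lambda>a. f (P a)) w) < (\<Sum>w\<in>VG. dn.conj_len f w)"
      apply (rule dn.conj_shorten[OF dn.auto_hom[OF f(1)] dn.auto_surj[OF f(1)] f(2) nontriv])
      subgoal for g x b by (rule that[of x g b]) blast+
      done
    define C where "C = {w \<in> VG. w \<notin> star VG EG x \<and> g w \<in> dn.hs_at (g x) x b}"
    have C: "saturated x C" unfolding C_def by (rule saturated_half_space[OF f g fg x])
    have comp: "w \<in> C \<longleftrightarrow> w' \<in> C"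
      if "EG w w'" "w \<notin> star VG EG x" "w' \<notin> star VG EG x" for w w'
      using saturated_components[OF C] that dn.E_V[OF that(1)] dn.E_sym
      unfolding union_of_components_compl_star_def by blast
    obtain P where P: "P \<in> auto G" "\<And>w. w \<in> VG \<Longrightarrow> P (dn.gen w) =
      dn.gen x [^]\<^bsub>G\<^esub> (of_bool (w \<in> C) :: int) \<otimes>\<^bsub>G\<^esub> dn.gen w \<otimes>\<^bsub>G\<^esub> dn.gen x [^]\<^bsub>G\<^esub> (- of_bool (w \<in> C) :: int)"
      by (rule dn.graded_conj_exists[OF x, of "\<lambda>w. of_bool (w \<in> C)"]) (use comp in auto)
    have P_gen: "P (dn.gen w) = (if w \<in> C then dn.gen x \<otimes>\<^bsub>G\<^esub> dn.gen w \<otimes>\<^bsub>G\<^esub> inv\<^bsub>G\<^esub> dn.gen x else dn.gen w)"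
      if "w \<in> VG" for w
      using P(2)[OF that] x that by (auto simp: dn.int_pow_neg dn.int_pow_1)
    have "is_partial_conj VG EG x C P"
      using P(1) P_gen by (simp add: is_partial_conj_def dn.G_def)
    then have P_in: "P \<in> liftable_partial_conjugations"
      using saturated_liftable[OF x C P] saturated_components[OF C] x
      by (auto simp: partial_conjugations_def)
    \<comment> \<open>Shortening calls for conjugation by \<open>letter (x, \<not> b)\<close>, which
      is \<open>inv gen x\<close> for true \<open>b\<close>; hence the inverse of \<open>P\<close>
      in that case.\<close>
    define Q where "Q = (if b then inv\<^bsub>AutoGroup G\<^esub> P else P)"
    have Q_gen: "Q \<in> generate (AutoGroup G) liftable_partial_conjugations"
      using generate.incl[OF P_in, of "AutoGroup G"] generate.inv[OF P_in, of "AutoGroup G"] by (simp add: Q_def)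
    then have Q: "Q \<in> auto G" "conjugating VG EG Q" "liftable VL EL VG EG \<phi> Q"
      using generate_subset_LPAut by (auto simp: LPAut_eq)
    have inv_gen: "(inv\<^bsub>AutoGroup G\<^esub> P) (dn.gen w) =
        (if w \<in> C then inv\<^bsub>G\<^esub> dn.gen x \<otimes>\<^bsub>G\<^esub> dn.gen w \<otimes>\<^bsub>G\<^esub> dn.gen x else dn.gen w)" if w: "w \<in> VG" for w
    proof -
      interpret P: group_hom G G P using dn.auto_hom[OF P(1)] by (simp add: group_hom_def group_hom_axioms_def dn.is_group)
      have "x \<notin> C" by (simp add: C_def dn.star_eq)
      then have "P (dn.gen x) = dn.gen x" using P_gen[OF x] by simp
      then have "P (if w \<in> C then inv\<^bsub>G\<^esub> dn.gen x \<otimes>\<^bsub>G\<^esub> dn.gen w \<otimes>\<^bsub>G\<^esub> dn.gen x else dn.gen w) = dn.gen w"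
        using P_gen[OF w] x w by (simp add: dn.m_assoc dn.inv_cancel)
      then show ?thesis
        using dn.auto_inv(2)[OF P(1), of "if w \<in> C then inv\<^bsub>G\<^esub> dn.gen x \<otimes>\<^bsub>G\<^esub> dn.gen w \<otimes>\<^bsub>G\<^esub> dn.gen x else dn.gen w"] x w
        by (auto split: if_splits)
    qed
    define f' where "f' = compose (carrier G) f Q"
    have f': "f' \<in> LPAut VL EL VG EG \<phi>"
      unfolding f'_def LPAut_eq
      using dn.auto_compose_auto dn.conjugating_compose liftable_compose f Q by simp
    have "(\<Sum>w\<in>VG. dn.conj_len (\<lambda>a. f (Q a)) w) < (\<Sum>w\<in>VG. dn.conj_len f w)"
    proof (rule short[OF dn.auto_hom[OF Q(1)]])
      fix w assume w: "w \<in> VG"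
      show "Q (dn.gen w) = (if w \<notin> star VG EG x \<and> g w \<in> dn.hs_at (g x) x b
         then dn.letter (x, \<not> b) \<otimes>\<^bsub>G\<^esub> dn.gen w \<otimes>\<^bsub>G\<^esub> dn.letter (x, b) else dn.gen w)"
        using inv_gen[OF w] P_gen[OF w] w by (cases b) (auto simp: Q_def C_def)
    qed
    moreover have "dn.conj_len f' w = dn.conj_len (\<lambda>a. f (Q a)) w" if "w \<in> VG" for w
      using that by (simp add: f'_def dn.conj_len_def compose_eq)
    ultimately have f'_in: "f' \<in> generate (AutoGroup G) liftable_partial_conjugations"
      using less.hyps[OF _ f'] by simp
    have invQ_in: "inv\<^bsub>AutoGroup G\<^esub> Q \<in> generate (AutoGroup G) liftable_partial_conjugations"
      using dn.aut.generate_m_inv_closed[OF _ Q_gen] liftable_partial_conjugations_subset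
      by (auto simp: dn.carrier_AutoGroup LPAut_eq)
    have "f = f' \<otimes>\<^bsub>AutoGroup G\<^esub> inv\<^bsub>AutoGroup G\<^esub> Q"
      using dn.aut.inv_solve_right[of f f' Q] f(1) f' Q(1)
      by (simp add: dn.carrier_AutoGroup dn.auto_compose f'_def LPAut_eq)
    then show ?thesis using generate.eng[OF f'_in invQ_in] by metis
  qed
qed

end

theorem theorem5p4:
  fixes VL :: "'w set" and EL :: "'w \<Rightarrow> 'w \<Rightarrow> bool"
    and VG :: "'v set" and EG :: "'v \<Rightarrow> 'v \<Rightarrow> bool" and \<phi> :: "'w \<Rightarrow> 'v"
  assumes "simple_graph VL EL" and "simple_graph VG EG"
    and "regular_covering VL EL VG EG \<phi>"
    and "no_isolated VG EG"
  shows "LPAut VL EL VG EG \<phi> =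
    generate (AutoGroup (RAAG VG EG))
      {f \<in> partial_conjugations VG EG. liftable VL EL VG EG \<phi> f}"
proof -
  interpret raag_cover VL EL "RAAG VL EL" VG EG "RAAG VG EG" \<phi>
    using assms by unfold_locales (auto simp: regular_covering_def)
  show ?thesis using generate_subset_LPAut LPAut_subset_generate by blast
qed

end
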